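(* Let $m\ge0$ and $l\ge1$ be fixed integers, let $X_1,X_2,\dots$ be a stationary sequence of $m$-dependent random variables, let $\mathcal D=(d_1,\dots,d_{l-1})$ with $d_j\in\mathbb{N}\cup\{\infty\}$, and let $f:\mathbb{R}^l\to\mathbb{R}$ be measurable (not necessarily symmetric). For each $n$, let $$U_n(f;\mathcal D)=\sum_{i\in\mathcal I}f_i,\qquad f_i=f(X_{i_1},\dots,X_{i_l}),$$ where $\mathcal I=\mathcal I_n$ is the set of $i=(i_1,\dots,i_l)$ with $1\le i_1<\dots<i_l\le n$ and $i_{j+1}-i_j\le d_j$ for $1\le j\le l-1$. Let $b=l-|\{k\in\{1,\dots,l-1\}:d_k<\infty\}|$. Assume that $\mathbb{E}|f_i|^4<\infty$ for all index vectors $i$ and that $$\lim_{n\to\infty}\frac{\mathrm{Var}(U_n(f;\mathcal D))}{n^{2b-1}}=\sigma_{f,\mathcal D}^2>0.$$ Then there is a positive constant $C_{m,l}$, depending on $m$, $l$, $f$ and $\mathcal D$ but not on $n$, such that for every $n$ with $\mathrm{Var}(U_n(f;\mathcal D))>0$, $$\sup_{z\in\mathbb{R}}|\mathbb{P}(W_1\le z)-\Phi(z)|\le C_{m,l}\Big(\frac{n^{-b-1/2}}{\sigma_{f,\mathcal D}^3}\sum_{i\in\mathcal I}\|f_i\|_4^3+\frac{n^{-b/2-1/2}}{\sigma_{f,\mathcal D}^2}\Big(\sum_{i\in\mathcal I}\|f_i\|_4^4\Big)^{1/2}\Big)$$ and $$\sup_{z\in\mathbb{R}}|\mathbb{P}(W_2\le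 z)-\Phi(z)|\le C_{m,l}\Big(\frac{n^{-b-1/2}}{\sigma_{f,\mathcal D}^3}\sum_{i\in\mathcal I}\|f_i\|_4^3+\frac{n^{-b/2-1/2}}{\sigma_{f,\mathcal D}^2}\Big(\sum_{i\in\mathcal I}\|f_i\|_4^4\Big)^{1/2}\Big)\cdot\frac{n^{-b}}{\sigma_{f,\mathcal D}^2}\sum_{i\in\mathcal I}\|f_i\|_2^2,$$ where $W_1$ and $W_2$ are the normalized and self-normalized statistics $$W_1=\frac{U_n(f;\mathcal D)-\mathbb{E}U_n(f;\mathcal D)}{\sqrt{\mathrm{Var}(U_n(f;\mathcal D))}},\qquad W_2=\frac{1}{V}\sum_{i\in\mathcal I}Z_i,\qquad V=\sqrt{\Big(\sum_{i\in\mathcal I}(Z_iY_i-\bar Z\bar Y)\Big)_+},$$ with $Z_i=f_i-\mathbb{E}f_i$ and $Y_i,\bar Z,\bar Y$ as defined in the context.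
   Context: $\Phi$ is the standard normal distribution function, $(x)_+=\max(x,0)$, $\|X\|_p=(\mathbb{E}|X|^p)^{1/p}$, $\mathbb{N}=\{1,2,\dots\}$. A sequence is $m$-dependent if $(X_i)_{i\le k}$ and $(X_i)_{i>k+m}$ are independent for every $k$. For $i=(i_1,\dots,i_l)\in\mathcal I$ let $s(i)=\{i_1,\dots,i_l\}$, and for $i,j\in\mathcal I$ let $|i-j|=\min_{p\in s(i),\,q\in s(j)}|p-q|$. Put $$A_{i1}=\{k\in\mathcal I:s(k)\cap s(i)\ne\varnothing\},\qquad A_{i2}=\{k\in\mathcal I:s(k)\cap s(i)=\varnothing,\ |i-k|\le m\},\qquad A_i=A_{i1}\cup A_{i2},$$ $Y_i=\sum_{k\in A_i}Z_k$, $\bar Z=\sum_{i\in\mathcal I}Z_i/|\mathcal I|$, $\bar Y=\sum_{i\in\mathcal I}Y_i/|\mathcal I|$. On the event $\{V=0\}$ the value of $W_2$ may be fixed by any convention. The constant $C_{m,l}$ is chosen after the sequence $(X_i)$, $f$ and $\mathcal D$ are fixed. *)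

theory Defs
  imports "HOL-Probability.Probability" "HOL-Library.Extended_Nat"
begin

text \<open>
  Sequences \<open>X\<^sub>1, X\<^sub>2, \<dots>\<close> are functions on \<^typ>\<open>nat\<close> whose value at \<open>0\<close> is never used.
  A point of \<open>\<real>\<^sup>l\<close> is an extensional function on \<open>{1..l}\<close>, so a measurable
  \<open>f : \<real>\<^sup>l \<rightarrow> \<real>\<close> is an element of \<open>borel_measurable (Pi\<^sub>M {1..l} (\<lambda>_. borel))\<close>.
  The constraint \<open>d\<^sub>j\<close> is \<open>d j\<close>; only its values at \<open>1 \<le> j \<le> l - 1\<close> are used.
\<close>

definition stationary :: "'a measure \<Rightarrow> (nat \<Rightarrow> 'a \<Rightarrow> real) \<Rightarrow> bool" where
  "stationary M X \<longleftrightarrow> (\<forall>k h.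
     distr M (Pi\<^sub>M {1..k} (\<lambda>_. borel)) (\<lambda>\<omega>. \<lambda>j\<in>{1..k}. X (j + h) \<omega>) =
     distr M (Pi\<^sub>M {1..k} (\<lambda>_. borel)) (\<lambda>\<omega>. \<lambda>j\<in>{1..k}. X j \<omega>))"

definition m_dependent :: "'a measure \<Rightarrow> nat \<Rightarrow> (nat \<Rightarrow> 'a \<Rightarrow> real) \<Rightarrow> bool" where
  "m_dependent M m X \<longleftrightarrow> (\<forall>k.
     prob_space.indep_var M
       (Pi\<^sub>M {1..k} (\<lambda>_. borel)) (\<lambda>\<omega>. \<lambda>i\<in>{1..k}. X i \<omega>)
       (Pi\<^sub>M {k + m<..} (\<lambda>_. borel)) (\<lambda>\<omega>. \<lambda>i\<in>{k + m<..}. X i \<omega>))"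

definition index_set :: "nat \<Rightarrow> (nat \<Rightarrow> enat) \<Rightarrow> nat \<Rightarrow> (nat \<Rightarrow> nat) set" where
  "index_set l d n = {i \<in> {1..l} \<rightarrow>\<^sub>E {1..n}. strict_mono_on {1..l} i \<and>
     (\<forall>j\<in>{1..l - 1}. enat (i (j + 1) - i j) \<le> d j)}"

definition block_number :: "nat \<Rightarrow> (nat \<Rightarrow> enat) \<Rightarrow> nat" where
  "block_number l d = l - card {k \<in> {1..l - 1}. d k < \<infinity>}"

definition supp :: "nat \<Rightarrow> (nat \<Rightarrow> nat) \<Rightarrow> nat set" where
  "supp l i = i ` {1..l}"

definition index_dist :: "nat \<Rightarrow> (nat \<Rightarrow> nat) \<Rightarrow> (nat \<Rightarrow> nat) \<Rightarrow> int" where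
  "index_dist l i j = Min ((\<lambda>(p, q). \<bar>int p - int q\<bar>) ` (supp l i \<times> supp l j))"

definition A1 :: "nat \<Rightarrow> (nat \<Rightarrow> enat) \<Rightarrow> nat \<Rightarrow> (nat \<Rightarrow> nat) \<Rightarrow> (nat \<Rightarrow> nat) set" where
  "A1 l d n i = {k \<in> index_set l d n. supp l k \<inter> supp l i \<noteq> {}}"

definition A2 :: "nat \<Rightarrow> nat \<Rightarrow> (nat \<Rightarrow> enat) \<Rightarrow> nat \<Rightarrow> (nat \<Rightarrow> nat) \<Rightarrow> (nat \<Rightarrow> nat) set" where
  "A2 m l d n i =
     {k \<in> index_set l d n. supp l k \<inter> supp l i = {} \<and> index_dist l i k \<le> int m}"

definition nbhd :: "nat \<Rightarrow> nat \<Rightarrow> (nat \<Rightarrow> enat) \<Rightarrow> nat \<Rightarrow> (nat \<Rightarrow> nat) \<Rightarrow> (nat \<Rightarrow> nat) set" where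
  "nbhd m l d n i = A1 l d n i \<union> A2 m l d n i"

definition Lp_norm :: "'a measure \<Rightarrow> real \<Rightarrow> ('a \<Rightarrow> real) \<Rightarrow> real" where
  "Lp_norm M p Y = (\<integral>\<omega>. \<bar>Y \<omega>\<bar> powr p \<partial>M) powr (1 / p)"

definition std_normal_cdf :: "real \<Rightarrow> real" where
  "std_normal_cdf = cdf std_normal_distribution"

definition fI ::
  "nat \<Rightarrow> ((nat \<Rightarrow> real) \<Rightarrow> real) \<Rightarrow> (nat \<Rightarrow> 'a \<Rightarrow> real) \<Rightarrow> (nat \<Rightarrow> nat) \<Rightarrow> 'a \<Rightarrow> real" where
  "fI l f X i \<omega> = f (\<lambda>j\<in>{1..l}. X (i j) \<omega>)"

definition U_stat ::
  "nat \<Rightarrow> (nat \<Rightarrow> enat) \<Rightarrow> ((nat \<Rightarrow> real) \<Rightarrow> real) \<Rightarrow> (nat \<Rightarrow> 'a \<Rightarrow> real) \<Rightarrow> nat \<Rightarrow> 'a \<Rightarrow> real" where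
  "U_stat l d f X n \<omega> = (\<Sum>i\<in>index_set l d n. fI l f X i \<omega>)"

definition ZI ::
  "'a measure \<Rightarrow> nat \<Rightarrow> ((nat \<Rightarrow> real) \<Rightarrow> real) \<Rightarrow> (nat \<Rightarrow> 'a \<Rightarrow> real) \<Rightarrow> (nat \<Rightarrow> nat) \<Rightarrow> 'a \<Rightarrow> real"
  where "ZI M l f X i \<omega> = fI l f X i \<omega> - prob_space.expectation M (fI l f X i)"

definition YI ::
  "'a measure \<Rightarrow> nat \<Rightarrow> nat \<Rightarrow> (nat \<Rightarrow> enat) \<Rightarrow> ((nat \<Rightarrow> real) \<Rightarrow> real) \<Rightarrow> (nat \<Rightarrow> 'a \<Rightarrow> real) \<Rightarrow> nat \<Rightarrow>
    (nat \<Rightarrow> nat) \<Rightarrow> 'a \<Rightarrow> real" where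
  "YI M m l d f X n i \<omega> = (\<Sum>k\<in>nbhd m l d n i. ZI M l f X k \<omega>)"

definition Zbar ::
  "'a measure \<Rightarrow> nat \<Rightarrow> (nat \<Rightarrow> enat) \<Rightarrow> ((nat \<Rightarrow> real) \<Rightarrow> real) \<Rightarrow> (nat \<Rightarrow> 'a \<Rightarrow> real) \<Rightarrow> nat \<Rightarrow>
    'a \<Rightarrow> real" where
  "Zbar M l d f X n \<omega> =
     (\<Sum>i\<in>index_set l d n. ZI M l f X i \<omega>) / real (card (index_set l d n))"

definition Ybar ::
  "'a measure \<Rightarrow> nat \<Rightarrow> nat \<Rightarrow> (nat \<Rightarrow> enat) \<Rightarrow> ((nat \<Rightarrow> real) \<Rightarrow> real) \<Rightarrow> (nat \<Rightarrow> 'a \<Rightarrow> real) \<Rightarrow> nat \<Rightarrow>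
    'a \<Rightarrow> real" where
  "Ybar M m l d f X n \<omega> =
     (\<Sum>i\<in>index_set l d n. YI M m l d f X n i \<omega>) / real (card (index_set l d n))"

definition V_stat ::
  "'a measure \<Rightarrow> nat \<Rightarrow> nat \<Rightarrow> (nat \<Rightarrow> enat) \<Rightarrow> ((nat \<Rightarrow> real) \<Rightarrow> real) \<Rightarrow> (nat \<Rightarrow> 'a \<Rightarrow> real) \<Rightarrow> nat \<Rightarrow>
    'a \<Rightarrow> real" where
  "V_stat M m l d f X n \<omega> =
     sqrt (max (\<Sum>i\<in>index_set l d n. (ZI M l f X i \<omega> * YI M m l d f X n i \<omega>
                   - Zbar M l d f X n \<omega> * Ybar M m l d f X n \<omega>)) 0)"

definition W1 ::
  "'a measure \<Rightarrow> nat \<Rightarrow> (nat \<Rightarrow> enat) \<Rightarrow> ((nat \<Rightarrow> real) \<Rightarrow> real) \<Rightarrow> (nat \<Rightarrow> 'a \<Rightarrow> real) \<Rightarrow> nat \<Rightarrow>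
    'a \<Rightarrow> real" where
  "W1 M l d f X n \<omega> =
     (U_stat l d f X n \<omega> - prob_space.expectation M (U_stat l d f X n)) /
     sqrt (prob_space.variance M (U_stat l d f X n))"

text \<open>The argument \<open>w\<close> is the convention for the value of \<open>W\<^sub>2\<close> on the event \<open>{V = 0}\<close>.\<close>

definition W2 ::
  "'a measure \<Rightarrow> nat \<Rightarrow> nat \<Rightarrow> (nat \<Rightarrow> enat) \<Rightarrow> ((nat \<Rightarrow> real) \<Rightarrow> real) \<Rightarrow> (nat \<Rightarrow> 'a \<Rightarrow> real) \<Rightarrow> nat \<Rightarrow>
    ('a \<Rightarrow> real) \<Rightarrow> 'a \<Rightarrow> real" where
  "W2 M m l d f X n w \<omega> =
     (if V_stat M m l d f X n \<omega> = 0 then w \<omega>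
      else 1 / V_stat M m l d f X n \<omega> * (\<Sum>i\<in>index_set l d n. ZI M l f X i \<omega>))"

definition rate ::
  "'a measure \<Rightarrow> nat \<Rightarrow> (nat \<Rightarrow> enat) \<Rightarrow> ((nat \<Rightarrow> real) \<Rightarrow> real) \<Rightarrow> (nat \<Rightarrow> 'a \<Rightarrow> real) \<Rightarrow> real \<Rightarrow> nat \<Rightarrow>
    real" where
  "rate M l d f X \<sigma> n =
     real n powr (- real (block_number l d) - 1/2) / \<sigma>^3
       * (\<Sum>i\<in>index_set l d n. Lp_norm M 4 (fI l f X i) ^ 3)
     + real n powr (- real (block_number l d) / 2 - 1/2) / \<sigma>^2
       * sqrt (\<Sum>i\<in>index_set l d n. Lp_norm M 4 (fI l f X i) ^ 4)"

end

theory Submission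
  imports Defs
begin


text \<open>
  The constant may depend on everything except \<open>n\<close>, so both inequalities assert a distance of order
  \<open>1 / sqrt n\<close>. Indeed a gap of length above \<open>m + 1\<close> between consecutive
  indices can be shortened without changing the law of the summand, so that the \<open>f\<^sub>i\<close> have finitely many
  laws (\<open>law_reduce\<close>) and uniformly bounded fourth moments; and since the variance is of order
  \<open>n ^ (2 * b - 1)\<close>, the right-hand sides are at least a constant times the target order for large \<open>n\<close>
  (\<open>rate_lower\<close>). The remaining \<open>n\<close> are absorbed by the constant, because the right-hand sides are positive
  whenever the variance is (\<open>rate_pos\<close>).

  The upper bound holds for any finite family \<open>\<xi>\<^sub>i\<close> of centered variables with a dependency graph, whose
  sum \<open>W\<close> has variance one. If neighbourhoods have at most \<open>D\<close> elements, \<open>L\<^sup>4\<close> norms are at most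
  \<open>a\<close> and \<open>card I * D * a\<^sup>2\<close> is at most \<open>B\<close>, then the distance to the normal law is at most
  \<open>\<delta> = D * a\<close> up to a factor that depends on \<open>B\<close> alone (\<open>Berry_Esseen_normalized\<close>). There are about
  \<open>n ^ b\<close> index vectors with about \<open>n ^ (b - 1)\<close> neighbours each, so that \<open>\<delta>\<close> is of order
  \<open>1 / sqrt n\<close> here.

  Both statistics have the form \<open>T = W / sqrt G\<close>, where \<open>G - 1\<close> is of order \<open>\<delta>\<close>: \<open>G = 1\<close> for
  \<open>W\<^sub>1\<close>, and for \<open>W\<^sub>2\<close> it is \<open>V\<^sup>2\<close> over the variance. The proof is by Stein's method. Removing
  the neighbourhood of \<open>j\<close> from \<open>W\<close> and from \<open>G\<close> gives a variable independent of \<open>\<xi>\<^sub>j\<close>. The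
  change in \<open>G\<close> is of order \<open>\<delta>\<^sup>2\<close> and is harmless, so that \<open>E (T * H T)\<close> equals the expected
  sum of \<open>\<xi>\<^sub>j / sqrt G\<close> times the increment of \<open>H\<close> caused by that removal, up to \<open>O(\<delta>)\<close>
  (\<open>stein_leave_one_out\<close>). When \<open>H\<close> solves the Stein equation for \<open>1{x \<le> z}\<close>, Taylor expansion leaves
  one difficult term, caused by the jump of \<open>H'\<close> at \<open>z\<close>: a weighted count of the \<open>j\<close> for which \<open>T\<close> is
  within the size of the \<open>j\<close>-th neighbourhood sum of \<open>z\<close>.

  This count is bounded by the same identity, for a random \<open>H\<close> whose derivative is a sum over \<open>i\<close> of
  bumps at \<open>z\<close>, the width of the \<open>i\<close>-th one following the size of the \<open>i\<close>-th neighbourhood sum. A shift by another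
  neighbourhood sum changes such a bump only by a fraction of itself and of the bump belonging to that other sum
  (\<open>bump_shift\<close>). The oscillation error is hence typically a small multiple of the main term (\<open>test_fun_increments\<close>)
  and can be absorbed, while \<open>E (T * H T)\<close> is of order \<open>\<delta>\<close> since \<open>H\<close> itself is small
  (\<open>bump_sum_L1\<close>).
\<close>

section \<open>Moment bounds\<close>

lemma (in prob_space) Cauchy_Schwarz_integral:
  fixes X Y :: "'a \<Rightarrow> real"
  assumes [measurable]: "X \<in> borel_measurable M" "Y \<in> borel_measurable M"
    and X2: "integrable M (\<lambda>\<omega>. (X \<omega>)\<^sup>2)" and Y2: "integrable M (\<lambda>\<omega>. (Y \<omega>)\<^sup>2)"
  shows "integrable M (\<lambda>\<omega>. X \<omega> * Y \<omega>)"
    and "(expectation (\<lambda>\<omega>. \<bar>X \<omega> * Y \<omega>\<bar>))\<^sup>2 \<le> expectation (\<lambda>\<omega>. (X \<omega>)\<^sup>2) * expectation (\<lambda>\<omega>. (Y \<omega>)\<^sup>2)"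
proof -
  show int: "integrable M (\<lambda>\<omega>. X \<omega> * Y \<omega>)"
  proof (rule Bochner_Integration.integrable_bound)
    show "integrable M (\<lambda>\<omega>. (X \<omega>)\<^sup>2 + (Y \<omega>)\<^sup>2)" using X2 Y2 by auto
    have "\<bar>a * b\<bar> \<le> a\<^sup>2 + b\<^sup>2" for a b :: real
    proof -
      have "2 * \<bar>a\<bar> * \<bar>b\<bar> \<le> \<bar>a\<bar>\<^sup>2 + \<bar>b\<bar>\<^sup>2" by (rule sum_squares_bound)
      moreover have "0 \<le> \<bar>a\<bar> * \<bar>b\<bar>" by simp
      ultimately show ?thesis unfolding abs_mult power2_abs by linarith
    qed
    then show "AE \<omega> in M. norm (X \<omega> * Y \<omega>) \<le> norm ((X \<omega>)\<^sup>2 + (Y \<omega>)\<^sup>2)" by (intro AE_I2) simp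
  qed auto
  have nn: "(\<integral>\<^sup>+ \<omega>. ennreal \<bar>X \<omega> * Y \<omega>\<bar> \<partial>M) = ennreal (expectation (\<lambda>\<omega>. \<bar>X \<omega> * Y \<omega>\<bar>))"
    using int by (intro nn_integral_eq_integral) auto
  have nX: "(\<integral>\<^sup>+ \<omega>. (ennreal \<bar>X \<omega>\<bar>)\<^sup>2 \<partial>M) = ennreal (expectation (\<lambda>\<omega>. (X \<omega>)\<^sup>2))"
    using X2 by (simp add: ennreal_power nn_integral_eq_integral)
  have nY: "(\<integral>\<^sup>+ \<omega>. (ennreal \<bar>Y \<omega>\<bar>)\<^sup>2 \<partial>M) = ennreal (expectation (\<lambda>\<omega>. (Y \<omega>)\<^sup>2))"
    using Y2 by (simp add: ennreal_power nn_integral_eq_integral)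
  have "(\<integral>\<^sup>+ \<omega>. ennreal \<bar>X \<omega>\<bar> * ennreal \<bar>Y \<omega>\<bar> \<partial>M)\<^sup>2
     \<le> (\<integral>\<^sup>+ \<omega>. (ennreal \<bar>X \<omega>\<bar>)\<^sup>2 \<partial>M) * (\<integral>\<^sup>+ \<omega>. (ennreal \<bar>Y \<omega>\<bar>)\<^sup>2 \<partial>M)"
    by (rule Cauchy_Schwarz_nn_integral) auto
  then have "ennreal ((expectation (\<lambda>\<omega>. \<bar>X \<omega> * Y \<omega>\<bar>))\<^sup>2)
      \<le> ennreal (expectation (\<lambda>\<omega>. (X \<omega>)\<^sup>2) * expectation (\<lambda>\<omega>. (Y \<omega>)\<^sup>2))"
    unfolding nX nY ennreal_mult[OF abs_ge_zero abs_ge_zero, symmetric] abs_mult[symmetric] nn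
    by (simp add: ennreal_power ennreal_mult)
  then show "(expectation (\<lambda>\<omega>. \<bar>X \<omega> * Y \<omega>\<bar>))\<^sup>2
      \<le> expectation (\<lambda>\<omega>. (X \<omega>)\<^sup>2) * expectation (\<lambda>\<omega>. (Y \<omega>)\<^sup>2)"
    by (simp add: ennreal_le_iff)
qed

definition (in prob_space) Lp_le :: "nat \<Rightarrow> ('a \<Rightarrow> real) \<Rightarrow> real \<Rightarrow> bool" where
  "Lp_le p X c \<longleftrightarrow> X \<in> borel_measurable M \<and> integrable M (\<lambda>\<omega>. \<bar>X \<omega>\<bar> ^ p) \<and>
     expectation (\<lambda>\<omega>. \<bar>X \<omega>\<bar> ^ p) \<le> c ^ p \<and> 0 \<le> c"

text \<open>Convexity of the \<open>p\<close>-th power with the weights \<open>a / (a + b)\<close> and \<open>b / (a + b)\<close>, which turns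
  separate moment bounds into Minkowski's inequality.\<close>

lemma abs_add_power_le:
  fixes x y a b :: real
  assumes "a > 0" "b > 0"
  shows "\<bar>x + y\<bar> ^ p \<le> (a + b) ^ p * (a / (a + b) * (\<bar>x\<bar> / a) ^ p + b / (a + b) * (\<bar>y\<bar> / b) ^ p)"
proof -
  have conv: "convex_on {0::real..} (\<lambda>x. x ^ p)"
    using convex_power_even[of p] convex_power_odd[of p] by (cases "even p") (auto intro: convex_on_subset)
  have "\<bar>x + y\<bar> / (a + b) \<le> (\<bar>x\<bar> + \<bar>y\<bar>) / (a + b)" using assms by (intro divide_right_mono) auto
  also have "\<dots> = a / (a + b) * (\<bar>x\<bar> / a) + b / (a + b) * (\<bar>y\<bar> / b)"
    using assms by (simp add: add_divide_distrib)
  finally have "(\<bar>x + y\<bar> / (a + b)) ^ p \<le> (a / (a + b) * (\<bar>x\<bar> / a) + b / (a + b) * (\<bar>y\<bar> / b)) ^ p"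
    using assms by (intro power_mono) auto
  also have "\<dots> \<le> a / (a + b) * (\<bar>x\<bar> / a) ^ p + b / (a + b) * (\<bar>y\<bar> / b) ^ p"
    using convex_onD[OF conv, of "b / (a + b)" "\<bar>x\<bar> / a" "\<bar>y\<bar> / b"] assms
    by (simp add: field_simps)
  finally show ?thesis
    using assms by (simp add: power_divide field_simps)
qed

context prob_space
begin

lemma Lp_leD:
  assumes "Lp_le p X c"
  shows "X \<in> borel_measurable M" "integrable M (\<lambda>\<omega>. \<bar>X \<omega>\<bar> ^ p)"
    "expectation (\<lambda>\<omega>. \<bar>X \<omega>\<bar> ^ p) \<le> c ^ p" "0 \<le> c"
  using assms by (auto simp: Lp_le_def)

lemma Lp_le_bound_mono: "Lp_le p X c \<Longrightarrow> c \<le> c' \<Longrightarrow> Lp_le p X c'"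
  by (auto simp: Lp_le_def intro: order_trans power_mono)

lemma Lp_le_dominated:
  assumes "Lp_le p Y c" "X \<in> borel_measurable M" "\<And>\<omega>. \<omega> \<in> space M \<Longrightarrow> \<bar>X \<omega>\<bar> \<le> \<bar>Y \<omega>\<bar>"
  shows "Lp_le p X c"
proof -
  note Y = Lp_leD[OF assms(1)]
  have *: "\<bar>X \<omega>\<bar> ^ p \<le> \<bar>Y \<omega>\<bar> ^ p" if "\<omega> \<in> space M" for \<omega>
    using assms(3)[OF that] by (intro power_mono) auto
  have int: "integrable M (\<lambda>\<omega>. \<bar>X \<omega>\<bar> ^ p)"
    using Y(2) by (rule Bochner_Integration.integrable_bound) (use assms(2) * in auto)
  have "expectation (\<lambda>\<omega>. \<bar>X \<omega>\<bar> ^ p) \<le> expectation (\<lambda>\<omega>. \<bar>Y \<omega>\<bar> ^ p)"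
    using int Y(2) * by (intro integral_mono) auto
  then show ?thesis using int Y assms(2) by (auto simp: Lp_le_def)
qed

lemma Lp_le_const: "Lp_le p (\<lambda>_. k) \<bar>k\<bar>"
  by (simp add: Lp_le_def prob_space)

lemma Lp_le_abs: "Lp_le p X c \<Longrightarrow> Lp_le p (\<lambda>\<omega>. \<bar>X \<omega>\<bar>) c"
  by (auto simp: Lp_le_def)

lemma Lp_le_cmult: "Lp_le p X c \<Longrightarrow> Lp_le p (\<lambda>\<omega>. k * X \<omega>) (\<bar>k\<bar> * c)"
  by (auto simp: Lp_le_def abs_mult power_mult_distrib intro: mult_left_mono)

lemma Lp_le_uminus: "Lp_le p X c \<Longrightarrow> Lp_le p (\<lambda>\<omega>. - X \<omega>) c"
  by (auto simp: Lp_le_def)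

lemma Lp_le_approx:
  assumes "X \<in> borel_measurable M" "0 \<le> c" "\<And>c'. c' > c \<Longrightarrow> Lp_le p X c'"
  shows "Lp_le p X c"
proof -
  have "expectation (\<lambda>\<omega>. \<bar>X \<omega>\<bar> ^ p) \<le> c ^ p"
  proof (rule tendsto_lowerbound)
    show "((\<lambda>c'. c' ^ p) \<longlongrightarrow> c ^ p) (at_right c)" by (intro tendsto_intros)
    show "\<forall>\<^sub>F c' in at_right c. expectation (\<lambda>\<omega>. \<bar>X \<omega>\<bar> ^ p) \<le> c' ^ p"
      using assms(3) by (auto simp: eventually_at_right_less Lp_le_def intro!: eventually_at_rightI[of c "c + 1"])
  qed auto
  then show ?thesis using assms assms(3)[of "c + 1"] by (auto simp: Lp_le_def)
qed

lemma Lp_le_add: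
  assumes "Lp_le p X a" "Lp_le p Y b"
  shows "Lp_le p (\<lambda>\<omega>. X \<omega> + Y \<omega>) (a + b)"
proof -
  have pos: "Lp_le p (\<lambda>\<omega>. X \<omega> + Y \<omega>) (a' + b')"
    if "Lp_le p X a'" "Lp_le p Y b'" and ab: "a' > 0" "b' > 0" for a' b'
  proof -
    note X = Lp_leD[OF that(1)] and Y = Lp_leD[OF that(2)]
    let ?g = "\<lambda>\<omega>. (a' + b') ^ p * (a' / (a' + b') * (\<bar>X \<omega>\<bar> / a') ^ p + b' / (a' + b') * (\<bar>Y \<omega>\<bar> / b') ^ p)"
    have intg: "integrable M ?g" using X(2) Y(2) by (simp add: power_divide)
    have le: "\<bar>X \<omega> + Y \<omega>\<bar> ^ p \<le> ?g \<omega>" for \<omega> by (rule abs_add_power_le[OF ab])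
    have int: "integrable M (\<lambda>\<omega>. \<bar>X \<omega> + Y \<omega>\<bar> ^ p)"
      using intg
    proof (rule Bochner_Integration.integrable_bound)
      show "AE \<omega> in M. norm (\<bar>X \<omega> + Y \<omega>\<bar> ^ p) \<le> norm (?g \<omega>)"
        using le ab by (intro AE_I2) (auto intro: order_trans[OF le abs_ge_self])
    qed (use X(1) Y(1) in auto)
    have "expectation (\<lambda>\<omega>. \<bar>X \<omega> + Y \<omega>\<bar> ^ p) \<le> expectation ?g"
      using int intg le by (intro integral_mono) auto
    also have "\<dots> = (a' + b') ^ p * (a' / (a' + b') * (expectation (\<lambda>\<omega>. \<bar>X \<omega>\<bar> ^ p) / a' ^ p)
        + b' / (a' + b') * (expectation (\<lambda>\<omega>. \<bar>Y \<omega>\<bar> ^ p) / b' ^ p))"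
      using X(2) Y(2) by (simp add: power_divide)
    also have "\<dots> \<le> (a' + b') ^ p * (a' / (a' + b') * 1 + b' / (a' + b') * 1)"
      using X(3) Y(3) ab by (intro mult_left_mono add_mono) auto
    also have "\<dots> = (a' + b') ^ p" using ab by (simp add: add_divide_distrib[symmetric])
    finally show ?thesis using int X(1) Y(1) ab by (auto simp: Lp_le_def)
  qed
  note a0 = Lp_leD(1,4)[OF assms(1)] and b0 = Lp_leD(1,4)[OF assms(2)]
  show ?thesis
  proof (rule Lp_le_approx)
    fix c' assume c': "a + b < c'"
    define e where "e = (c' - a - b) / 2"
    have e: "e > 0" "c' = (a + e) + (b + e)" using c' by (auto simp: e_def field_simps)
    show "Lp_le p (\<lambda>\<omega>. X \<omega> + Y \<omega>) c'" unfolding e(2)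
      using e a0 b0 by (intro pos Lp_le_bound_mono[OF assms(1)] Lp_le_bound_mono[OF assms(2)]) auto
  qed (use a0 b0 in auto)
qed

lemma Lp_le_diff:
  assumes "Lp_le p X a" "Lp_le p Y b"
  shows "Lp_le p (\<lambda>\<omega>. X \<omega> - Y \<omega>) (a + b)"
  using Lp_le_add[OF assms(1) Lp_le_uminus[OF assms(2)]] by simp

lemma Lp_le_sum:
  assumes "p > 0" "\<And>i. i \<in> S \<Longrightarrow> Lp_le p (X i) (c i)"
  shows "Lp_le p (\<lambda>\<omega>. \<Sum>i\<in>S. X i \<omega>) (\<Sum>i\<in>S. c i)"
  using assms(2)
proof (induction S rule: infinite_finite_induct)
  case (insert x F)
  then show ?case using Lp_le_add[of p "X x" "c x"] by simp
qed (use Lp_le_const[of p 0] assms(1) in auto)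

lemma Lp_le_sum_const:
  fixes c :: real
  assumes "p > 0" "\<And>i. i \<in> S \<Longrightarrow> Lp_le p (X i) c"
  shows "Lp_le p (\<lambda>\<omega>. \<Sum>i\<in>S. X i \<omega>) (real (card S) * c)"
  using Lp_le_sum[of p S X "\<lambda>_. c"] assms by simp

lemma Lp_le_mult:
  assumes "Lp_le (2 * p) X a" "Lp_le (2 * p) Y b"
  shows "Lp_le p (\<lambda>\<omega>. X \<omega> * Y \<omega>) (a * b)"
proof -
  note X = Lp_leD[OF assms(1)] and Y = Lp_leD[OF assms(2)]
  have sq: "(\<bar>x\<bar> ^ p)\<^sup>2 = \<bar>x\<bar> ^ (2 * p)" for x :: real
    by (simp add: power_mult[symmetric] mult.commute)
  have m: "(\<lambda>\<omega>. \<bar>X \<omega>\<bar> ^ p) \<in> borel_measurable M" "(\<lambda>\<omega>. \<bar>Y \<omega>\<bar> ^ p) \<in> borel_measurable M"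
    using X(1) Y(1) by auto
  have i: "integrable M (\<lambda>\<omega>. (\<bar>X \<omega>\<bar> ^ p)\<^sup>2)" "integrable M (\<lambda>\<omega>. (\<bar>Y \<omega>\<bar> ^ p)\<^sup>2)"
    unfolding sq using X(2) Y(2) by auto
  note CS = Cauchy_Schwarz_integral[OF m i]
  have eq: "\<bar>X \<omega>\<bar> ^ p * \<bar>Y \<omega>\<bar> ^ p = \<bar>X \<omega> * Y \<omega>\<bar> ^ p" for \<omega>
    by (simp add: abs_mult power_mult_distrib)
  have int: "integrable M (\<lambda>\<omega>. \<bar>X \<omega> * Y \<omega>\<bar> ^ p)" using CS(1) unfolding eq .
  have "(expectation (\<lambda>\<omega>. \<bar>X \<omega> * Y \<omega>\<bar> ^ p))\<^sup>2 \<le> a ^ (2 * p) * b ^ (2 * p)"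
    using CS(2) X(3,4) Y(3,4) unfolding eq sq
    by (simp add: order_trans[OF _ mult_mono])
  also have "\<dots> = ((a * b) ^ p)\<^sup>2"
    by (simp add: power_mult_distrib power_mult[symmetric] mult.commute)
  finally have "expectation (\<lambda>\<omega>. \<bar>X \<omega> * Y \<omega>\<bar> ^ p) \<le> (a * b) ^ p"
    by (rule power2_le_imp_le) (use X Y in auto)
  then show ?thesis using int X Y by (auto simp: Lp_le_def)
qed

lemma Lp_le_mult_L4: "Lp_le 4 X a \<Longrightarrow> Lp_le 4 Y b \<Longrightarrow> Lp_le 2 (\<lambda>\<omega>. X \<omega> * Y \<omega>) (a * b)"
  using Lp_le_mult[of 2 X a Y b] by simp

lemma Lp_le_mult_L2: "Lp_le 2 X a \<Longrightarrow> Lp_le 2 Y b \<Longrightarrow> Lp_le 1 (\<lambda>\<omega>. X \<omega> * Y \<omega>) (a * b)"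
  using Lp_le_mult[of 1 X a Y b] by simp

lemma Lp_le_2_of_4: "Lp_le 4 X a \<Longrightarrow> Lp_le 2 X a"
  using Lp_le_mult_L4[OF _ Lp_le_const[of 4 1], of X a] by simp

lemma Lp_le_1_of_2: "Lp_le 2 X a \<Longrightarrow> Lp_le 1 X a"
  using Lp_le_mult_L2[OF _ Lp_le_const[of 2 1], of X a] by simp

lemma Lp_le_1D:
  assumes "Lp_le 1 X c"
  shows "integrable M X" "expectation (\<lambda>\<omega>. \<bar>X \<omega>\<bar>) \<le> c" "\<bar>expectation X\<bar> \<le> c"
proof -
  note X = Lp_leD[OF assms]
  show i: "integrable M X" using X(1,2) integrable_abs_cancel[of M X] by simp
  show e: "expectation (\<lambda>\<omega>. \<bar>X \<omega>\<bar>) \<le> c" using X(3) by simp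
  show "\<bar>expectation X\<bar> \<le> c" using integral_abs_bound[of M X] e by linarith
qed

lemma Lp_le_2D:
  assumes "Lp_le 2 X c"
  shows "integrable M (\<lambda>\<omega>. (X \<omega>)\<^sup>2)" "expectation (\<lambda>\<omega>. (X \<omega>)\<^sup>2) \<le> c\<^sup>2"
  using Lp_leD[OF assms] by auto

lemma Lp_le_2I:
  assumes "X \<in> borel_measurable M" "integrable M (\<lambda>\<omega>. (X \<omega>)\<^sup>2)" "expectation (\<lambda>\<omega>. (X \<omega>)\<^sup>2) \<le> c\<^sup>2" "0 \<le> c"
  shows "Lp_le 2 X c"
  using assms by (auto simp: Lp_le_def)

lemma Lp_le_2_centered:
  assumes "Lp_le 2 X c"
  shows "Lp_le 2 (\<lambda>\<omega>. X \<omega> - expectation X) c"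
proof -
  note X = Lp_leD[OF assms] and X2 = Lp_le_2D[OF assms] and X1 = Lp_le_1D[OF Lp_le_1_of_2[OF assms]]
  have "expectation (\<lambda>\<omega>. (X \<omega> - expectation X)\<^sup>2) = expectation (\<lambda>\<omega>. (X \<omega>)\<^sup>2) - (expectation X)\<^sup>2"
    using X1(1) X2(1) by (rule variance_eq)
  also have "\<dots> \<le> c\<^sup>2" using X2(2) zero_le_power2[of "expectation X"] by linarith
  finally have "expectation (\<lambda>\<omega>. (X \<omega> - expectation X)\<^sup>2) \<le> c\<^sup>2" .
  moreover have "integrable M (\<lambda>\<omega>. (X \<omega> - expectation X)\<^sup>2)"
    using X1(1) X2(1) by (simp add: power2_diff)
  ultimately show ?thesis using X by (intro Lp_le_2I) auto
qed

end


section \<open>The Stein equation for the normal distribution\<close>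

lemma std_normal_density_pos: "std_normal_density x > 0"
  by (simp add: normal_density_pos)

lemma DERIV_std_normal_density:
  "(std_normal_density has_real_derivative (- x * std_normal_density x)) (at x)"
  unfolding std_normal_density_def[abs_def]
  by (rule derivative_eq_intros refl)+ (auto simp: field_simps)

lemma std_normal_cdf_diff:
  assumes "a \<le> b"
  shows "std_normal_cdf b - std_normal_cdf a = integral {a..b} std_normal_density"
proof (cases "a = b")
  case False
  then have ab: "a < b" using assms by simp
  interpret N: real_distribution std_normal_distribution by (rule real_dist_normal_dist)
  have int: "set_integrable lborel {a..b} std_normal_density"
    by (rule borel_integrable_atLeastAtMost') (auto simp: std_normal_density_def intro!: continuous_intros)
  have "std_normal_cdf b - std_normal_cdf a = measure std_normal_distribution {a<..b}"
    unfolding std_normal_cdf_def by (rule N.cdf_diff_eq[OF ab])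
  also have "\<dots> = (\<integral>x. indicator {a<..b} x * std_normal_density x \<partial>lborel)"
  proof -
    have "measure std_normal_distribution {a<..b} = (\<integral>x. indicator {a<..b} x \<partial>std_normal_distribution)"
      by simp
    also have "\<dots> = (\<integral>x. indicator {a<..b} x * std_normal_density x \<partial>lborel)"
      by (subst integral_density) (auto simp: mult.commute)
    finally show ?thesis .
  qed
  also have "\<dots> = (\<integral>x. indicator {a..b} x * std_normal_density x \<partial>lborel)"
  proof (rule integral_cong_AE)
    show "AE x in lborel. indicator {a<..b} x * std_normal_density x = indicator {a..b} x * std_normal_density x"
      using AE_lborel_singleton[of a] by eventually_elim (auto simp: indicator_def)
  qed auto
  also have "\<dots> = integral {a..b} std_normal_density"
    using set_borel_integral_eq_integral(2)[OF int] by (simp add: set_lebesgue_integral_def)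
  finally show ?thesis .
qed auto

lemma DERIV_std_normal_cdf:
  "(std_normal_cdf has_real_derivative std_normal_density x) (at x)"
proof -
  have "((\<lambda>u. integral {x - 1..u} std_normal_density) has_real_derivative std_normal_density x)
      (at x within {x - 1..x + 1})"
    by (rule integral_has_real_derivative) (auto simp: std_normal_density_def intro!: continuous_intros)
  then have "((\<lambda>u. std_normal_cdf (x - 1) + integral {x - 1..u} std_normal_density)
      has_real_derivative std_normal_density x) (at x within {x - 1..x + 1})"
    by (auto intro!: derivative_eq_intros)
  then have "(std_normal_cdf has_real_derivative std_normal_density x) (at x within {x - 1..x + 1})"
    by (rule has_field_derivative_transform_within[where d=1])
       (auto simp: std_normal_cdf_diff[symmetric])
  then show ?thesis
    by (subst (asm) at_within_interior) auto
qed

lemma std_normal_cdf_bounds: "0 \<le> std_normal_cdf x" "std_normal_cdf x \<le> 1"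
proof -
  interpret N: real_distribution std_normal_distribution by (rule real_dist_normal_dist)
  show "0 \<le> std_normal_cdf x" "std_normal_cdf x \<le> 1"
    unfolding std_normal_cdf_def by (rule N.cdf_nonneg, rule N.cdf_bounded_prob)
qed

lemma std_normal_cdf_mono: "x \<le> y \<Longrightarrow> std_normal_cdf x \<le> std_normal_cdf y"
proof -
  interpret N: real_distribution std_normal_distribution by (rule real_dist_normal_dist)
  show "x \<le> y \<Longrightarrow> std_normal_cdf x \<le> std_normal_cdf y"
    unfolding std_normal_cdf_def by (rule N.cdf_nondecreasing)
qed

lemma std_normal_cdf_at_top: "(std_normal_cdf \<longlongrightarrow> 1) at_top"
proof -
  interpret N: real_distribution std_normal_distribution by (rule real_dist_normal_dist)
  show ?thesis unfolding std_normal_cdf_def by (rule N.cdf_lim_at_top_prob)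
qed

lemma std_normal_cdf_at_bot: "(std_normal_cdf \<longlongrightarrow> 0) at_bot"
proof -
  interpret N: real_distribution std_normal_distribution by (rule real_dist_normal_dist)
  show ?thesis unfolding std_normal_cdf_def by (rule N.cdf_lim_at_bot)
qed

lemma std_normal_cdf_minus: "std_normal_cdf (- x) = 1 - std_normal_cdf x"
proof -
  let ?g = "\<lambda>x. std_normal_cdf x + std_normal_cdf (- x)"
  have "(?g has_real_derivative 0) (at x)" for x
  proof -
    have "std_normal_density (- x) = std_normal_density x" by (simp add: std_normal_density_def)
    then show ?thesis
      by (auto intro!: derivative_eq_intros DERIV_std_normal_cdf
          DERIV_chain2[OF DERIV_std_normal_cdf])
  qed
  then have const: "?g y = ?g x" for y
    by (intro DERIV_isconst_all allI)
  have "(?g \<longlongrightarrow> 1 + 0) at_top"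
    by (intro tendsto_add std_normal_cdf_at_top filterlim_compose[OF std_normal_cdf_at_bot]
        filterlim_uminus_at_bot_at_top)
  moreover have "?g = (\<lambda>_. ?g x)" by (rule ext) (rule const)
  ultimately have "((\<lambda>_::real. ?g x) \<longlongrightarrow> 1 + 0) at_top" by simp
  then have "?g x = 1 + 0" by (subst (asm) tendsto_const_iff) auto
  then show ?thesis by simp
qed

definition mills_ratio :: "real \<Rightarrow> real" where
  "mills_ratio x = (1 - std_normal_cdf x) / std_normal_density x"

lemma mills_ratio_nonneg: "0 \<le> mills_ratio x"
  unfolding mills_ratio_def using std_normal_cdf_bounds[of x] std_normal_density_pos[of x] by simp

lemma DERIV_mills_ratio: "(mills_ratio has_real_derivative (x * mills_ratio x - 1)) (at x)"
  unfolding mills_ratio_def[abs_def] using std_normal_density_pos[of x]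
  by (auto intro!: derivative_eq_intros DERIV_std_normal_cdf DERIV_std_normal_density
      simp: field_simps power2_eq_square)

text \<open>The difference \<open>\<phi> x / x - (1 - \<Phi> x)\<close> has derivative \<open>- \<phi> x / x\<^sup>2\<close> and vanishes at infinity.\<close>

lemma mult_mills_ratio_le_1: "x * mills_ratio x \<le> 1"
proof (cases "x > 0")
  case True
  define k where "k y = std_normal_density y / y - (1 - std_normal_cdf y)" for y
  have dk: "(k has_real_derivative (- std_normal_density y / y\<^sup>2)) (at y)" if "y > 0" for y
    unfolding k_def[abs_def] using that
    by (auto intro!: derivative_eq_intros DERIV_std_normal_cdf DERIV_std_normal_density
        simp: field_simps power2_eq_square)
  have anti: "k y \<le> k x" if "x \<le> y" for y
  proof (rule DERIV_nonpos_imp_nonincreasing[OF that])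
    fix w assume "x \<le> w" "w \<le> y"
    then show "\<exists>D. (k has_real_derivative D) (at w) \<and> D \<le> 0"
      using True dk[of w] std_normal_density_pos[of w]
      by (intro exI[of _ "- std_normal_density w / w\<^sup>2"]) auto
  qed
  have "(k \<longlongrightarrow> 0 - (1 - 1)) at_top"
    unfolding k_def[abs_def]
  proof (intro tendsto_diff tendsto_const std_normal_cdf_at_top)
    have lim: "((\<lambda>y::real. 1 / y) \<longlongrightarrow> 0) at_top"
      using tendsto_inverse_0_at_top[OF filterlim_ident[of at_top]] by (simp add: inverse_eq_divide)
    show "((\<lambda>y. std_normal_density y / y) \<longlongrightarrow> 0) at_top"
    proof (rule tendsto_sandwich[OF _ _ tendsto_const lim])
      show "\<forall>\<^sub>F y in at_top. 0 \<le> std_normal_density y / y"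
        using eventually_gt_at_top[of 0] by eventually_elim (auto intro: divide_nonneg_pos)
      have le1: "std_normal_density y \<le> 1" for y
      proof -
        have "1 / sqrt (2 * pi) \<le> 1" using pi_gt3 by simp
        then have "1 / sqrt (2 * pi) * exp (- y\<^sup>2 / 2) \<le> 1 * 1"
          by (intro mult_mono) auto
        then show ?thesis by (simp add: std_normal_density_def)
      qed
      show "\<forall>\<^sub>F y in at_top. std_normal_density y / y \<le> 1 / y"
        using eventually_gt_at_top[of 0] by eventually_elim (auto intro!: divide_right_mono le1)
    qed
  qed
  then have "0 \<le> k x"
    using anti by (intro tendsto_upperbound[of k _ at_top]) (auto simp: eventually_at_top_linorder)
  then show ?thesis
    using True std_normal_density_pos[of x] by (simp add: k_def mills_ratio_def field_simps)
next
  case False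
  then have "x * mills_ratio x \<le> 0" using mills_ratio_nonneg by (simp add: mult_nonpos_nonneg)
  then show ?thesis by simp
qed

lemma mills_ratio_antimono: "x \<le> y \<Longrightarrow> mills_ratio y \<le> mills_ratio x"
  by (rule DERIV_nonpos_imp_nonincreasing)
     (use DERIV_mills_ratio mult_mills_ratio_le_1 in \<open>auto intro!: exI conjI\<close>)

lemma mills_ratio_le_3:
  assumes "0 \<le> x"
  shows "mills_ratio x \<le> 3"
proof -
  have "mills_ratio x \<le> mills_ratio 0" using assms by (rule mills_ratio_antimono)
  also have "\<dots> \<le> sqrt (2 * pi)"
    using std_normal_cdf_bounds[of 0] by (simp add: mills_ratio_def std_normal_density_def mult_le_cancel_right1)
  also have "\<dots> \<le> sqrt (3\<^sup>2)" using pi_less_4 by (intro real_sqrt_le_mono) auto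
  finally show ?thesis by simp
qed

text \<open>The bounded solution of \<open>f' x = x * f x + 1{x \<le> z} - \<Phi> z\<close>, written with the Mills ratio.\<close>

definition stein_sol :: "real \<Rightarrow> real \<Rightarrow> real" where
  "stein_sol z x = (if x \<le> z then (1 - std_normal_cdf z) * mills_ratio (- x)
     else std_normal_cdf z * mills_ratio x)"

definition stein_deriv :: "real \<Rightarrow> real \<Rightarrow> real" where
  "stein_deriv z x = x * stein_sol z x + (if x \<le> z then 1 else 0) - std_normal_cdf z"

text \<open>Monotonicity of \<open>\<Phi>\<close> bounds the solution by the Mills ratio on either side of the origin, hence by
  the smaller of the two.\<close>

lemma stein_sol_le_mills: "0 \<le> stein_sol z x" "stein_sol z x \<le> mills_ratio \<bar>x\<bar>"
proof -
  note b = std_normal_cdf_bounds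
  show "0 \<le> stein_sol z x" using mills_ratio_nonneg b by (auto simp: stein_sol_def)
  have m: "mills_ratio (- x) = std_normal_cdf x / std_normal_density x" for x
    unfolding mills_ratio_def std_normal_cdf_minus by (simp add: std_normal_density_def)
  have swap: "(1 - std_normal_cdf x) * mills_ratio (- x) \<le> mills_ratio x"
             "std_normal_cdf x * mills_ratio x \<le> mills_ratio (- x)" for x
  proof -
    have "(1 - std_normal_cdf x) * std_normal_cdf x \<le> (1 - std_normal_cdf x) * 1"
      "std_normal_cdf x * (1 - std_normal_cdf x) \<le> std_normal_cdf x * 1"
      using b[of x] by (intro mult_left_mono; simp)+
    then show "(1 - std_normal_cdf x) * mills_ratio (- x) \<le> mills_ratio x"
      "std_normal_cdf x * mills_ratio x \<le> mills_ratio (- x)"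
      unfolding m unfolding mills_ratio_def using std_normal_density_pos[of x]
      by (auto simp: divide_right_mono)
  qed
  have "stein_sol z x \<le> mills_ratio x \<and> stein_sol z x \<le> mills_ratio (- x)"
  proof (cases "x \<le> z")
    case True
    have "(1 - std_normal_cdf z) * mills_ratio (- x) \<le> (1 - std_normal_cdf x) * mills_ratio (- x)"
      using std_normal_cdf_mono[OF True] mills_ratio_nonneg by (intro mult_right_mono) auto
    moreover have "(1 - std_normal_cdf z) * mills_ratio (- x) \<le> 1 * mills_ratio (- x)"
      using b mills_ratio_nonneg by (intro mult_right_mono) auto
    ultimately show ?thesis using swap(1)[of x] True by (auto simp: stein_sol_def)
  next
    case False
    then have "std_normal_cdf z * mills_ratio x \<le> std_normal_cdf x * mills_ratio x"
      using std_normal_cdf_mono[of z x] mills_ratio_nonneg by (intro mult_right_mono) auto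
    moreover have "std_normal_cdf z * mills_ratio x \<le> 1 * mills_ratio x"
      using b mills_ratio_nonneg by (intro mult_right_mono) auto
    ultimately show ?thesis using swap(2)[of x] False by (auto simp: stein_sol_def)
  qed
  then show "stein_sol z x \<le> mills_ratio \<bar>x\<bar>" by (auto simp: abs_if)
qed

lemma stein_sol_bound: "\<bar>stein_sol z x\<bar> \<le> 3"
  using stein_sol_le_mills[where z=z and x=x] mills_ratio_le_3[of "\<bar>x\<bar>"] by simp

lemma stein_deriv_bound: "\<bar>stein_deriv z x\<bar> \<le> 2"
proof -
  have "\<bar>x * stein_sol z x\<bar> \<le> \<bar>x\<bar> * mills_ratio \<bar>x\<bar>"
    using stein_sol_le_mills[where z=z and x=x] by (simp add: abs_mult mult_left_mono)
  also have "\<dots> \<le> 1" by (rule mult_mills_ratio_le_1)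
  finally show ?thesis using std_normal_cdf_bounds[of z] by (auto simp: stein_deriv_def)
qed

lemma DERIV_stein_sol:
  assumes "x \<noteq> z"
  shows "(stein_sol z has_real_derivative stein_deriv z x) (at x)"
proof (cases "x < z")
  case True
  have "((\<lambda>y. (1 - std_normal_cdf z) * mills_ratio (- y)) has_real_derivative stein_deriv z x) (at x)"
    by (rule derivative_eq_intros DERIV_chain2[OF DERIV_mills_ratio] refl)+
       (use True in \<open>auto simp: stein_deriv_def stein_sol_def algebra_simps\<close>)
  then show ?thesis
    by (rule has_field_derivative_transform_within_open[where S="{..<z}"])
       (use True in \<open>auto simp: stein_sol_def\<close>)
next
  case False
  have "((\<lambda>y. std_normal_cdf z * mills_ratio y) has_real_derivative stein_deriv z x) (at x)"
    by (rule derivative_eq_intros DERIV_mills_ratio refl)+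
       (use False assms in \<open>auto simp: stein_deriv_def stein_sol_def algebra_simps\<close>)
  then show ?thesis
    by (rule has_field_derivative_transform_within_open[where S="{z<..}"])
       (use False assms in \<open>auto simp: stein_sol_def\<close>)
qed

lemma continuous_stein_sol: "continuous_on UNIV (stein_sol z)"
proof -
  have m: "continuous_on S mills_ratio" for S
    by (rule continuous_at_imp_continuous_on) (auto intro: DERIV_isCont DERIV_mills_ratio)
  have m': "continuous_on S (\<lambda>x. mills_ratio (- x))" for S
    by (intro continuous_on_compose2[OF m[of UNIV]] continuous_intros) auto
  have "mills_ratio (- z) = std_normal_cdf z / std_normal_density z"
    unfolding mills_ratio_def std_normal_cdf_minus by (simp add: std_normal_density_def)
  then have eq: "(1 - std_normal_cdf z) * mills_ratio (- z) = std_normal_cdf z * mills_ratio z"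
    by (simp add: mills_ratio_def)
  have "continuous_on ({..z} \<union> {z..}) (stein_sol z)"
    unfolding stein_sol_def[abs_def]
    by (rule continuous_on_If) (use eq in \<open>auto intro!: continuous_intros m m' simp: order.antisym\<close>)
  also have "{..z} \<union> {z..} = UNIV" by auto
  finally show ?thesis .
qed

lemma stein_sol_mvt:
  assumes "a < b" "z \<notin> {a<..<b}"
  shows "\<exists>w. a < w \<and> w < b \<and> stein_sol z b - stein_sol z a = (b - a) * stein_deriv z w"
proof -
  have "continuous_on {a..b} (stein_sol z)"
    by (rule continuous_on_subset[OF continuous_stein_sol]) auto
  moreover have "(stein_sol z has_derivative (\<lambda>h. h * stein_deriv z x)) (at x)" if "a < x" "x < b" for x
    using DERIV_stein_sol[of x z] that assms(2)
    by (auto simp: has_field_derivative_def mult.commute[of _ "stein_deriv z x"])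
  ultimately show ?thesis
    by (rule mvt[OF assms(1), of "stein_sol z" "\<lambda>x h. h * stein_deriv z x"]) auto
qed

lemma stein_sol_Lipschitz: "\<bar>stein_sol z x - stein_sol z y\<bar> \<le> 2 * \<bar>x - y\<bar>"
proof -
  have 1: "\<bar>stein_sol z b - stein_sol z a\<bar> \<le> 2 * (b - a)" if ab: "a \<le> b" "z \<notin> {a<..<b}" for a b
  proof (cases "a = b")
    case False
    with ab obtain w where "stein_sol z b - stein_sol z a = (b - a) * stein_deriv z w"
      using stein_sol_mvt[of a b z] by auto
    then show ?thesis using mult_left_mono[OF stein_deriv_bound[of z w], of "b - a"] ab
      by (simp add: abs_mult mult.commute)
  qed auto
  have 2: "\<bar>stein_sol z b - stein_sol z a\<bar> \<le> 2 * (b - a)" if "a \<le> b" for a b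
  proof (cases "z \<in> {a<..<b}")
    case True
    then show ?thesis using 1[of a z] 1[of z b] by auto
  qed (use 1 that in auto)
  show ?thesis using 2[of x y] 2[of y x] by (cases "x \<le> y") auto
qed

text \<open>Unless \<open>z\<close> lies within \<open>\<bar>s\<bar>\<close> of \<open>t\<close>, the derivative does not jump between \<open>t - s\<close> and \<open>t\<close>
  and its variation comes from the factor \<open>x * f x\<close> alone.\<close>

lemma stein_sol_expansion:
  "\<bar>stein_sol z t - stein_sol z (t - s) - s * stein_deriv z t\<bar>
    \<le> (2 * \<bar>t\<bar> + 3) * s\<^sup>2 + 4 * (\<bar>s\<bar> * of_bool (\<bar>t - z\<bar> \<le> \<bar>s\<bar>))"
proof (cases "\<bar>t - z\<bar> \<le> \<bar>s\<bar>")
  case True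
  have "\<bar>s * stein_deriv z t\<bar> \<le> 2 * \<bar>s\<bar>"
    using mult_left_mono[OF stein_deriv_bound[of z t], of "\<bar>s\<bar>"] by (simp add: abs_mult)
  then have "\<bar>stein_sol z t - stein_sol z (t - s) - s * stein_deriv z t\<bar> \<le> 4 * \<bar>s\<bar>"
    using stein_sol_Lipschitz[of z t "t - s"] by simp
  moreover have "0 \<le> (2 * \<bar>t\<bar> + 3) * s\<^sup>2" by simp
  ultimately have "\<bar>stein_sol z t - stein_sol z (t - s) - s * stein_deriv z t\<bar> \<le> (2 * \<bar>t\<bar> + 3) * s\<^sup>2 + 4 * \<bar>s\<bar>"
    by linarith
  then show ?thesis using True by simp
next
  case False
  then have st: "\<bar>s\<bar> < \<bar>t - z\<bar>" by simp
  show ?thesis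
  proof (cases "s = 0")
    case nz: False
    have "\<exists>w. \<bar>w - t\<bar> \<le> \<bar>s\<bar> \<and> (w \<le> z \<longleftrightarrow> t \<le> z) \<and>
        stein_sol z t - stein_sol z (t - s) = s * stein_deriv z w"
    proof (cases "s > 0")
      case True
      then have "z \<notin> {t - s<..<t}" using st by auto
      then obtain w where "t - s < w" "w < t" "stein_sol z t - stein_sol z (t - s) = s * stein_deriv z w"
        using stein_sol_mvt[of "t - s" t z] True by auto
      then show ?thesis using st True by (intro exI[of _ w]) auto
    next
      case neg: False
      then have "z \<notin> {t<..<t - s}" using st nz by auto
      then obtain w where "t < w" "w < t - s" "stein_sol z (t - s) - stein_sol z t = (- s) * stein_deriv z w"
        using stein_sol_mvt[of t "t - s" z] nz neg by auto
      then show ?thesis using st neg by (intro exI[of _ w]) auto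
    qed
    then obtain w where w: "\<bar>w - t\<bar> \<le> \<bar>s\<bar>" "w \<le> z \<longleftrightarrow> t \<le> z"
        "stein_sol z t - stein_sol z (t - s) = s * stein_deriv z w" by blast
    have "stein_deriv z w - stein_deriv z t
        = t * (stein_sol z w - stein_sol z t) + (w - t) * stein_sol z w"
      using w(2) by (simp add: stein_deriv_def algebra_simps)
    also have "\<bar>\<dots>\<bar> \<le> \<bar>t\<bar> * (2 * \<bar>s\<bar>) + \<bar>s\<bar> * 3"
    proof (rule order_trans[OF abs_triangle_ineq add_mono])
      show "\<bar>t * (stein_sol z w - stein_sol z t)\<bar> \<le> \<bar>t\<bar> * (2 * \<bar>s\<bar>)"
        unfolding abs_mult using stein_sol_Lipschitz[of z w t] w(1) by (intro mult_left_mono) auto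
      show "\<bar>(w - t) * stein_sol z w\<bar> \<le> \<bar>s\<bar> * 3"
        unfolding abs_mult using stein_sol_bound[of z w] w(1) by (intro mult_mono) auto
    qed
    finally have "\<bar>s\<bar> * \<bar>stein_deriv z w - stein_deriv z t\<bar> \<le> \<bar>s\<bar> * (\<bar>t\<bar> * (2 * \<bar>s\<bar>) + \<bar>s\<bar> * 3)"
      by (intro mult_left_mono) auto
    also have "\<dots> = (2 * \<bar>t\<bar> + 3) * (\<bar>s\<bar> * \<bar>s\<bar>)" by (simp add: algebra_simps)
    finally have "\<bar>s * (stein_deriv z w - stein_deriv z t)\<bar> \<le> (2 * \<bar>t\<bar> + 3) * s\<^sup>2"
      by (simp add: abs_mult power2_eq_square)
    moreover have "stein_sol z t - stein_sol z (t - s) - s * stein_deriv z t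
        = s * (stein_deriv z w - stein_deriv z t)" unfolding w(3) by (simp add: algebra_simps)
    ultimately show ?thesis using st by simp
  qed simp
qed

lemma stein_sol_measurable [measurable]: "stein_sol z \<in> borel_measurable borel"
  by (rule borel_measurable_continuous_onI[OF continuous_stein_sol])

lemma stein_deriv_measurable [measurable]: "stein_deriv z \<in> borel_measurable borel"
  unfolding stein_deriv_def[abs_def] by measurable


section \<open>A bump kernel with adaptive width\<close>

definition bump :: "real \<Rightarrow> real \<Rightarrow> real" where
  "bump h x = h\<^sup>2 / (h\<^sup>2 + x\<^sup>2)"

text \<open>The linear term makes the weight dominate a small multiple of \<open>y\<close>. The quadratic one is the factor that
  appears when a bump is shifted by \<open>2 * y\<close>, so that the error is again a sum of weighted bumps.\<close>

definition bump_weight :: "real \<Rightarrow> real \<Rightarrow> real \<Rightarrow> real" where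
  "bump_weight r \<alpha> y = r * y + y\<^sup>2 / (y + \<alpha>)"

definition bump_primitive :: "real \<Rightarrow> real \<Rightarrow> real \<Rightarrow> real" where
  "bump_primitive h z x = h * (arctan ((x - z) / h) - arctan (- z / h))"

lemma bump_bounds: "0 \<le> bump h x" "bump h x \<le> 1"
proof -
  show "0 \<le> bump h x" by (simp add: bump_def)
  show "bump h x \<le> 1"
    by (cases "h\<^sup>2 + x\<^sup>2 = 0") (simp_all add: bump_def divide_le_eq_1 less_le)
qed

lemma bump_mono:
  assumes "0 < h" "h \<le> h'"
  shows "bump h x \<le> bump h' x"
proof -
  have "h\<^sup>2 \<le> h'\<^sup>2" using assms by (intro power_mono) auto
  then have "h\<^sup>2 * x\<^sup>2 \<le> h'\<^sup>2 * x\<^sup>2" by (rule mult_right_mono) simp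
  moreover have "h\<^sup>2 + x\<^sup>2 > 0" "h'\<^sup>2 + x\<^sup>2 > 0" using assms by (auto intro!: add_pos_nonneg)
  ultimately show ?thesis by (simp add: bump_def divide_le_eq le_divide_eq algebra_simps)
qed

lemma bump_ge_fifth:
  assumes "0 < h" "\<bar>x\<bar> \<le> 2 * h"
  shows "1 / 5 \<le> bump h x"
proof -
  have "x\<^sup>2 \<le> (2 * h)\<^sup>2" using assms(2) power_mono[of "\<bar>x\<bar>" "2 * h" 2] by simp
  moreover have "h\<^sup>2 + x\<^sup>2 > 0" using assms by (auto intro!: add_pos_nonneg)
  ultimately show ?thesis by (simp add: bump_def le_divide_eq power_mult_distrib)
qed

lemma bump_scale_diff:
  assumes "0 < h" "h \<le> h'"
  shows "\<bar>bump h x - bump h' x\<bar> \<le> 2 * (h' - h) / h'"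
proof -
  have pos: "0 < h\<^sup>2" "0 < h'\<^sup>2" using assms by auto
  have p: "h\<^sup>2 + x\<^sup>2 > 0" "h'\<^sup>2 + x\<^sup>2 > 0" using pos by (auto intro!: add_pos_nonneg)
  have "bump h' x - bump h x = (h'\<^sup>2 - h\<^sup>2) / (h'\<^sup>2 + x\<^sup>2) * (x\<^sup>2 / (h\<^sup>2 + x\<^sup>2))"
  proof -
    have "H' / (H' + X) - H / (H + X) = (H' - H) / (H' + X) * (X / (H + X))"
      if "H + X > 0" "H' + X > 0" for H H' X :: real
      using that by (simp add: divide_simps) algebra
    from this[OF p] show ?thesis by (simp add: bump_def)
  qed
  also have "\<dots> \<le> (h'\<^sup>2 - h\<^sup>2) / (h'\<^sup>2 + x\<^sup>2) * 1"
    using p assms by (intro mult_left_mono divide_nonneg_pos) (auto intro: power_mono)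
  also have "\<dots> \<le> (h'\<^sup>2 - h\<^sup>2) / h'\<^sup>2"
    using pos assms by (simp, intro divide_left_mono) (auto intro: power_mono simp: add_pos_nonneg)
  also have "\<dots> = (h' - h) * (h' + h) / h'\<^sup>2" by (simp add: power2_eq_square algebra_simps)
  also have "\<dots> \<le> (h' - h) * (2 * h') / h'\<^sup>2"
    using assms pos by (intro divide_right_mono mult_left_mono) auto
  also have "\<dots> = 2 * (h' - h) / h'" using assms by (simp add: power2_eq_square)
  finally show ?thesis using bump_mono[OF assms, of x] by simp
qed

lemma bump_weight_bounds:
  assumes "0 \<le> r" "r \<le> 1" "0 < \<alpha>" "0 \<le> y"
  shows "0 \<le> bump_weight r \<alpha> y" "bump_weight r \<alpha> y \<le> 2 * y" "r * y \<le> bump_weight r \<alpha> y"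
    "y\<^sup>2 / (y + \<alpha>) \<le> bump_weight r \<alpha> y"
proof -
  have q: "y\<^sup>2 / (y + \<alpha>) \<le> y" "0 \<le> y\<^sup>2 / (y + \<alpha>)" using assms by (auto simp: field_simps power2_eq_square)
  have "r * y \<le> 1 * y" "0 \<le> r * y" using assms by (intro mult_right_mono mult_nonneg_nonneg; simp)+
  then show "0 \<le> bump_weight r \<alpha> y" "bump_weight r \<alpha> y \<le> 2 * y" "r * y \<le> bump_weight r \<alpha> y"
    "y\<^sup>2 / (y + \<alpha>) \<le> bump_weight r \<alpha> y" using q by (auto simp: bump_weight_def)
qed

lemma bump_weight_diff:
  assumes "0 \<le> r" "r \<le> 1" "0 < \<alpha>" "0 \<le> y" "y \<le> y'"
  shows "0 \<le> bump_weight r \<alpha> y' - bump_weight r \<alpha> y" "bump_weight r \<alpha> y' - bump_weight r \<alpha> y \<le> 2 * (y' - y)"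
proof -
  have eq: "y\<^sup>2 / (y + \<alpha>) = y - \<alpha> + \<alpha>\<^sup>2 / (y + \<alpha>)" if "0 \<le> y" for y
    using that assms by (simp add: field_simps power2_eq_square)
  have "y'\<^sup>2 / (y' + \<alpha>) - y\<^sup>2 / (y + \<alpha>) = (y' - y) - (\<alpha>\<^sup>2 / (y + \<alpha>) - \<alpha>\<^sup>2 / (y' + \<alpha>))"
    using assms by (simp add: eq)
  moreover have "\<alpha>\<^sup>2 / (y' + \<alpha>) \<le> \<alpha>\<^sup>2 / (y + \<alpha>)"
    using assms by (intro divide_left_mono mult_pos_pos) auto
  moreover have "\<alpha>\<^sup>2 / (y + \<alpha>) - \<alpha>\<^sup>2 / (y' + \<alpha>) \<le> y' - y"
  proof -
    have "\<alpha>\<^sup>2 / (y + \<alpha>) - \<alpha>\<^sup>2 / (y' + \<alpha>) = (y' - y) * (\<alpha> / (y + \<alpha>) * (\<alpha> / (y' + \<alpha>)))"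
      using assms by (simp add: field_simps power2_eq_square)
    also have "\<dots> \<le> (y' - y) * (1 * 1)"
      using assms by (intro mult_left_mono mult_mono) auto
    finally show ?thesis by simp
  qed
  moreover have "0 \<le> r * (y' - y)" "r * (y' - y) \<le> 1 * (y' - y)"
    using assms by (intro mult_right_mono mult_nonneg_nonneg; simp)+
  ultimately show "0 \<le> bump_weight r \<alpha> y' - bump_weight r \<alpha> y" "bump_weight r \<alpha> y' - bump_weight r \<alpha> y \<le> 2 * (y' - y)"
    by (simp_all add: bump_weight_def algebra_simps)
qed

lemma weighted_bump_Lipschitz:
  assumes "0 \<le> r" "r \<le> 1" "0 < \<alpha>" "0 \<le> y" "0 \<le> y'"
  shows "\<bar>bump_weight r \<alpha> y * bump (y + \<alpha>) x - bump_weight r \<alpha> y' * bump (y' + \<alpha>) x\<bar> \<le> 6 * \<bar>y - y'\<bar>"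
proof -
  have *: "\<bar>bump_weight r \<alpha> y * bump (y + \<alpha>) x - bump_weight r \<alpha> y' * bump (y' + \<alpha>) x\<bar> \<le> 6 * (y' - y)"
    if y: "0 \<le> y" "y \<le> y'" for y y'
  proof -
    note w = bump_weight_bounds[OF assms(1-3), of y] bump_weight_diff[OF assms(1-3) y]
    have "\<bar>bump_weight r \<alpha> y * (bump (y + \<alpha>) x - bump (y' + \<alpha>) x)\<bar> \<le> (2 * y) * (2 * (y' - y) / (y' + \<alpha>))"
      unfolding abs_mult using w y assms(3) bump_scale_diff[of "y + \<alpha>" "y' + \<alpha>" x]
      by (intro mult_mono) auto
    also have "\<dots> = 4 * (y' - y) * (y / (y' + \<alpha>))" by simp
    also have "\<dots> \<le> 4 * (y' - y) * 1" using y assms(3) by (intro mult_left_mono) auto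
    finally have 1: "\<bar>bump_weight r \<alpha> y * (bump (y + \<alpha>) x - bump (y' + \<alpha>) x)\<bar> \<le> 4 * (y' - y)" by simp
    have "\<bar>(bump_weight r \<alpha> y - bump_weight r \<alpha> y') * bump (y' + \<alpha>) x\<bar> \<le> (2 * (y' - y)) * 1"
      unfolding abs_mult using w y bump_bounds[of "y' + \<alpha>" x] by (intro mult_mono) auto
    then show ?thesis using 1 by (simp add: algebra_simps)
  qed
  show ?thesis using *[of y y'] *[of y' y] assms by (cases "y \<le> y'") auto
qed

text \<open>A Harnack-type comparison. A shift of size \<open>2 * y\<close> changes a bump of width \<open>h \<ge> y\<close> by a
  fraction of order \<open>y / h\<close> of itself; a narrower bump is absorbed by the bump of width \<open>y + \<alpha>\<close>.\<close>

lemma bump_shift: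
  assumes "0 < \<alpha>" "\<alpha> \<le> h" "0 \<le> y" "\<bar>s\<bar> \<le> 2 * y"
  shows "\<bar>bump h (x - s) - bump h x\<bar> \<le> 18 * (y / (y + \<alpha>)) * (bump h x + bump (y + \<alpha>) x)"
proof (cases "y \<le> h")
  case True
  define u where "u = x - s"
  have h: "0 < h" using assms by simp
  have p: "h\<^sup>2 + x\<^sup>2 > 0" "h\<^sup>2 + u\<^sup>2 > 0" using h by (auto intro!: add_pos_nonneg)
  have yh: "y / h \<le> 2 * (y / (y + \<alpha>))"
  proof -
    have "y * (y + \<alpha>) \<le> y * (2 * h)" using assms True by (intro mult_left_mono) auto
    then show ?thesis using assms h by (simp add: field_simps)
  qed
  have "bump h u - bump h x = bump h x * ((x\<^sup>2 - u\<^sup>2) / (h\<^sup>2 + u\<^sup>2))"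
  proof -
    have "H / (H + U) - H / (H + X) = H / (H + X) * ((X - U) / (H + U))"
      if "H + X > 0" "H + U > 0" for H U X :: real
      using that by (simp add: divide_simps) algebra
    from this[OF p] show ?thesis by (simp add: bump_def)
  qed
  also have "x\<^sup>2 - u\<^sup>2 = 2 * (s * u) + s\<^sup>2" by (simp add: u_def power2_eq_square algebra_simps)
  finally have eq: "bump h u - bump h x = bump h x * ((2 * (s * u) + s\<^sup>2) / (h\<^sup>2 + u\<^sup>2))" .
  have sq: "s\<^sup>2 \<le> 4 * y\<^sup>2" using assms(4) power_mono[of "\<bar>s\<bar>" "2 * y" 2] by simp
  have "2 * h * \<bar>u\<bar> \<le> h\<^sup>2 + u\<^sup>2" using sum_squares_bound[of h "\<bar>u\<bar>"] by simp
  then have "\<bar>s\<bar> * (2 * h * \<bar>u\<bar>) \<le> (2 * y) * (h\<^sup>2 + u\<^sup>2)"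
    using assms h by (intro mult_mono) auto
  then have a: "\<bar>2 * (s * u)\<bar> / (h\<^sup>2 + u\<^sup>2) \<le> 2 * (y / h)"
    using p h by (simp add: field_simps abs_mult)
  have "s\<^sup>2 / (h\<^sup>2 + u\<^sup>2) \<le> 4 * y\<^sup>2 / h\<^sup>2"
    using sq h by (intro frac_le) auto
  also have "\<dots> = 4 * (y / h) * (y / h)" by (simp add: power2_eq_square)
  also have "\<dots> \<le> 4 * (y / h) * 1" using True h assms by (intro mult_left_mono) auto
  finally have b: "s\<^sup>2 / (h\<^sup>2 + u\<^sup>2) \<le> 4 * (y / h)" by simp
  have "\<bar>(2 * (s * u) + s\<^sup>2) / (h\<^sup>2 + u\<^sup>2)\<bar> \<le> \<bar>2 * (s * u)\<bar> / (h\<^sup>2 + u\<^sup>2) + s\<^sup>2 / (h\<^sup>2 + u\<^sup>2)"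
  proof -
    have "\<bar>2 * (s * u) + s\<^sup>2\<bar> \<le> \<bar>2 * (s * u)\<bar> + s\<^sup>2"
      using abs_triangle_ineq[of "2 * (s * u)" "s\<^sup>2"] by simp
    from divide_right_mono[OF this less_imp_le[OF p(2)]] show ?thesis
      by (simp only: abs_divide abs_of_pos[OF p(2)] add_divide_distrib[symmetric])
  qed
  also have "\<dots> \<le> 2 * (y / h) + 4 * (y / h)" by (rule add_mono[OF a b])
  also have "\<dots> \<le> 18 * (y / (y + \<alpha>))" 
  proof -
    have "0 \<le> y / (y + \<alpha>)" using assms by simp
    with yh show ?thesis by linarith
  qed
  finally have "\<bar>bump h u - bump h x\<bar> \<le> bump h x * (18 * (y / (y + \<alpha>)))"
    unfolding eq abs_mult using bump_bounds[of h x] by (intro mult_mono) auto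
  also have "\<dots> = 18 * (y / (y + \<alpha>)) * (bump h x + 0)" by simp
  also have "\<dots> \<le> 18 * (y / (y + \<alpha>)) * (bump h x + bump (y + \<alpha>) x)"
    using assms bump_bounds[of "y + \<alpha>" x] by (intro mult_left_mono add_left_mono) auto
  finally show ?thesis by (simp add: u_def)
next
  case False
  then have y: "h < y" "0 < y" "\<alpha> < y" using assms by auto
  have p: "(y + \<alpha>)\<^sup>2 + x\<^sup>2 > 0" "y\<^sup>2 + (x - s)\<^sup>2 > 0" "y\<^sup>2 + x\<^sup>2 > 0"
    using y assms by (auto intro!: add_pos_nonneg)
  have "bump h (x - s) \<le> bump y (x - s)" using y assms by (intro bump_mono) auto
  also have "\<dots> \<le> 9 * bump y x"
  proof -
    have "x\<^sup>2 \<le> 2 * (x - s)\<^sup>2 + 2 * s\<^sup>2"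
      using zero_le_power2[of "(x - s) - s"] by (simp add: power2_eq_square algebra_simps)
    moreover have "s\<^sup>2 \<le> 4 * y\<^sup>2" using assms(4) power_mono[of "\<bar>s\<bar>" "2 * y" 2] by simp
    moreover have "0 \<le> (x - s)\<^sup>2" by simp
    moreover have "Y + X \<le> 9 * (Y + U)" if "X \<le> 2 * U + 2 * Z" "Z \<le> 4 * Y" "0 \<le> U"
      for X Y U Z :: real using that by (simp add: distrib_left)
    ultimately have "y\<^sup>2 + x\<^sup>2 \<le> 9 * (y\<^sup>2 + (x - s)\<^sup>2)" by blast
    then have "y\<^sup>2 * (y\<^sup>2 + x\<^sup>2) \<le> y\<^sup>2 * (9 * (y\<^sup>2 + (x - s)\<^sup>2))" by (rule mult_left_mono) simp
    then show ?thesis using p by (simp add: bump_def divide_le_eq le_divide_eq field_simps)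
  qed
  also have "\<dots> \<le> 9 * bump (y + \<alpha>) x" using y assms by (intro mult_left_mono bump_mono) auto
  finally have 1: "bump h (x - s) \<le> 9 * bump (y + \<alpha>) x" .
  have "\<bar>bump h (x - s) - bump h x\<bar> \<le> bump h (x - s) + bump h x"
    using bump_bounds[of h x] bump_bounds[of h "x - s"] by simp
  also have "\<dots> \<le> 9 * (bump h x + bump (y + \<alpha>) x)" using 1 bump_bounds[of h x] by simp
  also have "\<dots> \<le> (18 * (y / (y + \<alpha>))) * (bump h x + bump (y + \<alpha>) x)"
  proof (rule mult_right_mono)
    show "9 \<le> 18 * (y / (y + \<alpha>))" using y assms by (simp add: field_simps)
  qed (use bump_bounds in auto)
  finally show ?thesis .
qed

lemma DERIV_bump_primitive:
  assumes "h > 0"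
  shows "(bump_primitive h z has_real_derivative bump h (x - z)) (at x)"
proof -
  have "h\<^sup>2 + (x - z)\<^sup>2 > 0" using assms by (auto intro!: add_pos_nonneg)
  then show ?thesis
    unfolding bump_primitive_def[abs_def] bump_def using assms
    by (auto intro!: derivative_eq_intros simp: field_simps power2_eq_square)
qed

lemma bump_primitive_0: "bump_primitive h z 0 = 0"
  by (simp add: bump_primitive_def)

lemma abs_bump_primitive_le:
  assumes "h > 0"
  shows "\<bar>bump_primitive h z x\<bar> \<le> 4 * h"
proof -
  have "\<bar>arctan ((x - z) / h) - arctan (- z / h)\<bar> \<le> 4"
    using arctan_bounded[of "(x - z) / h"] arctan_bounded[of "- z / h"] pi_less_4 by linarith
  then show ?thesis using assms by (simp add: bump_primitive_def abs_mult mult.commute)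
qed

lemma bump_primitive_measurable [measurable]:
  assumes [measurable]: "X \<in> borel_measurable N" "Y \<in> borel_measurable N"
  shows "(\<lambda>\<omega>. bump_primitive (X \<omega>) z (Y \<omega>)) \<in> borel_measurable N"
  unfolding bump_primitive_def by measurable

lemma bump_measurable [measurable]:
  assumes [measurable]: "X \<in> borel_measurable N" "Y \<in> borel_measurable N"
  shows "(\<lambda>\<omega>. bump (X \<omega>) (Y \<omega>)) \<in> borel_measurable N"
  unfolding bump_def by measurable

lemma bump_weight_measurable [measurable]:
  assumes [measurable]: "X \<in> borel_measurable N"
  shows "(\<lambda>\<omega>. bump_weight r \<alpha> (X \<omega>)) \<in> borel_measurable N"
  unfolding bump_weight_def by measurable

lemma abs_diff_le_of_DERIV_bound:
  fixes f :: "real \<Rightarrow> real"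
  assumes "convex S" "\<And>w. w \<in> S \<Longrightarrow> (f has_real_derivative f' w) (at w)" "\<And>w. w \<in> S \<Longrightarrow> \<bar>f' w\<bar> \<le> K"
    "x \<in> S" "y \<in> S"
  shows "\<bar>f x - f y\<bar> \<le> K * \<bar>x - y\<bar>"
  using field_differentiable_bound[of S f f' K x y] assms
  by (auto intro: has_field_derivative_at_within)

definition weighted_primitive :: "real \<Rightarrow> real \<Rightarrow> real \<Rightarrow> real \<Rightarrow> real \<Rightarrow> real" where
  "weighted_primitive r \<alpha> z y x = bump_weight r \<alpha> y * bump_primitive (y + \<alpha>) z x"

lemma weighted_primitive_0: "weighted_primitive r \<alpha> z y 0 = 0"
  by (simp add: weighted_primitive_def bump_primitive_0)

lemma DERIV_weighted_primitive:
  assumes "0 < \<alpha>" "0 \<le> y"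
  shows "(weighted_primitive r \<alpha> z y has_real_derivative bump_weight r \<alpha> y * bump (y + \<alpha>) (x - z)) (at x)"
  unfolding weighted_primitive_def[abs_def] using assms
  by (intro DERIV_cmult DERIV_bump_primitive) auto

lemma weighted_primitive_Lipschitz:
  assumes "0 \<le> r" "r \<le> 1" "0 < \<alpha>" "0 \<le> y"
  shows "\<bar>weighted_primitive r \<alpha> z y x - weighted_primitive r \<alpha> z y x'\<bar> \<le> 2 * y * \<bar>x - x'\<bar>"
proof (rule abs_diff_le_of_DERIV_bound[where S=UNIV])
  show "\<bar>bump_weight r \<alpha> y * bump (y + \<alpha>) (w - z)\<bar> \<le> 2 * y" for w
  proof -
    have "\<bar>bump_weight r \<alpha> y * bump (y + \<alpha>) (w - z)\<bar> \<le> (2 * y) * 1"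
      unfolding abs_mult using bump_weight_bounds[OF assms] bump_bounds[of "y + \<alpha>" "w - z"] assms
      by (intro mult_mono) auto
    then show ?thesis by simp
  qed
qed (use DERIV_weighted_primitive assms in auto)

lemma weighted_primitive_diff:
  assumes "0 \<le> r" "r \<le> 1" "0 < \<alpha>" "0 \<le> y" "0 \<le> y'"
  shows "\<bar>weighted_primitive r \<alpha> z y x - weighted_primitive r \<alpha> z y' x\<bar> \<le> 6 * \<bar>y - y'\<bar> * \<bar>x\<bar>"
proof -
  have "\<bar>(weighted_primitive r \<alpha> z y x - weighted_primitive r \<alpha> z y' x) -
      (weighted_primitive r \<alpha> z y 0 - weighted_primitive r \<alpha> z y' 0)\<bar> \<le> 6 * \<bar>y - y'\<bar> * \<bar>x - 0\<bar>"
    by (rule abs_diff_le_of_DERIV_bound[where S=UNIV and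
          f'="\<lambda>w. bump_weight r \<alpha> y * bump (y + \<alpha>) (w - z) - bump_weight r \<alpha> y' * bump (y' + \<alpha>) (w - z)"])
       (use assms in \<open>auto intro!: DERIV_diff DERIV_weighted_primitive weighted_bump_Lipschitz\<close>)
  then show ?thesis by (simp add: weighted_primitive_0)
qed

lemma bump_primitive_expansion:
  assumes "0 < \<alpha>" "\<alpha> \<le> h" "0 \<le> y" "\<bar>s\<bar> \<le> 2 * y"
  shows "\<bar>bump_primitive h z x - bump_primitive h z (x - s) - s * bump h (x - z)\<bar>
    \<le> \<bar>s\<bar> * (18 * (y / (y + \<alpha>)) * (bump h (x - z) + bump (y + \<alpha>) (x - z)))"
proof -
  let ?b = "bump h (x - z)" and ?K = "18 * (y / (y + \<alpha>)) * (bump h (x - z) + bump (y + \<alpha>) (x - z))"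
  have "\<bar>(bump_primitive h z x - x * ?b) - (bump_primitive h z (x - s) - (x - s) * ?b)\<bar> \<le> ?K * \<bar>x - (x - s)\<bar>"
  proof (rule abs_diff_le_of_DERIV_bound[where S="cball x \<bar>s\<bar>"])
    fix w assume w: "w \<in> cball x \<bar>s\<bar>"
    show "((\<lambda>a. bump_primitive h z a - a * ?b) has_real_derivative bump h (w - z) - 1 * ?b) (at w)"
      using assms by (intro DERIV_diff DERIV_bump_primitive DERIV_cmult_right DERIV_ident) auto
    have "\<bar>x - w\<bar> \<le> 2 * y" using w assms by (simp add: dist_real_def)
    from bump_shift[OF assms(1-3) this, of "x - z"]
    show "\<bar>bump h (w - z) - 1 * ?b\<bar> \<le> ?K" by (simp add: algebra_simps)
  qed (auto simp: dist_real_def)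
  then show ?thesis by (simp add: algebra_simps)
qed

lemma weighted_primitive_expansion:
  assumes "0 \<le> r" "r \<le> 1" "0 < \<alpha>" "0 \<le> y'" "0 \<le> y" "\<bar>s\<bar> \<le> 2 * y"
  shows "\<bar>weighted_primitive r \<alpha> z y' x - weighted_primitive r \<alpha> z y' (x - s)
        - s * (bump_weight r \<alpha> y' * bump (y' + \<alpha>) (x - z))\<bar>
    \<le> 36 * (y\<^sup>2 / (y + \<alpha>)) * (bump_weight r \<alpha> y' * (bump (y' + \<alpha>) (x - z) + bump (y + \<alpha>) (x - z)))"
proof -
  let ?g = "bump_weight r \<alpha> y'" and ?b = "bump (y' + \<alpha>) (x - z)" and ?b' = "bump (y + \<alpha>) (x - z)"
  have g: "0 \<le> ?g" using bump_weight_bounds assms by auto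
  have nn: "0 \<le> 18 * (y / (y + \<alpha>)) * (?b + ?b')" using assms bump_bounds by (intro mult_nonneg_nonneg add_nonneg_nonneg) auto
  have "\<bar>bump_primitive (y' + \<alpha>) z x - bump_primitive (y' + \<alpha>) z (x - s) - s * ?b\<bar> \<le> \<bar>s\<bar> * (18 * (y / (y + \<alpha>)) * (?b + ?b'))"
    using assms by (intro bump_primitive_expansion) auto
  also have "\<dots> \<le> (2 * y) * (18 * (y / (y + \<alpha>)) * (?b + ?b'))"
    using assms(6) nn by (intro mult_right_mono) auto
  finally have "?g * \<bar>bump_primitive (y' + \<alpha>) z x - bump_primitive (y' + \<alpha>) z (x - s) - s * ?b\<bar>
      \<le> ?g * ((2 * y) * (18 * (y / (y + \<alpha>)) * (?b + ?b')))" using g by (rule mult_left_mono)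
  also have "\<dots> = 36 * (y\<^sup>2 / (y + \<alpha>)) * (?g * (?b + ?b'))" by (simp add: power2_eq_square)
  also have "?g * \<bar>bump_primitive (y' + \<alpha>) z x - bump_primitive (y' + \<alpha>) z (x - s) - s * ?b\<bar>
      = \<bar>?g * (bump_primitive (y' + \<alpha>) z x - bump_primitive (y' + \<alpha>) z (x - s) - s * ?b)\<bar>"
    using g by (simp add: abs_mult)
  also have "?g * (bump_primitive (y' + \<alpha>) z x - bump_primitive (y' + \<alpha>) z (x - s) - s * ?b)
     = weighted_primitive r \<alpha> z y' x - weighted_primitive r \<alpha> z y' (x - s) - s * (?g * ?b)"
    by (simp add: weighted_primitive_def algebra_simps)
  finally show ?thesis .
qed

lemma abs_weighted_primitive_le:
  assumes "0 \<le> r" "r \<le> 1" "0 < \<alpha>" "0 \<le> y"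
  shows "\<bar>weighted_primitive r \<alpha> z y x\<bar> \<le> 8 * (y * y + \<alpha> * y)"
proof -
  have "\<bar>weighted_primitive r \<alpha> z y x\<bar> \<le> (2 * y) * (4 * (y + \<alpha>))"
    unfolding weighted_primitive_def abs_mult
    using bump_weight_bounds[OF assms] abs_bump_primitive_le[of "y + \<alpha>" z x] assms by (intro mult_mono) auto
  then show ?thesis by (simp add: algebra_simps)
qed

lemma weighted_primitive_measurable [measurable]:
  assumes [measurable]: "X \<in> borel_measurable N" "Y \<in> borel_measurable N"
  shows "(\<lambda>\<omega>. weighted_primitive r \<alpha> z (X \<omega>) (Y \<omega>)) \<in> borel_measurable N"
  unfolding weighted_primitive_def by measurable


section \<open>Locally dependent sums\<close>

lemma card_UN_le_mult:
  assumes "finite S" "real (card S) \<le> p" "\<And>x. x \<in> S \<Longrightarrow> real (card (f x)) \<le> q" "0 \<le> q"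
  shows "real (card (\<Union>x\<in>S. f x)) \<le> p * q"
proof -
  have "real (card (\<Union>x\<in>S. f x)) \<le> real (\<Sum>x\<in>S. card (f x))"
    using card_UN_le[OF assms(1), of f] by (simp only: of_nat_le_iff)
  also have "\<dots> \<le> (\<Sum>x\<in>S. q)" unfolding of_nat_sum by (intro sum_mono assms)
  also have "\<dots> \<le> p * q" using assms by (auto intro: mult_right_mono)
  finally show ?thesis .
qed

text \<open>The sets \<open>A i\<close> are the neighbourhoods in a dependency graph, and \<open>F S\<close> is a sigma algebra that makes
  the \<open>\<xi>\<^sub>i\<close> with \<open>i \<in> S\<close> measurable. The quantity \<open>card I * D * a\<^sup>2\<close> bounds the sum of all
  covariances, and \<open>D * a\<close> bounds a neighbourhood sum in \<open>L\<^sup>4\<close>.\<close>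

locale local_dependence = prob_space M for M :: "'a measure" +
  fixes I :: "'i set" and A :: "'i \<Rightarrow> 'i set" and F :: "'i set \<Rightarrow> 'a measure"
    and \<xi> :: "'i \<Rightarrow> 'a \<Rightarrow> real" and D a B :: real
  assumes finite_I: "finite I"
    and A_sub: "\<And>i. i \<in> I \<Longrightarrow> A i \<subseteq> I"
    and A_sym: "\<And>i k. i \<in> I \<Longrightarrow> k \<in> A i \<Longrightarrow> i \<in> A k"
    and card_A: "\<And>i. i \<in> I \<Longrightarrow> real (card (A i)) \<le> D"
    and F_sub: "\<And>S. S \<subseteq> I \<Longrightarrow> subalgebra M (F S)"
    and F_mono: "\<And>S S'. S \<subseteq> S' \<Longrightarrow> S' \<subseteq> I \<Longrightarrow> sets (F S) \<subseteq> sets (F S')"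
    and F_meas: "\<And>i. i \<in> I \<Longrightarrow> \<xi> i \<in> borel_measurable (F {i})"
    and F_indep: "\<And>S S'. S \<subseteq> I \<Longrightarrow> S' \<subseteq> I \<Longrightarrow> (\<And>s. s \<in> S \<Longrightarrow> A s \<inter> S' = {}) \<Longrightarrow>
        indep_set (sets (F S)) (sets (F S'))"
    and mean_zero: "\<And>i. i \<in> I \<Longrightarrow> expectation (\<xi> i) = 0"
    and L4: "\<And>i. i \<in> I \<Longrightarrow> Lp_le 4 (\<xi> i) a"
    and card_I: "real (card I) * D * a\<^sup>2 \<le> B"
    and B_ge_1: "1 \<le> B"
    and a_pos: "0 < a" and D_pos: "0 < D"
    and delta_le_1: "D * a \<le> 1"
    and variance_1: "expectation (\<lambda>\<omega>. (\<Sum>i\<in>I. \<xi> i \<omega>)\<^sup>2) = 1"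
begin

abbreviation \<delta> :: real where "\<delta> \<equiv> D * a"

definition W :: "'a \<Rightarrow> real" where "W \<omega> = (\<Sum>i\<in>I. \<xi> i \<omega>)"
definition \<eta> :: "'i \<Rightarrow> 'a \<Rightarrow> real" where "\<eta> j \<omega> = (\<Sum>k\<in>A j. \<xi> k \<omega>)"
definition e :: "'i \<Rightarrow> 'a \<Rightarrow> real" where "e j \<omega> = (\<Sum>k\<in>A j. \<bar>\<xi> k \<omega>\<bar>)"
definition pairs :: "('i \<times> 'i) set" where "pairs = Sigma I A"
definition pairs_off :: "'i \<Rightarrow> ('i \<times> 'i) set" where
  "pairs_off j = {(i, k) \<in> pairs. i \<notin> A j \<and> k \<notin> A j}"
definition psum :: "('i \<times> 'i) set \<Rightarrow> (real \<Rightarrow> real \<Rightarrow> real) \<Rightarrow> 'a \<Rightarrow> real" where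
  "psum P g \<omega> = (\<Sum>p\<in>P. g (\<xi> (fst p) \<omega>) (\<xi> (snd p) \<omega>))"
abbreviation S :: "'a \<Rightarrow> real" where "S \<equiv> psum pairs (*)"

lemma delta_pos: "0 < \<delta>" using a_pos D_pos by simp
lemma delta_power_le: "\<delta>\<^sup>2 \<le> \<delta>"
  using delta_pos delta_le_1 by (simp add: power2_eq_square mult_left_le)

lemma A_mem: "i \<in> I \<Longrightarrow> k \<in> A i \<Longrightarrow> k \<in> I"
  using A_sub by blast

lemma pairs_mem: "p \<in> pairs \<Longrightarrow> fst p \<in> I \<and> snd p \<in> I"
  using A_mem by (auto simp: pairs_def)

lemma finite_A: "i \<in> I \<Longrightarrow> finite (A i)"
  using A_sub finite_I finite_subset by blast

lemma finite_pairs: "finite pairs"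
  unfolding pairs_def using finite_I finite_A by auto

lemma pairs_off_sub: "pairs_off j \<subseteq> pairs"
  by (auto simp: pairs_off_def)

subsection \<open>Measurability and independence\<close>

lemma xi_measurable_F: "i \<in> T \<Longrightarrow> T \<subseteq> I \<Longrightarrow> \<xi> i \<in> borel_measurable (F T)"
  using F_meas[of i] F_mono[of "{i}" T] F_sub[of "{i}"] F_sub[of T]
  by (auto simp: subalgebra_def intro!: measurable_from_subalg[of "F T" "F {i}"])

lemma xi_measurable [measurable]: "i \<in> I \<Longrightarrow> \<xi> i \<in> borel_measurable M"
  using L4 Lp_leD(1) by blast

lemma measurable_F_imp: "T \<subseteq> I \<Longrightarrow> f \<in> borel_measurable (F T) \<Longrightarrow> f \<in> borel_measurable M"
  using measurable_from_subalg[OF F_sub] .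

lemma expectation_mult_indep:
  fixes f g :: "'a \<Rightarrow> real"
  assumes "T \<subseteq> I" "T' \<subseteq> I" "\<And>s. s \<in> T \<Longrightarrow> A s \<inter> T' = {}"
    and f: "f \<in> borel_measurable (F T)" "integrable M f"
    and g: "g \<in> borel_measurable (F T')" "integrable M g"
  shows "expectation (\<lambda>\<omega>. f \<omega> * g \<omega>) = expectation f * expectation g"
proof -
  have sp: "space (F T) = space M" "space (F T') = space M"
    using F_sub[OF assms(1)] F_sub[OF assms(2)] by (auto simp: subalgebra_def)
  have ind: "indep_set (sets (F T)) (sets (F T'))" using assms(1-3) by (rule F_indep)
  have sub: "sigma_sets (space M) {h -` X \<inter> space M |X. X \<in> sets borel} \<subseteq> sets N"
    if "h \<in> borel_measurable N" "space N = space M" for h :: "'a \<Rightarrow> real" and N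
    unfolding that(2)[symmetric]
    by (rule sets.sigma_sets_subset) (auto intro: measurable_sets[OF that(1)])
  have "indep_var borel f borel g"
    unfolding indep_var_eq
  proof (intro conjI)
    show "indep_set (sigma_sets (space M) {f -` X \<inter> space M |X. X \<in> sets borel})
        (sigma_sets (space M) {g -` X \<inter> space M |X. X \<in> sets borel})"
      using ind sub[OF f(1) sp(1)] sub[OF g(1) sp(2)] unfolding indep_sets2_eq by blast
  qed (use f g in auto)
  then show ?thesis using f(2) g(2) by (rule indep_var_lebesgue_integral)
qed

lemma expectation_xi_mult_zero:
  assumes "j \<in> I" "H \<in> borel_measurable (F (I - A j))" "integrable M H"
  shows "expectation (\<lambda>\<omega>. \<xi> j \<omega> * H \<omega>) = 0"
proof -
  have "integrable M (\<xi> j)" using Lp_le_1D(1)[OF Lp_le_1_of_2[OF Lp_le_2_of_4[OF L4[OF assms(1)]]]] .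
  then have "expectation (\<lambda>\<omega>. \<xi> j \<omega> * H \<omega>) = expectation (\<xi> j) * expectation H"
    using assms F_meas[of j] by (intro expectation_mult_indep[of "{j}" "I - A j"]) auto
  then show ?thesis using mean_zero[OF assms(1)] by simp
qed

lemma psum_measurable_F:
  assumes "P \<subseteq> pairs" "\<And>p. p \<in> P \<Longrightarrow> fst p \<in> T \<and> snd p \<in> T" "T \<subseteq> I"
    and [measurable]: "case_prod g \<in> borel_measurable (borel \<Otimes>\<^sub>M borel)"
  shows "psum P g \<in> borel_measurable (F T)"
  unfolding psum_def[abs_def]
proof (rule borel_measurable_sum)
  fix p assume p: "p \<in> P"
  have [measurable]: "\<xi> (fst p) \<in> borel_measurable (F T)" "\<xi> (snd p) \<in> borel_measurable (F T)"
    using assms(2)[OF p] assms(3) by (auto intro: xi_measurable_F)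
  have "(\<lambda>\<omega>. case_prod g (\<xi> (fst p) \<omega>, \<xi> (snd p) \<omega>)) \<in> borel_measurable (F T)" by measurable
  then show "(\<lambda>\<omega>. g (\<xi> (fst p) \<omega>) (\<xi> (snd p) \<omega>)) \<in> borel_measurable (F T)" by simp
qed

lemma psum_off_measurable_F:
  assumes "j \<in> I" "case_prod g \<in> borel_measurable (borel \<Otimes>\<^sub>M borel)"
  shows "psum (pairs_off j) g \<in> borel_measurable (F (I - A j))"
  by (rule psum_measurable_F) (use assms A_mem in \<open>auto simp: pairs_off_def pairs_def\<close>)

lemma psum_measurable:
  assumes "P \<subseteq> pairs" "case_prod g \<in> borel_measurable (borel \<Otimes>\<^sub>M borel)"
  shows "psum P g \<in> borel_measurable M"
proof (rule measurable_F_imp[of I])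
  show "psum P g \<in> borel_measurable (F I)"
  proof (rule psum_measurable_F[OF assms(1) _ _ assms(2)])
    fix p assume "p \<in> P"
    then have "p \<in> pairs" using assms(1) by blast
    then show "fst p \<in> I \<and> snd p \<in> I" by (rule pairs_mem)
  qed simp
qed simp

subsection \<open>Counting and moments\<close>

lemma Lp_le_xi_pair:
  assumes "i \<in> I" "k \<in> I" "case_prod g \<in> borel_measurable (borel \<Otimes>\<^sub>M borel)"
    and "\<And>x y. \<bar>g x y\<bar> \<le> \<bar>x * y\<bar>"
  shows "Lp_le 2 (\<lambda>\<omega>. g (\<xi> i \<omega>) (\<xi> k \<omega>)) (a\<^sup>2)"
proof (rule Lp_le_dominated)
  show "Lp_le 2 (\<lambda>\<omega>. \<xi> i \<omega> * \<xi> k \<omega>) (a\<^sup>2)"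
    unfolding power2_eq_square by (intro Lp_le_mult_L4 L4 assms)
  have "(\<lambda>\<omega>. case_prod g (\<xi> i \<omega>, \<xi> k \<omega>)) \<in> borel_measurable M"
    using assms(1-3) by measurable
  then show "(\<lambda>\<omega>. g (\<xi> i \<omega>) (\<xi> k \<omega>)) \<in> borel_measurable M" by simp
qed (use assms in auto)

lemma Lp_le_eta: "j \<in> I \<Longrightarrow> Lp_le 4 (\<eta> j) \<delta>"
  unfolding \<eta>_def[abs_def] using A_sub[of j] card_A[of j] a_pos
  by (intro Lp_le_bound_mono[OF Lp_le_sum_const[where c=a]] L4 mult_right_mono) auto

lemma Lp_le_e: "j \<in> I \<Longrightarrow> Lp_le 4 (e j) \<delta>"
  unfolding e_def[abs_def] using A_sub[of j] card_A[of j] a_pos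
  by (intro Lp_le_bound_mono[OF Lp_le_sum_const[where c=a]] Lp_le_abs L4 mult_right_mono) auto

lemma abs_eta_le_e: "\<bar>\<eta> j \<omega>\<bar> \<le> e j \<omega>"
  unfolding \<eta>_def e_def by (rule sum_abs)

lemma e_nonneg: "0 \<le> e j \<omega>"
  unfolding e_def by (simp add: sum_nonneg)

lemma card_sum_bounds:
  "card I * (a * \<delta>) \<le> B" "card I * (a * \<delta>\<^sup>2) \<le> B * \<delta>" "card I * (a * \<delta> ^ 3) \<le> B * \<delta>"
proof -
  show 1: "card I * (a * \<delta>) \<le> B" using card_I by (simp add: power2_eq_square mult_ac)
  have "card I * (a * \<delta>) * \<delta> \<le> B * \<delta>" using 1 delta_pos by (intro mult_right_mono) auto
  then show 2: "card I * (a * \<delta>\<^sup>2) \<le> B * \<delta>" by (simp only: power2_eq_square mult.assoc)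
  have "\<delta> ^ 3 \<le> \<delta>\<^sup>2" using delta_pos delta_le_1 by (intro power_decreasing) auto
  then have "card I * (a * \<delta> ^ 3) \<le> card I * (a * \<delta>\<^sup>2)" using a_pos by (intro mult_left_mono) auto
  then show "card I * (a * \<delta> ^ 3) \<le> B * \<delta>" using 2 by simp
qed

lemma card_pairs_at: "y \<in> I \<Longrightarrow> real (card ({y} \<times> A y \<union> A y \<times> {y})) \<le> 2 * D"
proof -
  assume y: "y \<in> I"
  have "card ({y} \<times> A y \<union> A y \<times> {y}) \<le> card (A y) + card (A y)"
    by (rule order_trans[OF card_Un_le]) (simp add: card_cartesian_product)
  then show ?thesis using card_A[OF y] by simp
qed

text \<open>By symmetry of the graph, a pair that meets \<open>A j\<close> is a point of \<open>A j\<close> together with one of its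
  neighbours.\<close>

lemma card_pairs_touching:
  assumes "j \<in> I"
  shows "real (card {p \<in> pairs. fst p \<in> A j \<or> snd p \<in> A j}) \<le> 2 * D\<^sup>2"
proof -
  have sub: "{p \<in> pairs. fst p \<in> A j \<or> snd p \<in> A j} \<subseteq> (\<Union>y\<in>A j. {y} \<times> A y \<union> A y \<times> {y})"
  proof
    fix p assume p: "p \<in> {p \<in> pairs. fst p \<in> A j \<or> snd p \<in> A j}"
    then have "fst p \<in> A (snd p)" "snd p \<in> A (fst p)" using A_sym by (auto simp: pairs_def)
    with p show "p \<in> (\<Union>y\<in>A j. {y} \<times> A y \<union> A y \<times> {y})"
      by (cases p) auto
  qed
  have "real (card {p \<in> pairs. fst p \<in> A j \<or> snd p \<in> A j})
      \<le> real (card (\<Union>y\<in>A j. {y} \<times> A y \<union> A y \<times> {y}))"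
  proof (intro of_nat_mono card_mono sub finite_UN_I finite_A assms)
    fix y assume "y \<in> A j"
    then have "finite (A y)" using A_sub[OF assms] finite_A by blast
    then show "finite ({y} \<times> A y \<union> A y \<times> {y})" by simp
  qed
  also have "\<dots> \<le> D * (2 * D)"
    using A_sub[OF assms] D_pos card_pairs_at card_A[OF assms] by (intro card_UN_le_mult finite_A assms) auto
  finally show ?thesis by (simp add: power2_eq_square)
qed

lemma card_pairs: "real (card pairs) \<le> card I * D"
  unfolding pairs_def using card_A finite_I D_pos sum_bounded_above[of I "\<lambda>i. real (card (A i))" D]
  by (simp add: card_SigmaI finite_A)

text \<open>About \<open>D\<^sup>2\<close> pairs meet a neighbourhood, and each contributes at most \<open>a\<^sup>2\<close>; this is why removing
  a neighbourhood from a pair sum is a second-order change.\<close>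

lemma psum_minus_off:
  assumes j: "j \<in> I" and g: "case_prod g \<in> borel_measurable (borel \<Otimes>\<^sub>M borel)"
    "\<And>x y. \<bar>g x y\<bar> \<le> \<bar>x * y\<bar>"
  shows "Lp_le 2 (\<lambda>\<omega>. psum pairs g \<omega> - psum (pairs_off j) g \<omega>) (2 * \<delta>\<^sup>2)"
proof -
  let ?P = "{p \<in> pairs. fst p \<in> A j \<or> snd p \<in> A j}"
  have "psum pairs g \<omega> - psum (pairs_off j) g \<omega> = psum ?P g \<omega>" for \<omega>
    unfolding psum_def
    by (subst sum_diff[OF finite_pairs pairs_off_sub, symmetric])
       (auto simp: pairs_off_def intro: sum.cong)
  moreover have "Lp_le 2 (psum ?P g) (card ?P * a\<^sup>2)"
    unfolding psum_def[abs_def]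
    by (intro Lp_le_sum_const Lp_le_xi_pair g) (auto dest: pairs_mem)
  moreover have "card ?P * a\<^sup>2 \<le> (2 * D\<^sup>2) * a\<^sup>2"
    using card_pairs_touching[OF j] by (intro mult_right_mono) auto
  ultimately show ?thesis by (simp add: power_mult_distrib Lp_le_bound_mono mult.assoc)
qed

text \<open>Covariances of terms with unconnected supports vanish, and the other ones are bounded by
  Cauchy-Schwarz.\<close>

lemma centered_sum_L2:
  fixes c d N :: real
  assumes Q: "finite Q" and s: "\<And>q. q \<in> Q \<Longrightarrow> s q \<subseteq> I"
    and H: "\<And>q. q \<in> Q \<Longrightarrow> H q \<in> borel_measurable (F (s q))" "\<And>q. q \<in> Q \<Longrightarrow> Lp_le 2 (H q) c"
    and N: "\<And>q. q \<in> Q \<Longrightarrow> real (card {q' \<in> Q. \<exists>x\<in>s q. A x \<inter> s q' \<noteq> {}}) \<le> N"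
    and bd: "card Q * N * c\<^sup>2 \<le> d\<^sup>2" "0 \<le> d"
  shows "Lp_le 2 (\<lambda>\<omega>. (\<Sum>q\<in>Q. H q \<omega>) - expectation (\<lambda>\<omega>. \<Sum>q\<in>Q. H q \<omega>)) d"
proof -
  define h where "h q \<omega> = H q \<omega> - expectation (H q)" for q \<omega>
  have h2: "Lp_le 2 (h q) c" if "q \<in> Q" for q
    unfolding h_def[abs_def] by (rule Lp_le_2_centered[OF H(2)[OF that]])
  have H1: "integrable M (H q)" if "q \<in> Q" for q
    using Lp_le_1D(1)[OF Lp_le_1_of_2[OF H(2)[OF that]]] .
  have h1: "integrable M (h q)" "expectation (h q) = 0" if "q \<in> Q" for q
    unfolding h_def[abs_def] using H1[OF that] by (auto simp: prob_space)
  have hh: "Lp_le 1 (\<lambda>\<omega>. h q \<omega> * h q' \<omega>) (c * c)" if "q \<in> Q" "q' \<in> Q" for q q'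
    by (intro Lp_le_mult_L2 h2 that)
  have hm: "h q \<in> borel_measurable (F (s q))" if "q \<in> Q" for q
    unfolding h_def[abs_def] using H(1)[OF that] by measurable
  have eq: "(\<Sum>q\<in>Q. H q \<omega>) - expectation (\<lambda>\<omega>. \<Sum>q\<in>Q. H q \<omega>) = (\<Sum>q\<in>Q. h q \<omega>)" for \<omega>
    using H1 by (simp add: h_def sum_subtractf)
  have sq: "(\<Sum>q\<in>Q. h q \<omega>)\<^sup>2 = (\<Sum>q\<in>Q. \<Sum>q'\<in>Q. h q \<omega> * h q' \<omega>)" for \<omega>
    by (simp add: power2_eq_square sum_product)
  have cov: "expectation (\<lambda>\<omega>. h q \<omega> * h q' \<omega>) \<le> (if \<exists>x\<in>s q. A x \<inter> s q' \<noteq> {} then c\<^sup>2 else 0)"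
    if q: "q \<in> Q" "q' \<in> Q" for q q'
  proof (cases "\<exists>x\<in>s q. A x \<inter> s q' \<noteq> {}")
    case True
    then show ?thesis using Lp_le_1D(3)[OF hh[OF q]] by (simp add: power2_eq_square)
  next
    case False
    then have "expectation (\<lambda>\<omega>. h q \<omega> * h q' \<omega>) = expectation (h q) * expectation (h q')"
      using q s by (intro expectation_mult_indep[of "s q" "s q'"] hm h1) auto
    then show ?thesis using h1(2)[OF q(1)] False by simp
  qed
  have "expectation (\<lambda>\<omega>. (\<Sum>q\<in>Q. h q \<omega>)\<^sup>2) = (\<Sum>q\<in>Q. \<Sum>q'\<in>Q. expectation (\<lambda>\<omega>. h q \<omega> * h q' \<omega>))"
    unfolding sq using Lp_le_1D(1)[OF hh] by simp
  also have "\<dots> \<le> (\<Sum>q\<in>Q. \<Sum>q'\<in>Q. if \<exists>x\<in>s q. A x \<inter> s q' \<noteq> {} then c\<^sup>2 else 0)"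
    by (intro sum_mono cov)
  also have "\<dots> = (\<Sum>q\<in>Q. card {q' \<in> Q. \<exists>x\<in>s q. A x \<inter> s q' \<noteq> {}} * c\<^sup>2)"
    using Q by (simp add: sum.If_cases Int_def)
  also have "\<dots> \<le> (\<Sum>q\<in>Q. N * c\<^sup>2)"
    by (intro sum_mono mult_right_mono N) auto
  also have "\<dots> \<le> d\<^sup>2" using bd by (simp add: mult.assoc)
  finally have E: "expectation (\<lambda>\<omega>. (\<Sum>q\<in>Q. h q \<omega>)\<^sup>2) \<le> d\<^sup>2" .
  show ?thesis unfolding eq
  proof (rule Lp_le_2I)
    show "(\<lambda>\<omega>. \<Sum>q\<in>Q. h q \<omega>) \<in> borel_measurable M" using h1(1) by auto
    show "integrable M (\<lambda>\<omega>. (\<Sum>q\<in>Q. h q \<omega>)\<^sup>2)"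
      unfolding sq using Lp_le_1D(1)[OF hh] by auto
  qed (use E bd in auto)
qed

lemma psum_fluctuation:
  assumes g: "case_prod g \<in> borel_measurable (borel \<Otimes>\<^sub>M borel)" "\<And>x y. \<bar>g x y\<bar> \<le> \<bar>x * y\<bar>"
  shows "Lp_le 2 (\<lambda>\<omega>. psum pairs g \<omega> - expectation (psum pairs g)) (2 * B * \<delta>)"
proof -
  define s where "s p = {fst p, snd p}" for p :: "'i \<times> 'i"
  have sI: "s p \<subseteq> I" if "p \<in> pairs" for p using pairs_mem[OF that] by (auto simp: s_def)
  have "Lp_le 2 (\<lambda>\<omega>. (\<Sum>p\<in>pairs. g (\<xi> (fst p) \<omega>) (\<xi> (snd p) \<omega>))
      - expectation (\<lambda>\<omega>. \<Sum>p\<in>pairs. g (\<xi> (fst p) \<omega>) (\<xi> (snd p) \<omega>))) (2 * B * \<delta>)"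
  proof (rule centered_sum_L2[where c="a\<^sup>2" and N="4 * D\<^sup>2" and s=s])
    fix p assume p: "p \<in> pairs"
    show "s p \<subseteq> I" by (rule sI[OF p])
    have "psum {p} g \<in> borel_measurable (F (s p))"
      by (rule psum_measurable_F) (use p sI[OF p] g in \<open>auto simp: s_def\<close>)
    then show "(\<lambda>\<omega>. g (\<xi> (fst p) \<omega>) (\<xi> (snd p) \<omega>)) \<in> borel_measurable (F (s p))"
      by (simp add: psum_def[abs_def])
    show "Lp_le 2 (\<lambda>\<omega>. g (\<xi> (fst p) \<omega>) (\<xi> (snd p) \<omega>)) (a\<^sup>2)"
      using sI[OF p] by (intro Lp_le_xi_pair g) (auto simp: s_def)
    have "real (card {q \<in> pairs. \<exists>x\<in>s p. A x \<inter> s q \<noteq> {}})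
        \<le> real (card (\<Union>x\<in>s p. {q \<in> pairs. fst q \<in> A x \<or> snd q \<in> A x}))"
      using finite_pairs by (intro of_nat_mono card_mono) (auto simp: s_def)
    also have "\<dots> \<le> 2 * (2 * D\<^sup>2)"
      using sI[OF p] by (intro card_UN_le_mult card_pairs_touching) (auto simp: s_def card_insert_if)
    finally show "real (card {q \<in> pairs. \<exists>x\<in>s p. A x \<inter> s q \<noteq> {}}) \<le> 4 * D\<^sup>2" by simp
  next
    have "card pairs * (4 * D\<^sup>2) * (a\<^sup>2)\<^sup>2 = 4 * \<delta>\<^sup>2 * (card pairs * a\<^sup>2)"
      by (simp add: power2_eq_square)
    also have "\<dots> \<le> 4 * \<delta>\<^sup>2 * ((card I * D) * a\<^sup>2)"
      by (intro mult_left_mono mult_right_mono card_pairs) auto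
    also have "\<dots> \<le> 4 * \<delta>\<^sup>2 * B\<^sup>2"
    proof (rule mult_left_mono)
      have "B * 1 \<le> B * B" using B_ge_1 by (intro mult_left_mono) auto
      then show "card I * D * a\<^sup>2 \<le> B\<^sup>2" using card_I by (simp add: power2_eq_square)
    qed auto
    finally show "card pairs * (4 * D\<^sup>2) * (a\<^sup>2)\<^sup>2 \<le> (2 * B * \<delta>)\<^sup>2"
      by (simp add: power_mult_distrib mult_ac)
    show "0 \<le> 2 * B * \<delta>" using B_ge_1 delta_pos by simp
  qed (rule finite_pairs)
  then show ?thesis by (simp add: psum_def[abs_def])
qed

lemma psum_L1:
  assumes g: "case_prod g \<in> borel_measurable (borel \<Otimes>\<^sub>M borel)" 
    and E: "\<And>i k. i \<in> I \<Longrightarrow> k \<in> I \<Longrightarrow> Lp_le 1 (\<lambda>\<omega>. g (\<xi> i \<omega>) (\<xi> k \<omega>)) (r * a\<^sup>2)" and r: "0 \<le> r"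
  shows "Lp_le 1 (psum pairs g) (r * B)"
proof (rule Lp_le_bound_mono)
  show "Lp_le 1 (psum pairs g) (card pairs * (r * a\<^sup>2))"
    unfolding psum_def[abs_def] by (intro Lp_le_sum_const E) (auto dest: pairs_mem)
  have "card pairs * (r * a\<^sup>2) = r * (card pairs * a\<^sup>2)" by simp
  also have "\<dots> \<le> r * ((card I * D) * a\<^sup>2)"
    using r by (intro mult_left_mono mult_right_mono card_pairs) auto
  also have "\<dots> \<le> r * B" using card_I r by (intro mult_left_mono) auto
  finally show "card pairs * (r * a\<^sup>2) \<le> r * B" .
qed

lemma S_eq: "S \<omega> = (\<Sum>i\<in>I. \<xi> i \<omega> * \<eta> i \<omega>)"
  unfolding psum_def pairs_def \<eta>_def using finite_I finite_A
  by (subst sum.Sigma[symmetric, of I A "\<lambda>i k. \<xi> i \<omega> * \<xi> k \<omega>", simplified case_prod_unfold])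
     (auto simp: sum_distrib_left)

definition W_off :: "'i \<Rightarrow> 'a \<Rightarrow> real" where "W_off j \<omega> = W \<omega> - \<eta> j \<omega>"

lemma W_off_eq: "j \<in> I \<Longrightarrow> W_off j \<omega> = (\<Sum>i\<in>I - A j. \<xi> i \<omega>)"
  unfolding W_off_def W_def \<eta>_def using sum_diff[OF finite_I A_sub, of j "\<lambda>i. \<xi> i \<omega>"] by simp

lemma W_off_measurable_F: "j \<in> I \<Longrightarrow> W_off j \<in> borel_measurable (F (I - A j))"
proof -
  assume j: "j \<in> I"
  have "(\<lambda>\<omega>. \<Sum>i\<in>I - A j. \<xi> i \<omega>) \<in> borel_measurable (F (I - A j))"
    by (intro borel_measurable_sum xi_measurable_F) auto
  then show ?thesis by (simp add: W_off_eq[OF j, abs_def])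
qed

text \<open>Replacing \<open>L\<close> by \<open>L - \<lambda>\<^sub>j\<close> in \<open>E (\<xi>\<^sub>j * L^3)\<close>, where \<open>\<lambda>\<^sub>j\<close> is the part of \<open>L\<close>
  near \<open>j\<close>, costs nothing in expectation; a fourth moment is thereby bounded by a second one.\<close>

lemma weighted_sum_L4:
  assumes c: "\<And>i. i \<in> I \<Longrightarrow> \<bar>c i\<bar> \<le> 1"
  shows "Lp_le 4 (\<lambda>\<omega>. \<Sum>i\<in>I. c i * \<xi> i \<omega>) (1 + 7 * B)"
proof -
  define L where "L \<omega> = (\<Sum>i\<in>I. c i * \<xi> i \<omega>)" for \<omega>
  define l where "l j \<omega> = (\<Sum>k\<in>A j. c k * \<xi> k \<omega>)" for j \<omega>
  have cx: "Lp_le 4 (\<lambda>\<omega>. c i * \<xi> i \<omega>) a" if "i \<in> I" for i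
    using c[OF that] a_pos by (intro Lp_le_bound_mono[OF Lp_le_cmult[OF L4[OF that]]]) (simp add: mult_le_cancel_right1)
  have L0: "Lp_le 4 L (card I * a)"
    unfolding L_def[abs_def] by (intro Lp_le_sum_const cx) auto
  have l4: "Lp_le 4 (l j) \<delta>" if j: "j \<in> I" for j
    unfolding l_def[abs_def] using A_sub[OF j] card_A[OF j] a_pos
    by (intro Lp_le_bound_mono[OF Lp_le_sum_const[where c=a]] cx mult_right_mono) auto
  define N where "N = root 4 (expectation (\<lambda>\<omega>. \<bar>L \<omega>\<bar> ^ 4))"
  have N0: "0 \<le> N" unfolding N_def by simp
  have N4: "N ^ 4 = expectation (\<lambda>\<omega>. \<bar>L \<omega>\<bar> ^ 4)"
    unfolding N_def by (rule real_root_pow_pos2) auto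
  have LN: "Lp_le 4 L N" using L0 N0 by (simp add: Lp_le_def N4)
  have l2: "Lp_le 2 (\<lambda>\<omega>. c j * \<xi> j \<omega> * l j \<omega>) (a * \<delta>)" if "j \<in> I" for j
    by (intro Lp_le_mult_L4 cx l4 that)
  have cube: "Lp_le 1 (\<lambda>\<omega>. c j * \<xi> j \<omega> * ((L \<omega>) ^ 3 - (L \<omega> - l j \<omega>) ^ 3)) (a * \<delta> * (3 * N\<^sup>2 + 3 * N + 1))"
    if j: "j \<in> I" for j
  proof -
    have "Lp_le 2 (\<lambda>\<omega>. 3 * (L \<omega> * L \<omega>) - 3 * (L \<omega> * l j \<omega>) + l j \<omega> * l j \<omega>)
        (\<bar>3\<bar> * (N * N) + \<bar>3\<bar> * (N * \<delta>) + \<delta> * \<delta>)"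
      by (intro Lp_le_add Lp_le_diff Lp_le_cmult Lp_le_mult_L4 LN l4 j)
    from Lp_le_mult_L2[OF l2[OF j] this]
    have "Lp_le 1 (\<lambda>\<omega>. c j * \<xi> j \<omega> * ((L \<omega>) ^ 3 - (L \<omega> - l j \<omega>) ^ 3))
        (a * \<delta> * (3 * (N * N) + 3 * (N * \<delta>) + \<delta> * \<delta>))"
      by (simp add: power3_eq_cube algebra_simps)
    then show ?thesis
    proof (rule Lp_le_bound_mono)
      have "N * \<delta> \<le> N * 1" "\<delta> * \<delta> \<le> 1 * 1"
        using N0 delta_pos delta_le_1 by (intro mult_left_mono mult_mono; simp)+
      then show "a * \<delta> * (3 * (N * N) + 3 * (N * \<delta>) + \<delta> * \<delta>) \<le> a * \<delta> * (3 * N\<^sup>2 + 3 * N + 1)"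
        using a_pos delta_pos by (intro mult_left_mono) (auto simp: power2_eq_square)
    qed
  qed
  have zero: "expectation (\<lambda>\<omega>. \<xi> j \<omega> * (c j * (L \<omega> - l j \<omega>) ^ 3)) = 0"
    and int0: "integrable M (\<lambda>\<omega>. c j * \<xi> j \<omega> * (L \<omega> - l j \<omega>) ^ 3)" if j: "j \<in> I" for j
  proof -
    have d: "Lp_le 4 (\<lambda>\<omega>. L \<omega> - l j \<omega>) (N + \<delta>)" by (intro Lp_le_diff LN l4 j)
    have d2: "Lp_le 2 (\<lambda>\<omega>. (L \<omega> - l j \<omega>) * (L \<omega> - l j \<omega>)) ((N + \<delta>) * (N + \<delta>))"
      by (intro Lp_le_mult_L4 d)
    have d3: "integrable M (\<lambda>\<omega>. (L \<omega> - l j \<omega>) * (L \<omega> - l j \<omega>) * (L \<omega> - l j \<omega>))"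
      by (rule Lp_le_1D(1)[OF Lp_le_mult_L2[OF d2 Lp_le_2_of_4[OF d]]])
    have "(\<lambda>\<omega>. \<Sum>i\<in>I - A j. c i * \<xi> i \<omega>) \<in> borel_measurable (F (I - A j))"
      by (intro borel_measurable_sum borel_measurable_times borel_measurable_const xi_measurable_F) auto
    moreover have "L \<omega> - l j \<omega> = (\<Sum>i\<in>I - A j. c i * \<xi> i \<omega>)" for \<omega>
      unfolding L_def l_def by (rule sum_diff[OF finite_I A_sub[OF j], symmetric])
    ultimately have [measurable]: "(\<lambda>\<omega>. L \<omega> - l j \<omega>) \<in> borel_measurable (F (I - A j))" by simp
    show "expectation (\<lambda>\<omega>. \<xi> j \<omega> * (c j * (L \<omega> - l j \<omega>) ^ 3)) = 0"
      using d3 by (intro expectation_xi_mult_zero j) (auto simp: power3_eq_cube)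
    have "Lp_le 1 (\<lambda>\<omega>. (c j * \<xi> j \<omega> * (L \<omega> - l j \<omega>)) * ((L \<omega> - l j \<omega>) * (L \<omega> - l j \<omega>)))
       ((a * (N + \<delta>)) * ((N + \<delta>) * (N + \<delta>)))"
      by (intro Lp_le_mult_L2 Lp_le_mult_L4 cx d j)
    from Lp_le_1D(1)[OF this] show "integrable M (\<lambda>\<omega>. c j * \<xi> j \<omega> * (L \<omega> - l j \<omega>) ^ 3)"
      by (simp add: power3_eq_cube mult_ac)
  qed
  have "\<bar>L \<omega>\<bar> ^ 4 = (\<Sum>j\<in>I. c j * \<xi> j \<omega> * ((L \<omega>) ^ 3 - (L \<omega> - l j \<omega>) ^ 3)
      + c j * \<xi> j \<omega> * (L \<omega> - l j \<omega>) ^ 3)" for \<omega>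
  proof -
    have "\<bar>L \<omega>\<bar> ^ 4 = L \<omega> * L \<omega> ^ 3" by (simp add: eval_nat_numeral)
    also have "\<dots> = (\<Sum>j\<in>I. c j * \<xi> j \<omega> * L \<omega> ^ 3)"
      unfolding L_def by (simp only: sum_distrib_right)
    finally show ?thesis by (simp add: algebra_simps)
  qed
  then have "N ^ 4 = (\<Sum>j\<in>I. expectation (\<lambda>\<omega>. c j * \<xi> j \<omega> * ((L \<omega>) ^ 3 - (L \<omega> - l j \<omega>) ^ 3))
      + expectation (\<lambda>\<omega>. c j * \<xi> j \<omega> * (L \<omega> - l j \<omega>) ^ 3))"
    unfolding N4 using Lp_le_1D(1)[OF cube] int0 by simp
  also have "\<dots> = (\<Sum>j\<in>I. expectation (\<lambda>\<omega>. c j * \<xi> j \<omega> * ((L \<omega>) ^ 3 - (L \<omega> - l j \<omega>) ^ 3)))"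
    using zero by (intro sum.cong) (auto simp: mult_ac)
  also have "\<dots> \<le> card I * (a * \<delta> * (3 * N\<^sup>2 + 3 * N + 1))"
  proof (rule sum_bounded_above)
    fix j assume "j \<in> I"
    show "expectation (\<lambda>\<omega>. c j * \<xi> j \<omega> * ((L \<omega>) ^ 3 - (L \<omega> - l j \<omega>) ^ 3)) \<le> a * \<delta> * (3 * N\<^sup>2 + 3 * N + 1)"
      by (rule abs_le_D1[OF Lp_le_1D(3)[OF cube[OF \<open>j \<in> I\<close>]]])
  qed
  also have "\<dots> = (card I * (a * \<delta>)) * (3 * N\<^sup>2 + 3 * N + 1)" by simp
  also have "\<dots> \<le> B * (3 * N\<^sup>2 + 3 * N + 1)"
    using N0 by (intro mult_right_mono card_sum_bounds) auto
  finally have main: "N ^ 4 \<le> B * (3 * N\<^sup>2 + 3 * N + 1)" .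
  have "N \<le> 1 + 7 * B"
  proof (cases "N \<le> 1")
    case False
    then have N1: "1 < N" by simp
    then have "N * 1 \<le> N * N" "1 * 1 \<le> N * N" by (intro mult_left_mono mult_mono; simp)+
    then have "3 * N\<^sup>2 + 3 * N + 1 \<le> 7 * N\<^sup>2" by (simp add: power2_eq_square)
    then have "B * (3 * N\<^sup>2 + 3 * N + 1) \<le> B * (7 * N\<^sup>2)" using B_ge_1 by (intro mult_left_mono) auto
    with main have "N\<^sup>2 * N\<^sup>2 \<le> (7 * B) * N\<^sup>2" by (simp add: eval_nat_numeral mult_ac)
    then have "N\<^sup>2 \<le> 7 * B" using N1 by (intro mult_right_le_imp_le[of "N\<^sup>2" "N\<^sup>2"]) auto
    moreover have "N \<le> N\<^sup>2" using N1 by (simp add: power2_eq_square)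
    ultimately show ?thesis by simp
  qed (use B_ge_1 in auto)
  with LN show ?thesis unfolding L_def[abs_def] by (rule Lp_le_bound_mono)
qed

text \<open>A bound for the \<open>L\<^sup>4\<close> norms of \<open>W\<close> and of all \<open>W_off j\<close>.\<close>

definition nW :: real where "nW = 2 + 7 * B"

lemma nW_ge_1: "1 \<le> nW" using B_ge_1 by (simp add: nW_def)

lemma W_L4: "Lp_le 4 W nW"
  unfolding W_def[abs_def] using weighted_sum_L4[of "\<lambda>_. 1"] by (auto intro: Lp_le_bound_mono simp: nW_def)

lemma W_off_L4: "j \<in> I \<Longrightarrow> Lp_le 4 (W_off j) nW"
  unfolding W_off_def[abs_def]
  using Lp_le_diff[OF weighted_sum_L4[of "\<lambda>_. 1"] Lp_le_eta, of j] delta_le_1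
  by (auto intro: Lp_le_bound_mono simp: W_def[abs_def] nW_def)

lemma expectation_S: "expectation S = 1"
proof -
  have int: "integrable M (\<lambda>\<omega>. \<xi> i \<omega> * \<eta> i \<omega>)" "integrable M (\<lambda>\<omega>. \<xi> i \<omega> * W_off i \<omega>)" if "i \<in> I" for i
    using Lp_le_1D(1)[OF Lp_le_1_of_2[OF Lp_le_mult_L4[OF L4[OF that] Lp_le_eta[OF that]]]]
      Lp_le_1D(1)[OF Lp_le_1_of_2[OF Lp_le_mult_L4[OF L4[OF that] W_off_L4[OF that]]]] by auto
  have "1 = expectation (\<lambda>\<omega>. (W \<omega>)\<^sup>2)" using variance_1 by (simp add: W_def)
  also have "\<dots> = expectation (\<lambda>\<omega>. \<Sum>i\<in>I. \<xi> i \<omega> * \<eta> i \<omega> + \<xi> i \<omega> * W_off i \<omega>)"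
  proof (rule Bochner_Integration.integral_cong[OF refl])
    fix \<omega>
    have "(W \<omega>)\<^sup>2 = (\<Sum>i\<in>I. \<xi> i \<omega> * W \<omega>)"
      by (simp add: power2_eq_square W_def sum_distrib_right)
    then show "(W \<omega>)\<^sup>2 = (\<Sum>i\<in>I. \<xi> i \<omega> * \<eta> i \<omega> + \<xi> i \<omega> * W_off i \<omega>)"
      by (simp add: W_off_def algebra_simps)
  qed
  also have "\<dots> = (\<Sum>i\<in>I. expectation (\<lambda>\<omega>. \<xi> i \<omega> * \<eta> i \<omega>) + expectation (\<lambda>\<omega>. \<xi> i \<omega> * W_off i \<omega>))"
    using int by simp
  also have "\<dots> = (\<Sum>i\<in>I. expectation (\<lambda>\<omega>. \<xi> i \<omega> * \<eta> i \<omega>))"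
    using Lp_le_1D(1)[OF Lp_le_1_of_2[OF Lp_le_2_of_4[OF W_off_L4]]]
    by (intro sum.cong) (auto simp: expectation_xi_mult_zero W_off_measurable_F)
  also have "\<dots> = expectation S" using int by (simp add: S_eq[abs_def])
  finally show ?thesis by simp
qed

lemma S_minus_1_L2: "Lp_le 2 (\<lambda>\<omega>. S \<omega> - 1) (2 * B * \<delta>)"
  using psum_fluctuation[of "(*)"] by (simp add: expectation_S)

lemma one_le_card: "1 \<le> card I * (a * \<delta>)"
proof -
  have "Lp_le 1 S (card I * (a * \<delta>))"
    unfolding S_eq[abs_def] by (intro Lp_le_sum_const Lp_le_1_of_2 Lp_le_mult_L4 L4 Lp_le_eta) auto
  from Lp_le_1D(3)[OF this] show ?thesis by (simp add: expectation_S)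
qed

lemma sum_nbhd_swap:
  fixes g :: "'i \<Rightarrow> real"
  shows "(\<Sum>i\<in>I. \<Sum>k\<in>A i. g k) = (\<Sum>k\<in>I. real (card (A k)) * g k)"
proof -
  have restr: "(\<Sum>k\<in>A i. g k) = (\<Sum>k\<in>I. if k \<in> A i then g k else 0)" if "i \<in> I" for i and g :: "'i \<Rightarrow> real"
    using sum.inter_restrict[OF finite_I, of g "A i"] A_sub[OF that] by (simp add: Int_absorb1)
  have "(\<Sum>i\<in>I. \<Sum>k\<in>A i. g k) = (\<Sum>i\<in>I. \<Sum>k\<in>I. if k \<in> A i then g k else 0)"
    by (intro sum.cong refl restr)
  also have "\<dots> = (\<Sum>k\<in>I. \<Sum>i\<in>I. if i \<in> A k then g k else 0)"
    by (subst sum.swap) (use A_sym in \<open>auto intro!: sum.cong\<close>)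
  also have "\<dots> = (\<Sum>k\<in>I. \<Sum>i\<in>A k. g k)"
    by (intro sum.cong refl restr[symmetric])
  finally show ?thesis by simp
qed

lemma one_le_second_moments:
  "1 \<le> D * (\<Sum>i\<in>I. expectation (\<lambda>\<omega>. (\<xi> i \<omega>)\<^sup>2))"
proof -
  define v where "v i = expectation (\<lambda>\<omega>. (\<xi> i \<omega>)\<^sup>2)" for i
  have v0: "0 \<le> v i" for i by (simp add: v_def)
  note L2 = Lp_le_2D(1)[OF Lp_le_2_of_4[OF L4]]
  have prod: "Lp_le 1 (\<lambda>\<omega>. \<xi> i \<omega> * \<xi> k \<omega>) (a * a)" if "i \<in> I" "k \<in> I" for i k
    by (intro Lp_le_mult_L2 Lp_le_2_of_4 L4 that)
  have cov: "expectation (\<lambda>\<omega>. \<xi> i \<omega> * \<xi> k \<omega>) \<le> (v i + v k) / 2" if ik: "i \<in> I" "k \<in> I" for i k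
  proof -
    have "expectation (\<lambda>\<omega>. \<xi> i \<omega> * \<xi> k \<omega>) \<le> expectation (\<lambda>\<omega>. ((\<xi> i \<omega>)\<^sup>2 + (\<xi> k \<omega>)\<^sup>2) / 2)"
    proof (rule integral_mono)
      show "integrable M (\<lambda>\<omega>. \<xi> i \<omega> * \<xi> k \<omega>)" by (rule Lp_le_1D(1)[OF prod[OF ik]])
      show "integrable M (\<lambda>\<omega>. ((\<xi> i \<omega>)\<^sup>2 + (\<xi> k \<omega>)\<^sup>2) / 2)" using L2 ik by simp
      show "\<xi> i \<omega> * \<xi> k \<omega> \<le> ((\<xi> i \<omega>)\<^sup>2 + (\<xi> k \<omega>)\<^sup>2) / 2" for \<omega>
        using sum_squares_bound[of "\<xi> i \<omega>" "\<xi> k \<omega>"] by simp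
    qed
    also have "\<dots> = (v i + v k) / 2" using L2 ik by (simp add: v_def)
    finally show ?thesis .
  qed
  have sumv: "(\<Sum>i\<in>I. \<Sum>k\<in>A i. v i) \<le> D * (\<Sum>i\<in>I. v i)"
    unfolding sum_distrib_left using card_A v0 by (intro sum_mono) (auto intro: mult_right_mono)
  have swap: "(\<Sum>i\<in>I. \<Sum>k\<in>A i. v k) = (\<Sum>i\<in>I. \<Sum>k\<in>A i. v i)"
    by (simp add: sum_nbhd_swap)
  have "1 = expectation (\<lambda>\<omega>. \<Sum>i\<in>I. \<Sum>k\<in>A i. \<xi> i \<omega> * \<xi> k \<omega>)"
    using expectation_S by (simp add: S_eq[abs_def] \<eta>_def sum_distrib_left)
  also have "\<dots> = (\<Sum>i\<in>I. \<Sum>k\<in>A i. expectation (\<lambda>\<omega>. \<xi> i \<omega> * \<xi> k \<omega>))"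
    using Lp_le_1D(1)[OF prod] A_mem by (simp add: Bochner_Integration.integral_sum)
  also have "\<dots> \<le> (\<Sum>i\<in>I. \<Sum>k\<in>A i. (v i + v k) / 2)"
    by (intro sum_mono cov) (auto dest: A_mem)
  also have "\<dots> = ((\<Sum>i\<in>I. \<Sum>k\<in>A i. v i) + (\<Sum>i\<in>I. \<Sum>k\<in>A i. v k)) / 2"
    by (simp add: sum.distrib sum_divide_distrib[symmetric])
  also have "\<dots> \<le> D * (\<Sum>i\<in>I. v i)" using sumv swap by simp
  finally show ?thesis by (simp add: v_def)
qed

end


section \<open>Studentized sums and the leave-one-out Stein identity\<close>

text \<open>The clipping at \<open>1/4\<close> makes the reciprocal square root Lipschitz and leaves it unchanged near one.\<close>

definition inv_sqrt :: "real \<Rightarrow> real" where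
  "inv_sqrt g = 1 / sqrt (max g (1/4))"

lemma inv_sqrt_bounds: "0 < inv_sqrt g" "inv_sqrt g \<le> 2"
proof -
  have "sqrt ((1/2)\<^sup>2) \<le> sqrt (max g (1/4))" by (intro real_sqrt_le_mono) (auto simp: power2_eq_square)
  then have "1/2 \<le> sqrt (max g (1/4))" by simp
  then show "0 < inv_sqrt g" "inv_sqrt g \<le> 2" by (auto simp: inv_sqrt_def field_simps)
qed

lemma inv_sqrt_Lipschitz: "\<bar>inv_sqrt g - inv_sqrt g'\<bar> \<le> 4 * \<bar>g - g'\<bar>"
proof -
  define u v where "u = sqrt (max g (1/4))" and "v = sqrt (max g' (1/4))"
  have "sqrt ((1/2)\<^sup>2) \<le> u" "sqrt ((1/2)\<^sup>2) \<le> v"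
    unfolding u_def v_def by (intro real_sqrt_le_mono; auto simp: power2_eq_square)+
  then have uv: "1/2 \<le> u" "1/2 \<le> v" by auto
  have sq: "u\<^sup>2 = max g (1/4)" "v\<^sup>2 = max g' (1/4)" unfolding u_def v_def by auto
  have "(1/2) * (1/2) * (1/2 + 1/2) \<le> u * v * (u + v)" using uv by (intro mult_mono add_mono) auto
  then have d: "1/4 \<le> u * v * (u + v)" by simp
  have "inv_sqrt g - inv_sqrt g' = (v\<^sup>2 - u\<^sup>2) / (u * v * (u + v))"
    using uv unfolding inv_sqrt_def u_def[symmetric] v_def[symmetric]
    by (simp add: divide_simps) (simp add: power2_eq_square algebra_simps)
  then have "\<bar>inv_sqrt g - inv_sqrt g'\<bar> = \<bar>v\<^sup>2 - u\<^sup>2\<bar> / (u * v * (u + v))"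
    using d by (simp add: abs_divide)
  also have "\<dots> \<le> \<bar>v\<^sup>2 - u\<^sup>2\<bar> / (1/4)" using d by (intro divide_left_mono) auto
  also have "\<dots> \<le> 4 * \<bar>g - g'\<bar>" unfolding sq by simp
  finally show ?thesis .
qed

lemma inv_sqrt_sq_mult: "\<bar>(inv_sqrt g)\<^sup>2 * g - 1\<bar> \<le> 4 * \<bar>g - 1\<bar>"
  by (auto simp: inv_sqrt_def power_divide max_def)

lemma inv_sqrt_measurable [measurable]: "inv_sqrt \<in> borel_measurable borel"
  unfolding inv_sqrt_def[abs_def] by measurable

text \<open>\<open>G\<close> is an estimate of the variance of the sum, and \<open>G_off j\<close> a version of it that does not see
  the neighbourhood of \<open>j\<close>. The choice \<open>G = 1\<close> gives the plain normalized sum.\<close>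

locale studentized_dependence = local_dependence M I A F \<xi> D a B
  for M :: "'a measure" and I :: "'i set" and A :: "'i \<Rightarrow> 'i set" and F :: "'i set \<Rightarrow> 'a measure"
    and \<xi> :: "'i \<Rightarrow> 'a \<Rightarrow> real" and D a B :: real +
  fixes G :: "'a \<Rightarrow> real" and G_off :: "'i \<Rightarrow> 'a \<Rightarrow> real" and c :: real
  assumes G_meas [measurable]: "G \<in> borel_measurable M"
    and G_off_meas: "\<And>j. j \<in> I \<Longrightarrow> G_off j \<in> borel_measurable (F (I - A j))"
    and G_minus_1: "Lp_le 2 (\<lambda>\<omega>. G \<omega> - 1) (c * \<delta>)"
    and G_minus_off: "\<And>j. j \<in> I \<Longrightarrow> Lp_le 2 (\<lambda>\<omega>. G \<omega> - G_off j \<omega>) (c * \<delta>\<^sup>2)"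
    and S_minus_G: "Lp_le 1 (\<lambda>\<omega>. S \<omega> - G \<omega>) (c * \<delta>)"
    and c_ge_1: "1 \<le> c"
begin

definition \<rho> :: "'a \<Rightarrow> real" where "\<rho> \<omega> = inv_sqrt (G \<omega>)"
definition \<rho>_off :: "'i \<Rightarrow> 'a \<Rightarrow> real" where "\<rho>_off j \<omega> = inv_sqrt (G_off j \<omega>)"
definition T :: "'a \<Rightarrow> real" where "T \<omega> = W \<omega> * \<rho> \<omega>"
definition T_off :: "'i \<Rightarrow> 'a \<Rightarrow> real" where "T_off j \<omega> = W_off j \<omega> * \<rho>_off j \<omega>"
definition shift :: "'i \<Rightarrow> 'a \<Rightarrow> real" where "shift j \<omega> = \<eta> j \<omega> * \<rho> \<omega>"

lemma rho_bounds: "0 < \<rho> \<omega>" "\<rho> \<omega> \<le> 2"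
  and rho_off_bounds: "0 < \<rho>_off j \<omega>" "\<rho>_off j \<omega> \<le> 2"
  unfolding \<rho>_def \<rho>_off_def by (rule inv_sqrt_bounds)+

lemma rho_measurable [measurable]: "\<rho> \<in> borel_measurable M"
  unfolding \<rho>_def[abs_def] by measurable

lemma W_measurable [measurable]: "W \<in> borel_measurable M"
  using W_L4 Lp_leD(1) by blast

lemma T_measurable [measurable]: "T \<in> borel_measurable M"
  unfolding T_def[abs_def] by measurable

lemma T_off_measurable_F: "j \<in> I \<Longrightarrow> T_off j \<in> borel_measurable (F (I - A j))"
  "j \<in> I \<Longrightarrow> \<rho>_off j \<in> borel_measurable (F (I - A j))"
proof -
  assume j: "j \<in> I"
  note [measurable] = G_off_meas[OF j] W_off_measurable_F[OF j]
  show "\<rho>_off j \<in> borel_measurable (F (I - A j))" unfolding \<rho>_off_def[abs_def] by measurable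
  then show "T_off j \<in> borel_measurable (F (I - A j))" unfolding T_off_def[abs_def] by measurable
qed

lemma T_minus_shift: "T \<omega> - shift j \<omega> = W_off j \<omega> * \<rho> \<omega>"
  by (simp add: T_def shift_def W_off_def algebra_simps)

lemma abs_T_le: "\<bar>T \<omega>\<bar> \<le> 2 * \<bar>W \<omega>\<bar>"
  unfolding T_def abs_mult using rho_bounds[of \<omega>] mult_left_mono[of "\<rho> \<omega>" 2 "\<bar>W \<omega>\<bar>"] by simp

lemma abs_shift_le: "\<bar>shift j \<omega>\<bar> \<le> 2 * e j \<omega>"
proof -
  have "\<bar>\<eta> j \<omega>\<bar> * \<bar>\<rho> \<omega>\<bar> \<le> e j \<omega> * 2"
    using rho_bounds[of \<omega>] abs_eta_le_e[of j \<omega>] e_nonneg[of j \<omega>] by (intro mult_mono) auto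
  then show ?thesis by (simp add: shift_def abs_mult)
qed

lemma sum_xi_rho_shift: "(\<Sum>j\<in>I. \<xi> j \<omega> * \<rho> \<omega> * shift j \<omega>) = (\<rho> \<omega>)\<^sup>2 * S \<omega>"
  unfolding S_eq by (simp add: shift_def sum_distrib_left power2_eq_square mult_ac)

lemma rho_sq_S_L1: "Lp_le 1 (\<lambda>\<omega>. (\<rho> \<omega>)\<^sup>2 * S \<omega> - 1) (8 * c * \<delta>)"
proof -
  have 1: "Lp_le 1 (\<lambda>\<omega>. 4 * \<bar>S \<omega> - G \<omega>\<bar> + 4 * \<bar>G \<omega> - 1\<bar>) (\<bar>4\<bar> * (c * \<delta>) + \<bar>4\<bar> * (c * \<delta>))"
    by (intro Lp_le_add Lp_le_cmult Lp_le_abs S_minus_G Lp_le_1_of_2 G_minus_1)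
  have "Lp_le 1 (\<lambda>\<omega>. (\<rho> \<omega>)\<^sup>2 * S \<omega> - 1) (\<bar>4\<bar> * (c * \<delta>) + \<bar>4\<bar> * (c * \<delta>))"
  proof (rule Lp_le_dominated[OF 1])
    show "(\<lambda>\<omega>. (\<rho> \<omega>)\<^sup>2 * S \<omega> - 1) \<in> borel_measurable M"
      using psum_measurable[of pairs "(*)"] by measurable
    fix \<omega>
    have "(\<rho> \<omega>)\<^sup>2 \<le> 2\<^sup>2" using rho_bounds[of \<omega>] by (intro power_mono) auto
    then have "\<bar>(\<rho> \<omega>)\<^sup>2 * (S \<omega> - G \<omega>)\<bar> \<le> 4 * \<bar>S \<omega> - G \<omega>\<bar>"
      unfolding abs_mult by (intro mult_right_mono) auto
    moreover have "\<bar>(\<rho> \<omega>)\<^sup>2 * G \<omega> - 1\<bar> \<le> 4 * \<bar>G \<omega> - 1\<bar>"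
      unfolding \<rho>_def by (rule inv_sqrt_sq_mult)
    ultimately show "\<bar>(\<rho> \<omega>)\<^sup>2 * S \<omega> - 1\<bar> \<le> \<bar>4 * \<bar>S \<omega> - G \<omega>\<bar> + 4 * \<bar>G \<omega> - 1\<bar>\<bar>"
      by (simp add: right_diff_distrib)
  qed
  then show ?thesis by (simp add: mult_ac)
qed

text \<open>The summand \<open>\<xi>\<^sub>j\<close> is independent of \<open>T_off j\<close>, so \<open>\<xi>\<^sub>j * \<rho>_off j * H_off j (T_off j)\<close> has mean
  zero. It differs from \<open>\<xi>\<^sub>j * \<rho> * H (T - shift j)\<close> through three changes only, each of second order in
  \<open>\<delta>\<close>: of the factor \<open>\<rho>\<close>, of the argument, and of the function \<open>H\<close>.\<close>

lemma stein_leave_one_out: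
  fixes H :: "'a \<Rightarrow> real \<Rightarrow> real" and H_off :: "'i \<Rightarrow> 'a \<Rightarrow> real \<Rightarrow> real"
  assumes K: "0 \<le> K" "\<And>\<omega> x y. \<bar>H \<omega> x - H \<omega> y\<bar> \<le> K * \<bar>x - y\<bar>" "\<And>\<omega>. \<bar>H \<omega> 0\<bar> \<le> K"
    and meas: "(\<lambda>\<omega>. H \<omega> (T \<omega>)) \<in> borel_measurable M"
      "\<And>j. j \<in> I \<Longrightarrow> (\<lambda>\<omega>. H \<omega> (T \<omega> - shift j \<omega>)) \<in> borel_measurable M"
      "\<And>j. j \<in> I \<Longrightarrow> (\<lambda>\<omega>. H_off j \<omega> (T_off j \<omega>)) \<in> borel_measurable (F (I - A j))"
    and close: "\<And>j \<omega> x. j \<in> I \<Longrightarrow> \<bar>H \<omega> x - H_off j \<omega> x\<bar> \<le> \<bar>x\<bar> * E j \<omega>"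
    and E: "\<And>j. j \<in> I \<Longrightarrow> Lp_le 2 (E j) (q * \<delta>\<^sup>2)" "0 \<le> q"
  shows "integrable M (\<lambda>\<omega>. T \<omega> * H \<omega> (T \<omega>))"
    and "\<And>j. j \<in> I \<Longrightarrow> integrable M (\<lambda>\<omega>. \<xi> j \<omega> * \<rho> \<omega> * (H \<omega> (T \<omega>) - H \<omega> (T \<omega> - shift j \<omega>)))"
    and "\<bar>expectation (\<lambda>\<omega>. T \<omega> * H \<omega> (T \<omega>))
        - expectation (\<lambda>\<omega>. \<Sum>j\<in>I. \<xi> j \<omega> * \<rho> \<omega> * (H \<omega> (T \<omega>) - H \<omega> (T \<omega> - shift j \<omega>)))\<bar>
      \<le> B * nW * (20 * K * c + 4 * q) * \<delta>"
proof -
  have growth: "\<bar>H \<omega> x\<bar> \<le> K + K * \<bar>x\<bar>" for \<omega> x using K(2)[of \<omega> x 0] K(3)[of \<omega>] by simp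
  note nW0 = order_trans[OF zero_le_one nW_ge_1]
  show int1: "integrable M (\<lambda>\<omega>. T \<omega> * H \<omega> (T \<omega>))"
  proof (rule Lp_le_1D(1), rule Lp_le_dominated)
    show "Lp_le 1 (\<lambda>\<omega>. (2 * K) * \<bar>W \<omega>\<bar> + (4 * K) * (W \<omega> * W \<omega>)) (\<bar>2 * K\<bar> * nW + \<bar>4 * K\<bar> * (nW * nW))"
      by (intro Lp_le_add Lp_le_cmult Lp_le_abs Lp_le_mult_L2 Lp_le_1_of_2 Lp_le_2_of_4 W_L4)
    fix \<omega>
    have "\<bar>T \<omega> * H \<omega> (T \<omega>)\<bar> \<le> (2 * \<bar>W \<omega>\<bar>) * (K + K * (2 * \<bar>W \<omega>\<bar>))"
      unfolding abs_mult using abs_T_le[of \<omega>] growth[of \<omega> "T \<omega>"] mult_left_mono[OF abs_T_le[of \<omega>] K(1)] K(1)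
      by (intro mult_mono) auto
    also have "\<dots> = (2 * K) * \<bar>W \<omega>\<bar> + (4 * K) * (W \<omega> * W \<omega>)"
      by (simp add: algebra_simps)
    finally show "\<bar>T \<omega> * H \<omega> (T \<omega>)\<bar> \<le> \<bar>(2 * K) * \<bar>W \<omega>\<bar> + (4 * K) * (W \<omega> * W \<omega>)\<bar>" by simp
  qed (use meas in measurable)
  show int2: "integrable M (\<lambda>\<omega>. \<xi> j \<omega> * \<rho> \<omega> * (H \<omega> (T \<omega>) - H \<omega> (T \<omega> - shift j \<omega>)))" if j: "j \<in> I" for j
  proof (rule Lp_le_1D(1), rule Lp_le_dominated)
    show "Lp_le 1 (\<lambda>\<omega>. (4 * K) * (\<xi> j \<omega> * e j \<omega>)) (\<bar>4 * K\<bar> * (a * \<delta>))"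
      by (intro Lp_le_cmult Lp_le_mult_L2 Lp_le_2_of_4 L4 Lp_le_e j)
    fix \<omega>
    have "\<bar>H \<omega> (T \<omega>) - H \<omega> (T \<omega> - shift j \<omega>)\<bar> \<le> K * (2 * e j \<omega>)"
      using K(2)[of \<omega> "T \<omega>" "T \<omega> - shift j \<omega>"] mult_left_mono[OF abs_shift_le[of j \<omega>] K(1)] by simp
    then have "\<bar>\<xi> j \<omega> * \<rho> \<omega> * (H \<omega> (T \<omega>) - H \<omega> (T \<omega> - shift j \<omega>))\<bar> \<le> (\<bar>\<xi> j \<omega>\<bar> * 2) * (K * (2 * e j \<omega>))"
      unfolding abs_mult using rho_bounds[of \<omega>] by (intro mult_mono) auto
    then show "\<bar>\<xi> j \<omega> * \<rho> \<omega> * (H \<omega> (T \<omega>) - H \<omega> (T \<omega> - shift j \<omega>))\<bar> \<le> \<bar>(4 * K) * (\<xi> j \<omega> * e j \<omega>)\<bar>"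
      using K(1) e_nonneg[of j \<omega>] by (simp add: abs_mult mult_ac)
  next
    have [measurable]: "\<xi> j \<in> borel_measurable M" using j by (rule xi_measurable)
    show "(\<lambda>\<omega>. \<xi> j \<omega> * \<rho> \<omega> * (H \<omega> (T \<omega>) - H \<omega> (T \<omega> - shift j \<omega>))) \<in> borel_measurable M"
      using meas(1) meas(2)[OF j] by measurable
  qed
  define Z where "Z j \<omega> = \<rho>_off j \<omega> * H_off j \<omega> (T_off j \<omega>)" for j \<omega>
  define R where "R j \<omega> = \<xi> j \<omega> * \<rho> \<omega> * H \<omega> (T \<omega> - shift j \<omega>) - \<xi> j \<omega> * Z j \<omega>" for j \<omega>
  have ZF: "Z j \<in> borel_measurable (F (I - A j))" if "j \<in> I" for j
    unfolding Z_def[abs_def] using T_off_measurable_F(2)[OF that] meas(3)[OF that] by measurable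
  have Zint: "integrable M (Z j)" and xZint: "integrable M (\<lambda>\<omega>. \<xi> j \<omega> * Z j \<omega>)" if j: "j \<in> I" for j
  proof -
    note m = measurable_F_imp[OF _ ZF[OF j]] xi_measurable[OF j]
    have bd: "\<bar>Z j \<omega>\<bar> \<le> \<bar>2 * K + (4 * K) * \<bar>W_off j \<omega>\<bar> + 4 * \<bar>W_off j \<omega> * E j \<omega>\<bar>\<bar>" for \<omega>
    proof -
      have t: "\<bar>T_off j \<omega>\<bar> \<le> 2 * \<bar>W_off j \<omega>\<bar>"
        unfolding T_off_def abs_mult using rho_off_bounds[of j \<omega>] mult_left_mono[of "\<rho>_off j \<omega>" 2 "\<bar>W_off j \<omega>\<bar>"] by simp
      have "\<bar>H_off j \<omega> (T_off j \<omega>)\<bar> \<le> K + K * \<bar>T_off j \<omega>\<bar> + \<bar>T_off j \<omega>\<bar> * \<bar>E j \<omega>\<bar>"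
        using growth[of \<omega> "T_off j \<omega>"] close[OF j, of \<omega> "T_off j \<omega>"]
          mult_left_mono[OF abs_ge_self[of "E j \<omega>"], of "\<bar>T_off j \<omega>\<bar>"] by linarith
      also have "\<dots> \<le> K + K * (2 * \<bar>W_off j \<omega>\<bar>) + (2 * \<bar>W_off j \<omega>\<bar>) * \<bar>E j \<omega>\<bar>"
        using t K(1) by (intro add_mono mult_mono) auto
      finally have "\<bar>Z j \<omega>\<bar> \<le> 2 * (K + K * (2 * \<bar>W_off j \<omega>\<bar>) + (2 * \<bar>W_off j \<omega>\<bar>) * \<bar>E j \<omega>\<bar>)"
        unfolding Z_def abs_mult using rho_off_bounds[of j \<omega>] by (intro mult_mono) auto
      also have "\<dots> = 2 * K + (4 * K) * \<bar>W_off j \<omega>\<bar> + 4 * \<bar>W_off j \<omega> * E j \<omega>\<bar>"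
        by (simp add: abs_mult algebra_simps)
      finally show ?thesis by linarith
    qed
    have "Lp_le 1 (\<lambda>\<omega>. 2 * K + (4 * K) * \<bar>W_off j \<omega>\<bar> + 4 * \<bar>W_off j \<omega> * E j \<omega>\<bar>)
      (\<bar>2 * K\<bar> + \<bar>4 * K\<bar> * nW + \<bar>4\<bar> * (nW * (q * \<delta>\<^sup>2)))"
      by (intro Lp_le_add Lp_le_const Lp_le_cmult Lp_le_abs Lp_le_mult_L2 Lp_le_1_of_2 Lp_le_2_of_4 W_off_L4 E j)
    from Lp_le_dominated[OF this m(1)] bd show "integrable M (Z j)" by (intro Lp_le_1D(1)) auto
    have 2: "Lp_le 1 (\<lambda>\<omega>. (2 * K) * \<bar>\<xi> j \<omega>\<bar> + (4 * K) * \<bar>\<xi> j \<omega> * W_off j \<omega>\<bar> + 4 * \<bar>\<xi> j \<omega> * W_off j \<omega> * E j \<omega>\<bar>)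
      (\<bar>2 * K\<bar> * a + \<bar>4 * K\<bar> * (a * nW) + \<bar>4\<bar> * (a * nW * (q * \<delta>\<^sup>2)))"
      by (intro Lp_le_add Lp_le_cmult Lp_le_abs Lp_le_mult_L2 Lp_le_mult_L4 Lp_le_1_of_2 Lp_le_2_of_4 L4 W_off_L4 E j)
    have "\<bar>\<xi> j \<omega> * Z j \<omega>\<bar> \<le> \<bar>(2 * K) * \<bar>\<xi> j \<omega>\<bar> + (4 * K) * \<bar>\<xi> j \<omega> * W_off j \<omega>\<bar> + 4 * \<bar>\<xi> j \<omega> * W_off j \<omega> * E j \<omega>\<bar>\<bar>" for \<omega>
    proof -
      have "\<bar>\<xi> j \<omega> * Z j \<omega>\<bar> \<le> \<bar>\<xi> j \<omega>\<bar> * \<bar>2 * K + (4 * K) * \<bar>W_off j \<omega>\<bar> + 4 * \<bar>W_off j \<omega> * E j \<omega>\<bar>\<bar>"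
        unfolding abs_mult by (intro mult_left_mono) (use bd[of \<omega>] in \<open>auto simp: abs_mult\<close>)
      also have "\<dots> = \<bar>\<xi> j \<omega> * (2 * K + (4 * K) * \<bar>W_off j \<omega>\<bar> + 4 * \<bar>W_off j \<omega> * E j \<omega>\<bar>)\<bar>"
        by (simp only: abs_mult)
      also have "\<dots> = \<bar>\<xi> j \<omega>\<bar> * (2 * K + (4 * K) * \<bar>W_off j \<omega>\<bar> + 4 * \<bar>W_off j \<omega> * E j \<omega>\<bar>)"
        unfolding abs_mult[of "\<xi> j \<omega>"] using K(1) by (subst (2) abs_of_nonneg) auto
      also have "\<dots> = (2 * K) * \<bar>\<xi> j \<omega>\<bar> + (4 * K) * \<bar>\<xi> j \<omega> * W_off j \<omega>\<bar> + 4 * \<bar>\<xi> j \<omega> * W_off j \<omega> * E j \<omega>\<bar>"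
        by (simp add: abs_mult algebra_simps)
      finally show ?thesis by linarith
    qed
    from Lp_le_dominated[OF 2 _ this] show "integrable M (\<lambda>\<omega>. \<xi> j \<omega> * Z j \<omega>)"
      using m by (intro Lp_le_1D(1)) auto
  qed
  have RL: "Lp_le 1 (R j) (a * \<delta>\<^sup>2 * (nW * (20 * K * c + 4 * q)))" if j: "j \<in> I" for j
  proof -
    let ?Y = "\<lambda>\<omega>. (16 * K) * \<bar>\<xi> j \<omega> * W_off j \<omega> * (G \<omega> - G_off j \<omega>)\<bar> + (4 * K) * \<bar>\<xi> j \<omega> * (G \<omega> - G_off j \<omega>)\<bar>
      + 4 * \<bar>\<xi> j \<omega> * W_off j \<omega> * E j \<omega>\<bar>"
    have 1: "Lp_le 1 ?Y (\<bar>16 * K\<bar> * (a * nW * (c * \<delta>\<^sup>2)) + \<bar>4 * K\<bar> * (a * (c * \<delta>\<^sup>2)) + \<bar>4\<bar> * (a * nW * (q * \<delta>\<^sup>2)))"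
      by (intro Lp_le_add Lp_le_cmult Lp_le_abs Lp_le_mult_L2 Lp_le_mult_L4 Lp_le_2_of_4 L4 W_off_L4 E G_minus_off j)
    have 2: "Lp_le 1 ?Y (a * \<delta>\<^sup>2 * (nW * (20 * K * c + 4 * q)))"
    proof (rule Lp_le_bound_mono[OF 1])
      have "4 * K * (a * (c * \<delta>\<^sup>2)) * 1 \<le> 4 * K * (a * (c * \<delta>\<^sup>2)) * nW"
        using K(1) a_pos c_ge_1 nW_ge_1 by (intro mult_left_mono mult_nonneg_nonneg) auto
      then show "\<bar>16 * K\<bar> * (a * nW * (c * \<delta>\<^sup>2)) + \<bar>4 * K\<bar> * (a * (c * \<delta>\<^sup>2)) + \<bar>4\<bar> * (a * nW * (q * \<delta>\<^sup>2))
          \<le> a * \<delta>\<^sup>2 * (nW * (20 * K * c + 4 * q))"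
        using K(1) by (simp add: algebra_simps)
    qed
    show ?thesis
    proof (rule Lp_le_dominated[OF 2])
      note [measurable] = xi_measurable[OF j] meas(2)[OF j] measurable_F_imp[OF Diff_subset ZF[OF j]]
      show "R j \<in> borel_measurable M" unfolding R_def[abs_def] by measurable
      fix \<omega>
      define w r r' x g where "w = W_off j \<omega>" and "r = \<rho> \<omega>" and "r' = \<rho>_off j \<omega>" and "x = \<xi> j \<omega>"
        and "g = \<bar>G \<omega> - G_off j \<omega>\<bar>"
      have rr: "\<bar>r - r'\<bar> \<le> 4 * g" unfolding r_def r'_def \<rho>_def \<rho>_off_def g_def by (rule inv_sqrt_Lipschitz)
      have rb: "0 < r" "r \<le> 2" "0 < r'" "r' \<le> 2" unfolding r_def r'_def by (rule rho_bounds rho_off_bounds)+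
      have g0: "0 \<le> g" by (simp add: g_def)
      have Req: "R j \<omega> = x * (r * (H \<omega> (w * r) - H \<omega> (w * r')) + (r - r') * H \<omega> (w * r')
          + r' * (H \<omega> (w * r') - H_off j \<omega> (w * r')))"
        unfolding R_def Z_def T_minus_shift T_off_def w_def r_def r'_def x_def by (simp add: algebra_simps)
      have b1: "\<bar>r * (H \<omega> (w * r) - H \<omega> (w * r'))\<bar> \<le> 2 * (K * (\<bar>w\<bar> * (4 * g)))"
      proof -
        have "\<bar>H \<omega> (w * r) - H \<omega> (w * r')\<bar> \<le> K * \<bar>w * r - w * r'\<bar>" by (rule K(2))
        also have "\<dots> = K * (\<bar>w\<bar> * \<bar>r - r'\<bar>)" by (simp only: right_diff_distrib[symmetric] abs_mult)
        also have "\<dots> \<le> K * (\<bar>w\<bar> * (4 * g))" using rr K(1) by (intro mult_left_mono) auto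
        finally show ?thesis unfolding abs_mult using rb K(1) by (intro mult_mono) auto
      qed
      have wr: "\<bar>w * r'\<bar> \<le> 2 * \<bar>w\<bar>" unfolding abs_mult using rb mult_left_mono[of r' 2 "\<bar>w\<bar>"] by simp
      have b2: "\<bar>(r - r') * H \<omega> (w * r')\<bar> \<le> (4 * g) * (K + K * (2 * \<bar>w\<bar>))"
        unfolding abs_mult using rr growth[of \<omega> "w * r'"] mult_left_mono[OF wr K(1)] K(1) g0
        by (intro mult_mono) auto
      have b3: "\<bar>r' * (H \<omega> (w * r') - H_off j \<omega> (w * r'))\<bar> \<le> 2 * ((2 * \<bar>w\<bar>) * \<bar>E j \<omega>\<bar>)"
      proof -
        have "\<bar>H \<omega> (w * r') - H_off j \<omega> (w * r')\<bar> \<le> \<bar>w * r'\<bar> * E j \<omega>" by (rule close[OF j])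
        also have "\<dots> \<le> \<bar>w * r'\<bar> * \<bar>E j \<omega>\<bar>" by (intro mult_left_mono) auto
        also have "\<dots> \<le> (2 * \<bar>w\<bar>) * \<bar>E j \<omega>\<bar>" using wr by (intro mult_right_mono) auto
        finally show ?thesis unfolding abs_mult using rb by (intro mult_mono) auto
      qed
      have "\<bar>R j \<omega>\<bar> \<le> \<bar>x\<bar> * (2 * (K * (\<bar>w\<bar> * (4 * g))) + (4 * g) * (K + K * (2 * \<bar>w\<bar>)) + 2 * ((2 * \<bar>w\<bar>) * \<bar>E j \<omega>\<bar>))"
        unfolding Req abs_mult[of x]
        by (intro mult_left_mono order_trans[OF abs_triangle_ineq] add_mono b1 b2 b3 abs_ge_zero)
      also have "\<dots> = (16 * K) * (\<bar>x\<bar> * \<bar>w\<bar> * g) + (4 * K) * (\<bar>x\<bar> * g) + 4 * (\<bar>x\<bar> * \<bar>w\<bar> * \<bar>E j \<omega>\<bar>)"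
        by (simp add: algebra_simps)
      also have "\<dots> = ?Y \<omega>" by (simp add: abs_mult x_def w_def g_def)
      finally show "\<bar>R j \<omega>\<bar> \<le> \<bar>?Y \<omega>\<bar>" by linarith
    qed
  qed
  have "T \<omega> * H \<omega> (T \<omega>) = (\<Sum>j\<in>I. \<xi> j \<omega> * \<rho> \<omega> * (H \<omega> (T \<omega>) - H \<omega> (T \<omega> - shift j \<omega>)))
      + (\<Sum>j\<in>I. R j \<omega> + \<xi> j \<omega> * Z j \<omega>)" for \<omega>
  proof -
    have "T \<omega> * H \<omega> (T \<omega>) = (\<Sum>j\<in>I. \<xi> j \<omega> * \<rho> \<omega> * H \<omega> (T \<omega>))"
      unfolding T_def W_def by (simp only: sum_distrib_right)
    then show ?thesis by (simp add: R_def right_diff_distrib sum_subtractf)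
  qed
  then have "expectation (\<lambda>\<omega>. T \<omega> * H \<omega> (T \<omega>))
     = expectation (\<lambda>\<omega>. \<Sum>j\<in>I. \<xi> j \<omega> * \<rho> \<omega> * (H \<omega> (T \<omega>) - H \<omega> (T \<omega> - shift j \<omega>)))
      + (\<Sum>j\<in>I. expectation (R j) + expectation (\<lambda>\<omega>. \<xi> j \<omega> * Z j \<omega>))"
    using int2 Lp_le_1D(1)[OF RL] xZint by simp
  also have "(\<Sum>j\<in>I. expectation (R j) + expectation (\<lambda>\<omega>. \<xi> j \<omega> * Z j \<omega>)) = (\<Sum>j\<in>I. expectation (R j))"
    using expectation_xi_mult_zero[OF _ ZF Zint] by (intro sum.cong) auto
  finally have "\<bar>expectation (\<lambda>\<omega>. T \<omega> * H \<omega> (T \<omega>))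
        - expectation (\<lambda>\<omega>. \<Sum>j\<in>I. \<xi> j \<omega> * \<rho> \<omega> * (H \<omega> (T \<omega>) - H \<omega> (T \<omega> - shift j \<omega>)))\<bar>
      = \<bar>\<Sum>j\<in>I. expectation (R j)\<bar>" by simp
  also have "\<dots> \<le> (\<Sum>j\<in>I. \<bar>expectation (R j)\<bar>)" by (rule sum_abs)
  also have "\<dots> \<le> card I * (a * \<delta>\<^sup>2 * (nW * (20 * K * c + 4 * q)))"
    by (intro sum_bounded_above Lp_le_1D(3)[OF RL])
  also have "\<dots> = (card I * (a * \<delta>\<^sup>2)) * (nW * (20 * K * c + 4 * q))" by simp
  also have "\<dots> \<le> (B * \<delta>) * (nW * (20 * K * c + 4 * q))"
    using K(1) c_ge_1 E(2) nW0 by (intro mult_right_mono card_sum_bounds mult_nonneg_nonneg add_nonneg_nonneg) auto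
  finally show "\<bar>expectation (\<lambda>\<omega>. T \<omega> * H \<omega> (T \<omega>))
        - expectation (\<lambda>\<omega>. \<Sum>j\<in>I. \<xi> j \<omega> * \<rho> \<omega> * (H \<omega> (T \<omega>) - H \<omega> (T \<omega> - shift j \<omega>)))\<bar>
      \<le> B * nW * (20 * K * c + 4 * q) * \<delta>" by (simp add: mult_ac)
qed

end


section \<open>A weighted concentration inequality\<close>

text \<open>Only the part with all three factors truncated keeps the small denominator \<open>\<alpha>\<close>. The parts with an
  excess factor are estimated by products of two.\<close>

lemma truncated_quotient_le:
  fixes t s u v \<alpha> :: real
  assumes "0 \<le> t" "0 \<le> s" "0 \<le> u" "0 \<le> v" "0 < \<alpha>"
  shows "(t + s) * ((u + v)\<^sup>2 / (u + v + \<alpha>)) \<le> 2 / \<alpha> * (t * u\<^sup>2) + 2 * (t * v + s * (u + v))"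
proof -
  have d: "0 < u + v + \<alpha>" using assms by simp
  have 1: "(u + v)\<^sup>2 / (u + v + \<alpha>) \<le> u + v" using assms by (simp add: divide_le_eq power2_eq_square algebra_simps)
  have "(u + v)\<^sup>2 \<le> 2 * u\<^sup>2 + 2 * v\<^sup>2" using zero_le_power2[of "u - v"] by (simp add: power2_eq_square algebra_simps)
  then have "(u + v)\<^sup>2 / (u + v + \<alpha>) \<le> (2 * u\<^sup>2 + 2 * v\<^sup>2) / (u + v + \<alpha>)" using d by (intro divide_right_mono) auto
  also have "\<dots> = 2 * u\<^sup>2 / (u + v + \<alpha>) + 2 * v\<^sup>2 / (u + v + \<alpha>)" by (simp add: add_divide_distrib)
  also have "\<dots> \<le> 2 * u\<^sup>2 / \<alpha> + 2 * v"
  proof (rule add_mono)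
    show "2 * u\<^sup>2 / (u + v + \<alpha>) \<le> 2 * u\<^sup>2 / \<alpha>" using assms d by (intro divide_left_mono) auto
    show "2 * v\<^sup>2 / (u + v + \<alpha>) \<le> 2 * v" using assms d by (simp add: divide_le_eq power2_eq_square algebra_simps)
  qed
  finally have 2: "(u + v)\<^sup>2 / (u + v + \<alpha>) \<le> 2 * u\<^sup>2 / \<alpha> + 2 * v" .
  have "(t + s) * ((u + v)\<^sup>2 / (u + v + \<alpha>)) \<le> t * (2 * u\<^sup>2 / \<alpha> + 2 * v) + s * (u + v)"
    unfolding distrib_right using assms 1 2 by (intro add_mono mult_left_mono) auto
  also have "\<dots> \<le> t * (2 * u\<^sup>2 / \<alpha> + 2 * v) + 2 * (s * (u + v))" using assms by simp
  also have "\<dots> = 2 / \<alpha> * (t * u\<^sup>2) + 2 * (t * v + s * (u + v))" by (simp add: algebra_simps)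
  finally show ?thesis .
qed

context local_dependence
begin

text \<open>The minimal width \<open>\<alpha>\<close> of a bump is a large multiple of \<open>\<delta>\<close>, and the linear part \<open>r0\<close> of the weight is
  small. Truncation at \<open>a * M0\<close> serves sums over triples: a product of three summands need not have a second
  moment, and its fluctuation could not be estimated otherwise.\<close>

definition \<alpha> :: real where "\<alpha> = 2000 * B * \<delta>"
definition r0 :: real where "r0 = 1 / (1000 * B)"
definition M0 :: real where "M0 = 1000 * B"
definition trunc :: "real \<Rightarrow> real" where "trunc x = min \<bar>x\<bar> (a * M0)"
definition rest :: "real \<Rightarrow> real" where "rest x = \<bar>x\<bar> - trunc x"

lemma const_bounds: "0 < \<alpha>" "0 < r0" "r0 \<le> 1" "1 \<le> M0"
  using B_ge_1 delta_pos by (auto simp: \<alpha>_def r0_def M0_def)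

lemma trunc_rest_bounds: "0 \<le> trunc x" "trunc x \<le> \<bar>x\<bar>" "trunc x \<le> a * M0" "0 \<le> rest x" "rest x \<le> \<bar>x\<bar>"
  "trunc x + rest x = \<bar>x\<bar>" "rest x \<le> x\<^sup>2 / (4 * (a * M0))"
proof -
  have p: "0 < a * M0" using a_pos const_bounds by simp
  show "0 \<le> trunc x" "trunc x \<le> \<bar>x\<bar>" "trunc x \<le> a * M0" "0 \<le> rest x" "rest x \<le> \<bar>x\<bar>"
    "trunc x + rest x = \<bar>x\<bar>"
    using p by (auto simp: trunc_def rest_def)
  have "0 \<le> (\<bar>x\<bar> - 2 * (a * M0))\<^sup>2" by simp
  then have "(\<bar>x\<bar> - a * M0) * (4 * (a * M0)) \<le> x\<^sup>2"
    by (simp add: power2_eq_square algebra_simps)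
  then have "\<bar>x\<bar> - a * M0 \<le> x\<^sup>2 / (4 * (a * M0))" using p by (simp add: le_divide_eq)
  moreover have "0 \<le> x\<^sup>2 / (4 * (a * M0))" using p by simp
  ultimately show "rest x \<le> x\<^sup>2 / (4 * (a * M0))" by (simp add: rest_def trunc_def min_def)
qed

lemma trunc_measurable [measurable]: "trunc \<in> borel_measurable borel"
  unfolding trunc_def[abs_def] by measurable

lemma rest_measurable [measurable]: "rest \<in> borel_measurable borel"
  unfolding rest_def[abs_def] by measurable

definition triples :: "('i \<times> 'i \<times> 'i) set" where "triples = Sigma I (\<lambda>i. A i \<times> A i)"

abbreviation R :: "'a \<Rightarrow> real" where "R \<equiv> psum pairs (\<lambda>x y. \<bar>x * y\<bar>)"
abbreviation R_off :: "'i \<Rightarrow> 'a \<Rightarrow> real" where "R_off j \<equiv> psum (pairs_off j) (\<lambda>x y. \<bar>x * y\<bar>)"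
abbreviation R2 :: "'a \<Rightarrow> real" where "R2 \<equiv> psum pairs (\<lambda>x y. trunc x * rest y + rest x * \<bar>y\<bar>)"
definition R3 :: "'a \<Rightarrow> real" where
  "R3 \<omega> = (\<Sum>q\<in>triples. trunc (\<xi> (fst q) \<omega>) * (trunc (\<xi> (fst (snd q)) \<omega>) * trunc (\<xi> (snd (snd q)) \<omega>)))"
text \<open>The total weight of the bumps, which up to the factor \<open>144\<close> is the relative oscillation
  error of the test function.\<close>

definition Rv :: "'a \<Rightarrow> real" where
  "Rv \<omega> = (\<Sum>i\<in>I. \<bar>\<xi> i \<omega>\<bar> * bump_weight r0 \<alpha> (e i \<omega>))"

lemma sum_pairs: "psum pairs g \<omega> = (\<Sum>i\<in>I. \<Sum>k\<in>A i. g (\<xi> i \<omega>) (\<xi> k \<omega>))"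
  unfolding psum_def pairs_def using finite_I finite_A
  by (subst sum.Sigma[of I A "\<lambda>i k. g (\<xi> i \<omega>) (\<xi> k \<omega>)"]) (auto simp: case_prod_unfold)

lemma R_eq: "R \<omega> = (\<Sum>i\<in>I. \<bar>\<xi> i \<omega>\<bar> * e i \<omega>)"
  by (simp add: sum_pairs e_def sum_distrib_left abs_mult)

lemma R3_eq: "R3 \<omega> = (\<Sum>i\<in>I. trunc (\<xi> i \<omega>) * (\<Sum>k\<in>A i. trunc (\<xi> k \<omega>))\<^sup>2)"
proof -
  have "R3 \<omega> = (\<Sum>i\<in>I. \<Sum>p\<in>A i \<times> A i. trunc (\<xi> i \<omega>) * (trunc (\<xi> (fst p) \<omega>) * trunc (\<xi> (snd p) \<omega>)))"
    unfolding R3_def triples_def using finite_I finite_A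
    by (subst sum.Sigma) (auto simp: case_prod_unfold)
  also have "\<dots> = (\<Sum>i\<in>I. trunc (\<xi> i \<omega>) * (\<Sum>k\<in>A i. trunc (\<xi> k \<omega>))\<^sup>2)"
  proof (rule sum.cong[OF refl])
    fix i
    have "(\<Sum>p\<in>A i \<times> A i. trunc (\<xi> (fst p) \<omega>) * trunc (\<xi> (snd p) \<omega>)) = (\<Sum>k\<in>A i. trunc (\<xi> k \<omega>))\<^sup>2"
      by (simp only: power2_eq_square sum_product sum.cartesian_product case_prod_unfold)
    then show "(\<Sum>p\<in>A i \<times> A i. trunc (\<xi> i \<omega>) * (trunc (\<xi> (fst p) \<omega>) * trunc (\<xi> (snd p) \<omega>)))
        = trunc (\<xi> i \<omega>) * (\<Sum>k\<in>A i. trunc (\<xi> k \<omega>))\<^sup>2"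
      by (simp add: sum_distrib_left[symmetric])
  qed
  finally show ?thesis .
qed

lemma Rv_le: "Rv \<omega> \<le> r0 * R \<omega> + 2 / \<alpha> * R3 \<omega> + 2 * R2 \<omega>"
proof -
  define t where "t i = trunc (\<xi> i \<omega>)" for i
  define s where "s i = rest (\<xi> i \<omega>)" for i
  have ts: "0 \<le> t i" "0 \<le> s i" "\<bar>\<xi> i \<omega>\<bar> = t i + s i" for i
    using trunc_rest_bounds[of "\<xi> i \<omega>"] by (auto simp: t_def s_def)
  have "\<bar>\<xi> i \<omega>\<bar> * bump_weight r0 \<alpha> (e i \<omega>) \<le> r0 * (\<bar>\<xi> i \<omega>\<bar> * e i \<omega>)
      + 2 / \<alpha> * (t i * (\<Sum>k\<in>A i. t k)\<^sup>2) + 2 * (\<Sum>k\<in>A i. t i * s k + s i * \<bar>\<xi> k \<omega>\<bar>)" for i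
  proof -
    have e: "e i \<omega> = (\<Sum>k\<in>A i. t k) + (\<Sum>k\<in>A i. s k)"
      unfolding e_def ts(3) by (rule sum.distrib)
    have "\<bar>\<xi> i \<omega>\<bar> * ((e i \<omega>)\<^sup>2 / (e i \<omega> + \<alpha>))
       \<le> 2 / \<alpha> * (t i * (\<Sum>k\<in>A i. t k)\<^sup>2) + 2 * (t i * (\<Sum>k\<in>A i. s k) + s i * e i \<omega>)"
      unfolding e ts(3) using ts const_bounds by (intro truncated_quotient_le sum_nonneg) auto
    also have "t i * (\<Sum>k\<in>A i. s k) + s i * e i \<omega> = (\<Sum>k\<in>A i. t i * s k + s i * \<bar>\<xi> k \<omega>\<bar>)"
      by (simp add: e_def sum.distrib sum_distrib_left)
    finally show ?thesis by (simp add: bump_weight_def distrib_left mult_ac)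
  qed
  then have "Rv \<omega> \<le> (\<Sum>i\<in>I. r0 * (\<bar>\<xi> i \<omega>\<bar> * e i \<omega>)
      + 2 / \<alpha> * (t i * (\<Sum>k\<in>A i. t k)\<^sup>2) + 2 * (\<Sum>k\<in>A i. t i * s k + s i * \<bar>\<xi> k \<omega>\<bar>))"
    unfolding Rv_def by (rule sum_mono)
  also have "\<dots> = r0 * R \<omega> + 2 / \<alpha> * R3 \<omega> + 2 * R2 \<omega>"
    by (simp add: R_eq R3_eq sum_pairs t_def s_def sum.distrib sum_distrib_left)
  finally show ?thesis .
qed

lemma R_L1: "Lp_le 1 R B"
proof -
  have "Lp_le 1 R (1 * B)"
  proof (rule psum_L1)
    show "Lp_le 1 (\<lambda>\<omega>. \<bar>\<xi> i \<omega> * \<xi> k \<omega>\<bar>) (1 * a\<^sup>2)" if "i \<in> I" "k \<in> I" for i k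
      unfolding mult_1 by (rule Lp_le_1_of_2, rule Lp_le_xi_pair) (use that in auto)
  qed auto
  then show ?thesis by simp
qed

lemma R_fluctuation: "Lp_le 2 (\<lambda>\<omega>. R \<omega> - expectation R) (2 * B * \<delta>)"
  by (rule psum_fluctuation) auto

lemma R2_summand_le: "\<bar>trunc x * rest y + rest x * \<bar>y\<bar>\<bar> \<le> \<bar>x * y\<bar>"
proof -
  note x = trunc_rest_bounds[of x] and y = trunc_rest_bounds[of y]
  have "trunc x * rest y + rest x * \<bar>y\<bar> \<le> trunc x * \<bar>y\<bar> + rest x * \<bar>y\<bar>"
    using x y by (intro add_mono mult_left_mono) auto
  also have "\<dots> = \<bar>x * y\<bar>" using x(6) by (simp add: distrib_right[symmetric] abs_mult)
  finally show ?thesis using x y by simp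
qed

lemma R2_fluctuation: "Lp_le 2 (\<lambda>\<omega>. R2 \<omega> - expectation R2) (2 * B * \<delta>)"
  by (rule psum_fluctuation[OF _ R2_summand_le]) measurable

lemma R2_L1: "Lp_le 1 R2 (1 / (2 * M0) * B)"
proof (rule psum_L1)
  fix i k assume ik: "i \<in> I" "k \<in> I"
  note [measurable] = xi_measurable[OF ik(1)] xi_measurable[OF ik(2)]
  let ?c = "1 / (4 * (a * M0))"
  have p: "0 < a * M0" using a_pos const_bounds by simp
  have 1: "Lp_le 1 (\<lambda>\<omega>. ?c * \<bar>\<xi> k \<omega> * \<xi> k \<omega> * \<xi> i \<omega>\<bar> + ?c * \<bar>\<xi> i \<omega> * \<xi> i \<omega> * \<xi> k \<omega>\<bar>)
      (\<bar>?c\<bar> * (a * a * a) + \<bar>?c\<bar> * (a * a * a))"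
    by (intro Lp_le_add Lp_le_cmult Lp_le_abs Lp_le_mult_L2 Lp_le_mult_L4 Lp_le_2_of_4 L4 ik)
  have "Lp_le 1 (\<lambda>\<omega>. trunc (\<xi> i \<omega>) * rest (\<xi> k \<omega>) + rest (\<xi> i \<omega>) * \<bar>\<xi> k \<omega>\<bar>)
      (\<bar>?c\<bar> * (a * a * a) + \<bar>?c\<bar> * (a * a * a))"
  proof (rule Lp_le_dominated[OF 1])
    fix \<omega>
    note x = trunc_rest_bounds[of "\<xi> i \<omega>"] and y = trunc_rest_bounds[of "\<xi> k \<omega>"]
    have "trunc (\<xi> i \<omega>) * rest (\<xi> k \<omega>) + rest (\<xi> i \<omega>) * \<bar>\<xi> k \<omega>\<bar>
      \<le> \<bar>\<xi> i \<omega>\<bar> * ((\<xi> k \<omega>)\<^sup>2 / (4 * (a * M0))) + ((\<xi> i \<omega>)\<^sup>2 / (4 * (a * M0))) * \<bar>\<xi> k \<omega>\<bar>"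
      using x y by (intro add_mono mult_mono) auto
    also have "\<dots> = ?c * \<bar>\<xi> k \<omega> * \<xi> k \<omega> * \<xi> i \<omega>\<bar> + ?c * \<bar>\<xi> i \<omega> * \<xi> i \<omega> * \<xi> k \<omega>\<bar>"
      by (simp add: abs_mult power2_eq_square)
    finally show "\<bar>trunc (\<xi> i \<omega>) * rest (\<xi> k \<omega>) + rest (\<xi> i \<omega>) * \<bar>\<xi> k \<omega>\<bar>\<bar> \<le>
        \<bar>?c * \<bar>\<xi> k \<omega> * \<xi> k \<omega> * \<xi> i \<omega>\<bar> + ?c * \<bar>\<xi> i \<omega> * \<xi> i \<omega> * \<xi> k \<omega>\<bar>\<bar>"
      using x y by simp
  qed measurable
  moreover have "\<bar>?c\<bar> * (a * a * a) + \<bar>?c\<bar> * (a * a * a) = 1 / (2 * M0) * a\<^sup>2"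
    using p by (simp add: power2_eq_square field_simps)
  ultimately show "Lp_le 1 (\<lambda>\<omega>. trunc (\<xi> i \<omega>) * rest (\<xi> k \<omega>) + rest (\<xi> i \<omega>) * \<bar>\<xi> k \<omega>\<bar>) (1 / (2 * M0) * a\<^sup>2)"
    by simp
qed (use const_bounds in auto)

lemma finite_triples: "finite triples"
  unfolding triples_def using finite_I finite_A by auto

lemma card_triples: "real (card triples) \<le> card I * D\<^sup>2"
proof -
  have "real (card triples) = (\<Sum>i\<in>I. real (card (A i)) * real (card (A i)))"
    unfolding triples_def using finite_I finite_A by (simp add: card_SigmaI card_cartesian_product)
  also have "\<dots> \<le> card I * (D * D)"
    using card_A D_pos by (intro sum_bounded_above mult_mono) auto
  finally show ?thesis by (simp add: power2_eq_square)
qed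

definition triple_supp :: "'i \<times> 'i \<times> 'i \<Rightarrow> 'i set" where
  "triple_supp q = {fst q, fst (snd q), snd (snd q)}"

lemma triple_supp_sub: "q \<in> triples \<Longrightarrow> triple_supp q \<subseteq> I"
  using A_mem by (auto simp: triples_def triple_supp_def)

text \<open>The middle of a triple is its first entry, so a point occurs as a middle or next to one of its neighbours.\<close>

lemma card_triples_at:
  assumes y: "y \<in> I"
  shows "real (card {q \<in> triples. y \<in> triple_supp q}) \<le> 3 * D\<^sup>2"
proof -
  let ?S = "Sigma (A y) A"
  let ?X = "{y} \<times> (A y \<times> A y)" and ?Y = "(\<lambda>(i, k). (i, y, k)) ` ?S" and ?Z = "(\<lambda>(i, k). (i, k, y)) ` ?S"
  have fin: "finite ?S" using finite_A[OF y] finite_A A_mem[OF y] by auto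
  have "real (card ?S) = (\<Sum>i\<in>A y. real (card (A i)))"
    using finite_A[OF y] finite_A A_mem[OF y] by (subst card_SigmaI) auto
  also have "\<dots> \<le> card (A y) * D" using card_A A_mem[OF y] by (intro sum_bounded_above) auto
  also have "\<dots> \<le> D * D" using card_A[OF y] D_pos by (intro mult_right_mono) auto
  finally have cS: "real (card ?S) \<le> D * D" .
  have cX: "real (card ?X) \<le> D * D"
    using card_A[OF y] D_pos by (simp add: card_cartesian_product mult_mono)
  have "{q \<in> triples. y \<in> triple_supp q} \<subseteq> ?X \<union> ?Y \<union> ?Z"
  proof
    fix q assume q: "q \<in> {q \<in> triples. y \<in> triple_supp q}"
    obtain i k k' where eq: "q = (i, k, k')" by (cases q)
    have m: "i \<in> I" "k \<in> A i" "k' \<in> A i" using q eq by (auto simp: triples_def)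
    then have "i \<in> A k" "i \<in> A k'" using A_sym by auto
    with q m show "q \<in> ?X \<union> ?Y \<union> ?Z" by (auto simp: eq triple_supp_def intro: rev_image_eqI)
  qed
  then have "card {q \<in> triples. y \<in> triple_supp q} \<le> card (?X \<union> ?Y \<union> ?Z)"
    using fin finite_A[OF y] by (intro card_mono) auto
  also have "\<dots> \<le> card ?X + card ?S + card ?S"
    using card_Un_le[of "?X \<union> ?Y" ?Z] card_Un_le[of ?X ?Y] card_image_le[OF fin, of "\<lambda>(i, k). (i, y, k)"]
      card_image_le[OF fin, of "\<lambda>(i, k). (i, k, y)"] by linarith
  finally have "real (card {q \<in> triples. y \<in> triple_supp q}) \<le> real (card ?X) + real (card ?S) + real (card ?S)"
    by linarith
  then show ?thesis using cS cX by (simp add: power2_eq_square)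
qed

lemma R3_L1: "Lp_le 1 R3 (B * \<delta>)"
proof -
  have s: "Lp_le 1 (\<lambda>\<omega>. trunc (\<xi> (fst q) \<omega>) * (trunc (\<xi> (fst (snd q)) \<omega>) * trunc (\<xi> (snd (snd q)) \<omega>))) (a * (a * a))"
    if q: "q \<in> triples" for q
  proof (rule Lp_le_dominated)
    have m: "fst q \<in> I" "fst (snd q) \<in> I" "snd (snd q) \<in> I"
      using triple_supp_sub[OF q] by (auto simp: triple_supp_def)
    show "Lp_le 1 (\<lambda>\<omega>. \<xi> (fst q) \<omega> * (\<xi> (fst (snd q)) \<omega> * \<xi> (snd (snd q)) \<omega>)) (a * (a * a))"
      by (intro Lp_le_mult_L2 Lp_le_mult_L4 Lp_le_2_of_4 L4 m)
    note [measurable] = xi_measurable[OF m(1)] xi_measurable[OF m(2)] xi_measurable[OF m(3)]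
    show "(\<lambda>\<omega>. trunc (\<xi> (fst q) \<omega>) * (trunc (\<xi> (fst (snd q)) \<omega>) * trunc (\<xi> (snd (snd q)) \<omega>))) \<in> borel_measurable M"
      by measurable
    show "\<bar>trunc (\<xi> (fst q) \<omega>) * (trunc (\<xi> (fst (snd q)) \<omega>) * trunc (\<xi> (snd (snd q)) \<omega>))\<bar>
      \<le> \<bar>\<xi> (fst q) \<omega> * (\<xi> (fst (snd q)) \<omega> * \<xi> (snd (snd q)) \<omega>)\<bar>" for \<omega>
      unfolding abs_mult using trunc_rest_bounds by (intro mult_mono) auto
  qed
  have "Lp_le 1 R3 (real (card triples) * (a * (a * a)))"
    unfolding R3_def[abs_def] by (intro Lp_le_sum_const s) auto
  moreover have "real (card triples) * (a * (a * a)) \<le> (card I * D\<^sup>2) * (a * (a * a))"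
    using a_pos by (intro mult_right_mono card_triples) auto
  ultimately show ?thesis using card_sum_bounds(2)
    by (auto simp: power2_eq_square mult_ac intro: Lp_le_bound_mono)
qed

lemma R3_fluctuation: "Lp_le 2 (\<lambda>\<omega>. R3 \<omega> - expectation R3) (3 * M0 ^ 3 * B * \<delta>\<^sup>2)"
proof -
  let ?h = "\<lambda>q \<omega>. trunc (\<xi> (fst q) \<omega>) * (trunc (\<xi> (fst (snd q)) \<omega>) * trunc (\<xi> (snd (snd q)) \<omega>))"
  let ?c = "a * M0 * (a * M0 * (a * M0))"
  have aM: "0 < a * M0" using a_pos const_bounds by simp
  have "Lp_le 2 (\<lambda>\<omega>. (\<Sum>q\<in>triples. ?h q \<omega>) - expectation (\<lambda>\<omega>. \<Sum>q\<in>triples. ?h q \<omega>)) (3 * M0 ^ 3 * B * \<delta>\<^sup>2)"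
  proof (rule centered_sum_L2[where c="?c" and N="9 * D ^ 3" and s=triple_supp])
    fix q assume q: "q \<in> triples"
    show sI: "triple_supp q \<subseteq> I" by (rule triple_supp_sub[OF q])
    have [measurable]: "\<xi> (fst q) \<in> borel_measurable (F (triple_supp q))"
      "\<xi> (fst (snd q)) \<in> borel_measurable (F (triple_supp q))" "\<xi> (snd (snd q)) \<in> borel_measurable (F (triple_supp q))"
      by (rule xi_measurable_F[OF _ sI]; simp add: triple_supp_def)+
    show m: "?h q \<in> borel_measurable (F (triple_supp q))" by measurable
    show "Lp_le 2 (?h q) ?c"
    proof (rule Lp_le_dominated[OF Lp_le_bound_mono[OF Lp_le_const[of 2 ?c]] measurable_F_imp[OF sI m]])
      show "\<bar>?h q \<omega>\<bar> \<le> \<bar>?c\<bar>" for \<omega>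
        unfolding abs_mult using trunc_rest_bounds aM a_pos const_bounds by (intro mult_mono) auto
    qed (use aM in auto)
    have "real (card {q' \<in> triples. \<exists>x\<in>triple_supp q. A x \<inter> triple_supp q' \<noteq> {}})
        \<le> real (card (\<Union>x\<in>triple_supp q. \<Union>y\<in>A x. {q' \<in> triples. y \<in> triple_supp q'}))"
    proof (intro of_nat_mono card_mono)
      show "finite (\<Union>x\<in>triple_supp q. \<Union>y\<in>A x. {q' \<in> triples. y \<in> triple_supp q'})"
        by (rule finite_subset[OF _ finite_triples]) auto
    qed auto
    also have "\<dots> \<le> 3 * (D * (3 * D\<^sup>2))"
    proof (rule card_UN_le_mult)
      show "real (card (triple_supp q)) \<le> 3" by (simp add: triple_supp_def card_insert_if)
      fix x assume "x \<in> triple_supp q"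
      then have x: "x \<in> I" using sI by blast
      show "real (card (\<Union>y\<in>A x. {q' \<in> triples. y \<in> triple_supp q'})) \<le> D * (3 * D\<^sup>2)"
        using x A_mem[OF x] by (intro card_UN_le_mult card_triples_at finite_A card_A) auto
    qed (use D_pos in \<open>auto simp: triple_supp_def\<close>)
    finally show "real (card {q' \<in> triples. \<exists>x\<in>triple_supp q. A x \<inter> triple_supp q' \<noteq> {}}) \<le> 9 * D ^ 3"
      by (simp add: power2_eq_square power3_eq_cube)
  next
    have "card triples * (9 * D ^ 3) * ?c\<^sup>2 \<le> (card I * D\<^sup>2) * (9 * D ^ 3) * ?c\<^sup>2"
      using D_pos by (intro mult_right_mono card_triples) auto
    also have "\<dots> = 9 * M0 ^ 6 * \<delta> ^ 4 * (card I * D * a\<^sup>2)"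
      by (simp add: power2_eq_square eval_nat_numeral)
    also have "\<dots> \<le> 9 * M0 ^ 6 * \<delta> ^ 4 * B\<^sup>2"
    proof (rule mult_left_mono)
      have "B * 1 \<le> B * B" using B_ge_1 by (intro mult_left_mono) auto
      then show "card I * D * a\<^sup>2 \<le> B\<^sup>2" using card_I by (simp add: power2_eq_square)
      show "0 \<le> 9 * M0 ^ 6 * \<delta> ^ 4" using const_bounds delta_pos by simp
    qed
    also have "\<dots> = (3 * M0 ^ 3 * B * \<delta>\<^sup>2)\<^sup>2" by (simp add: power2_eq_square eval_nat_numeral)
    finally show "card triples * (9 * D ^ 3) * ?c\<^sup>2 \<le> (3 * M0 ^ 3 * B * \<delta>\<^sup>2)\<^sup>2" .
    show "0 \<le> 3 * M0 ^ 3 * B * \<delta>\<^sup>2" using B_ge_1 const_bounds by simp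
  qed (rule finite_triples)
  then show ?thesis by (simp add: R3_def[abs_def])
qed

text \<open>A bound for the fluctuations of \<open>144 * Rv\<close> that has mean of order \<open>\<delta>\<close>.\<close>

definition fluct :: "'a \<Rightarrow> real" where
  "fluct \<omega> = 144 * (r0 * \<bar>R \<omega> - expectation R\<bar> + 2 / \<alpha> * \<bar>R3 \<omega> - expectation R3\<bar> + 2 * \<bar>R2 \<omega> - expectation R2\<bar>)"

definition c_fluct :: real where "c_fluct = 144 * (1 + 3 * M0 ^ 3 + 4 * B)"

lemma fluct_L1: "Lp_le 1 fluct (c_fluct * \<delta>)"
proof -
  have 1: "Lp_le 1 fluct (\<bar>144\<bar> * (\<bar>r0\<bar> * (2 * B * \<delta>) + \<bar>2 / \<alpha>\<bar> * (3 * M0 ^ 3 * B * \<delta>\<^sup>2) + \<bar>2\<bar> * (2 * B * \<delta>)))"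
    unfolding fluct_def[abs_def]
    by (intro Lp_le_cmult Lp_le_add Lp_le_abs Lp_le_1_of_2 R_fluctuation R2_fluctuation R3_fluctuation)
  show ?thesis
  proof (rule Lp_le_bound_mono[OF 1])
    have 1: "\<bar>r0\<bar> * (2 * B * \<delta>) = \<delta> / 500" using B_ge_1 by (simp add: r0_def)
    have 2: "\<bar>2 / \<alpha>\<bar> * (3 * M0 ^ 3 * B * \<delta>\<^sup>2) = (3 * M0 ^ 3) * \<delta> / 1000"
      using B_ge_1 a_pos D_pos by (simp add: \<alpha>_def power2_eq_square)
    have 3: "\<bar>2\<bar> * (2 * B * \<delta>) = 4 * B * \<delta>" by simp
    have "0 \<le> (3 * M0 ^ 3) * \<delta>" using const_bounds a_pos D_pos by (intro mult_nonneg_nonneg) auto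
    then have "\<bar>r0\<bar> * (2 * B * \<delta>) + \<bar>2 / \<alpha>\<bar> * (3 * M0 ^ 3 * B * \<delta>\<^sup>2) + \<bar>2\<bar> * (2 * B * \<delta>)
        \<le> \<delta> + (3 * M0 ^ 3) * \<delta> + 4 * B * \<delta>"
      unfolding 1 2 3 using delta_pos by linarith
    also have "\<dots> = (1 + 3 * M0 ^ 3 + 4 * B) * \<delta>" by (simp only: distrib_right mult_1)
    finally have *: "\<bar>r0\<bar> * (2 * B * \<delta>) + \<bar>2 / \<alpha>\<bar> * (3 * M0 ^ 3 * B * \<delta>\<^sup>2) + \<bar>2\<bar> * (2 * B * \<delta>)
        \<le> (1 + 3 * M0 ^ 3 + 4 * B) * \<delta>" .
    show "\<bar>144\<bar> * (\<bar>r0\<bar> * (2 * B * \<delta>) + \<bar>2 / \<alpha>\<bar> * (3 * M0 ^ 3 * B * \<delta>\<^sup>2) + \<bar>2\<bar> * (2 * B * \<delta>))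
        \<le> c_fluct * \<delta>"
      unfolding c_fluct_def mult.assoc[of 144]
      by (rule order_trans[OF _ mult_left_mono[OF *]]) auto
  qed
qed

text \<open>The constants in \<open>\<alpha>\<close>, \<open>r0\<close> and \<open>M0\<close> keep the mean of the bound in \<open>Rv_le\<close> at \<open>3/1000\<close>
  or less, so that \<open>144\<close> times this mean is below \<open>1/2\<close>.\<close>

lemma Rv_le_half_plus_fluct: "144 * Rv \<omega> \<le> 1/2 + fluct \<omega>"
proof -
  note e1 = abs_le_D1[OF Lp_le_1D(3)[OF R_L1]] abs_le_D1[OF Lp_le_1D(3)[OF R2_L1]] abs_le_D1[OF Lp_le_1D(3)[OF R3_L1]]
  have "r0 * expectation R \<le> r0 * B" "2 / \<alpha> * expectation R3 \<le> 2 / \<alpha> * (B * \<delta>)"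
    using e1 const_bounds by (intro mult_left_mono; simp)+
  moreover have "r0 * B = 1/1000" "2 / \<alpha> * (B * \<delta>) = 1/1000" "1 / (2 * M0) * B = 1/2000"
    using B_ge_1 a_pos D_pos by (auto simp: r0_def \<alpha>_def M0_def)
  ultimately have m: "r0 * expectation R + 2 / \<alpha> * expectation R3 + 2 * expectation R2 \<le> 3/1000"
    using e1(2) by linarith
  have "r0 * (R \<omega> - expectation R) \<le> r0 * \<bar>R \<omega> - expectation R\<bar>"
    "2 / \<alpha> * (R3 \<omega> - expectation R3) \<le> 2 / \<alpha> * \<bar>R3 \<omega> - expectation R3\<bar>"
    "2 * (R2 \<omega> - expectation R2) \<le> 2 * \<bar>R2 \<omega> - expectation R2\<bar>"
    using const_bounds by (intro mult_left_mono; simp)+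
  then have "r0 * R \<omega> + 2 / \<alpha> * R3 \<omega> + 2 * R2 \<omega> \<le> 3/1000 + fluct \<omega> / 144"
  proof -
    assume *: "r0 * (R \<omega> - expectation R) \<le> r0 * \<bar>R \<omega> - expectation R\<bar>"
      "2 / \<alpha> * (R3 \<omega> - expectation R3) \<le> 2 / \<alpha> * \<bar>R3 \<omega> - expectation R3\<bar>"
      "2 * (R2 \<omega> - expectation R2) \<le> 2 * \<bar>R2 \<omega> - expectation R2\<bar>"
    have "fluct \<omega> / 144 = r0 * \<bar>R \<omega> - expectation R\<bar> + 2 / \<alpha> * \<bar>R3 \<omega> - expectation R3\<bar> + 2 * \<bar>R2 \<omega> - expectation R2\<bar>"
      by (simp add: fluct_def)
    with * m show ?thesis unfolding right_diff_distrib by linarith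
  qed
  with Rv_le[of \<omega>] show ?thesis by linarith
qed

end


subsection \<open>The test function\<close>

text \<open>The function \<open>r \<mapsto> K / max K r\<close> falls off like \<open>1 / r\<close>, so its change multiplied by \<open>r\<close> is
  controlled uniformly.\<close>

lemma cutoff_diff_le:
  fixes K r r' :: real
  assumes "0 < K" "0 \<le> r" "0 \<le> r'"
  shows "\<bar>K / max K r - K / max K r'\<bar> * r \<le> \<bar>r - r'\<bar>"
proof -
  define m m' where "m = max K r" and "m' = max K r'"
  have m: "0 < m" "0 < m'" "r \<le> m" "K \<le> m'" using assms by (auto simp: m_def m'_def)
  have "K / m - K / m' = (K / m') * ((m' - m) / m)" using m by (simp add: field_simps)
  then have "\<bar>K / m - K / m'\<bar> * r = (K / m') * (r / m) * \<bar>m' - m\<bar>"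
    using m assms by (simp add: abs_mult abs_divide)
  also have "\<dots> \<le> 1 * 1 * \<bar>m' - m\<bar>" using m assms by (intro mult_right_mono mult_mono) auto
  also have "\<dots> \<le> \<bar>r - r'\<bar>" by (auto simp: m_def m'_def max_def)
  finally show ?thesis by (simp add: m_def m'_def)
qed

context studentized_dependence
begin

definition e_off :: "'i \<Rightarrow> 'i \<Rightarrow> 'a \<Rightarrow> real" where
  "e_off j i \<omega> = (\<Sum>k\<in>A i - A j. \<bar>\<xi> k \<omega>\<bar>)"

text \<open>The derivative of the sum is a sum of weighted bumps, which is at most \<open>2 * R\<close> but not bounded. The cut-off
  factor makes the Lipschitz constant deterministic. In \<open>test_fun_off\<close> every summand near \<open>j\<close> is removed, also from
  the widths of the bumps.\<close>

definition test_fun :: "real \<Rightarrow> 'a \<Rightarrow> real \<Rightarrow> real" where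
  "test_fun z \<omega> x = 2 * B / max (2 * B) (R \<omega>) * (\<Sum>i\<in>I. \<bar>\<xi> i \<omega>\<bar> * weighted_primitive r0 \<alpha> z (e i \<omega>) x)"

definition test_fun_off :: "real \<Rightarrow> 'i \<Rightarrow> 'a \<Rightarrow> real \<Rightarrow> real" where
  "test_fun_off z j \<omega> x = 2 * B / max (2 * B) (R_off j \<omega>) *
     (\<Sum>i\<in>I - A j. \<bar>\<xi> i \<omega>\<bar> * weighted_primitive r0 \<alpha> z (e_off j i \<omega>) x)"

definition bump_sum :: "real \<Rightarrow> 'a \<Rightarrow> real" where
  "bump_sum z \<omega> = (\<Sum>i\<in>I. \<bar>\<xi> i \<omega>\<bar> * (bump_weight r0 \<alpha> (e i \<omega>) * bump (e i \<omega> + \<alpha>) (T \<omega> - z)))"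

definition cut :: "'a \<Rightarrow> real" where "cut \<omega> = 2 * B / max (2 * B) (R \<omega>)"

lemma r0_bounds: "0 \<le> r0" "r0 \<le> 1" "0 < \<alpha>"
  using const_bounds by auto

lemma R_nonneg: "0 \<le> R \<omega>" "0 \<le> R_off j \<omega>"
  by (auto simp: psum_def intro: sum_nonneg)

lemma cutoff_bounds: "0 \<le> 2 * B / max (2 * B) r" "2 * B / max (2 * B) r \<le> 1"
  "0 \<le> r \<Longrightarrow> 2 * B / max (2 * B) r * r \<le> 2 * B"
proof -
  have "0 < max (2 * B) r" using B_ge_1 by simp
  then show "0 \<le> 2 * B / max (2 * B) r" "2 * B / max (2 * B) r \<le> 1"
    using B_ge_1 by auto
  show "2 * B / max (2 * B) r * r \<le> 2 * B" if "0 \<le> r"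
    using B_ge_1 that by (auto simp: divide_le_eq max_def mult_left_mono)
qed

lemma cut_bounds: "0 \<le> cut \<omega>" "cut \<omega> \<le> 1" "cut \<omega> * R \<omega> \<le> 2 * B"
  unfolding cut_def using cutoff_bounds R_nonneg by blast+

lemma e_measurable [measurable]: "i \<in> I \<Longrightarrow> e i \<in> borel_measurable M"
  using Lp_le_e Lp_leD(1) by blast

lemma R_measurable [measurable]: "R \<in> borel_measurable M"
  by (rule psum_measurable) auto

lemma test_fun_measurable:
  assumes [measurable]: "X \<in> borel_measurable M"
  shows "(\<lambda>\<omega>. test_fun z \<omega> (X \<omega>)) \<in> borel_measurable M"
  unfolding test_fun_def by measurable

lemma test_fun_off_measurable:
  assumes j: "j \<in> I"
  shows "(\<lambda>\<omega>. test_fun_off z j \<omega> (T_off j \<omega>)) \<in> borel_measurable (F (I - A j))"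
proof -
  have x: "\<xi> i \<in> borel_measurable (F (I - A j))" if "i \<in> I - A j" for i
    by (rule xi_measurable_F[OF that]) auto
  have eo: "e_off j i \<in> borel_measurable (F (I - A j))" if "i \<in> I - A j" for i
    unfolding e_off_def[abs_def] using that A_mem by (intro borel_measurable_sum borel_measurable_abs x) auto
  have [measurable]: "R_off j \<in> borel_measurable (F (I - A j))"
    by (rule psum_off_measurable_F[OF j]) auto
  have "(\<lambda>\<omega>. \<Sum>i\<in>I - A j. \<bar>\<xi> i \<omega>\<bar> * weighted_primitive r0 \<alpha> z (e_off j i \<omega>) (T_off j \<omega>))
      \<in> borel_measurable (F (I - A j))"
    by (intro borel_measurable_sum borel_measurable_times borel_measurable_abs x
        weighted_primitive_measurable eo T_off_measurable_F(1)[OF j])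
  then show ?thesis unfolding test_fun_off_def by measurable
qed

lemma test_fun_Lipschitz: "\<bar>test_fun z \<omega> x - test_fun z \<omega> y\<bar> \<le> 4 * B * \<bar>x - y\<bar>"
proof -
  let ?w = "\<lambda>i. weighted_primitive r0 \<alpha> z (e i \<omega>)"
  have "\<bar>\<Sum>i\<in>I. \<bar>\<xi> i \<omega>\<bar> * (?w i x - ?w i y)\<bar> \<le> (\<Sum>i\<in>I. \<bar>\<xi> i \<omega>\<bar> * (2 * e i \<omega> * \<bar>x - y\<bar>))"
  proof (rule order_trans[OF sum_abs sum_mono])
    show "\<bar>\<bar>\<xi> i \<omega>\<bar> * (?w i x - ?w i y)\<bar> \<le> \<bar>\<xi> i \<omega>\<bar> * (2 * e i \<omega> * \<bar>x - y\<bar>)" for i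
      unfolding abs_mult abs_abs
      by (intro mult_left_mono weighted_primitive_Lipschitz r0_bounds e_nonneg) auto
  qed
  also have "\<dots> = R \<omega> * (2 * \<bar>x - y\<bar>)" by (simp add: R_eq sum_distrib_left sum_distrib_right mult_ac)
  finally have 1: "\<bar>\<Sum>i\<in>I. \<bar>\<xi> i \<omega>\<bar> * (?w i x - ?w i y)\<bar> \<le> R \<omega> * (2 * \<bar>x - y\<bar>)" .
  have "test_fun z \<omega> x - test_fun z \<omega> y = cut \<omega> * (\<Sum>i\<in>I. \<bar>\<xi> i \<omega>\<bar> * (?w i x - ?w i y))"
    by (simp add: test_fun_def cut_def right_diff_distrib sum_subtractf)
  then have "\<bar>test_fun z \<omega> x - test_fun z \<omega> y\<bar> \<le> cut \<omega> * (R \<omega> * (2 * \<bar>x - y\<bar>))"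
    using mult_left_mono[OF 1 cut_bounds(1)[of \<omega>]] by (simp only: abs_mult abs_of_nonneg[OF cut_bounds(1)])
  also have "\<dots> = (cut \<omega> * R \<omega>) * (2 * \<bar>x - y\<bar>)" by simp
  also have "\<dots> \<le> (2 * B) * (2 * \<bar>x - y\<bar>)"
    using cut_bounds(3) by (intro mult_right_mono) auto
  finally show ?thesis by simp
qed

lemma R_minus_R_off:
  assumes j: "j \<in> I"
  shows "R \<omega> - R_off j \<omega> = (\<Sum>i\<in>A j. \<bar>\<xi> i \<omega>\<bar> * e i \<omega>) + (\<Sum>i\<in>I - A j. \<bar>\<xi> i \<omega>\<bar> * (e i \<omega> - e_off j i \<omega>))"
proof -
  have "pairs_off j = Sigma (I - A j) (\<lambda>i. A i - A j)" by (auto simp: pairs_off_def pairs_def)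
  then have "R_off j \<omega> = (\<Sum>i\<in>I - A j. \<Sum>k\<in>A i - A j. \<bar>\<xi> i \<omega> * \<xi> k \<omega>\<bar>)"
    unfolding psum_def using finite_I finite_A
    by (subst sum.Sigma) (auto simp: case_prod_unfold)
  then have "R_off j \<omega> = (\<Sum>i\<in>I - A j. \<bar>\<xi> i \<omega>\<bar> * e_off j i \<omega>)"
    by (simp add: e_off_def sum_distrib_left abs_mult)
  moreover have "R \<omega> = (\<Sum>i\<in>A j. \<bar>\<xi> i \<omega>\<bar> * e i \<omega>) + (\<Sum>i\<in>I - A j. \<bar>\<xi> i \<omega>\<bar> * e i \<omega>)"
    unfolding R_eq using sum.subset_diff[OF A_sub[OF j] finite_I, of "\<lambda>i. \<bar>\<xi> i \<omega>\<bar> * e i \<omega>"] by simp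
  ultimately show ?thesis by (simp add: right_diff_distrib sum_subtractf)
qed

lemma e_off_bounds: "i \<in> I \<Longrightarrow> 0 \<le> e_off j i \<omega>" "i \<in> I \<Longrightarrow> e_off j i \<omega> \<le> e i \<omega>"
  unfolding e_off_def e_def by (auto intro: sum_nonneg sum_mono2 finite_A)

text \<open>The two functions vanish at the origin, and their derivatives differ by at most \<open>8 * (R - R_off j)\<close>: a quarter
  of this comes from the cut-off and the rest from the bumps.\<close>

lemma test_fun_close:
  assumes j: "j \<in> I"
  shows "\<bar>test_fun z \<omega> x - test_fun_off z j \<omega> x\<bar> \<le> \<bar>x\<bar> * (8 * (R \<omega> - R_off j \<omega>))"
proof -
  let ?w = "\<lambda>i. weighted_primitive r0 \<alpha> z (e i \<omega>) x" and ?w' = "\<lambda>i. weighted_primitive r0 \<alpha> z (e_off j i \<omega>) x"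
  let ?k = "2 * B / max (2 * B) (R \<omega>)" and ?k' = "2 * B / max (2 * B) (R_off j \<omega>)"
  let ?d = "R \<omega> - R_off j \<omega>"
  have wb: "\<bar>?w i\<bar> \<le> 2 * e i \<omega> * \<bar>x\<bar>" for i
    using weighted_primitive_Lipschitz[OF r0_bounds e_nonneg, of z i \<omega> x 0] by (simp add: weighted_primitive_0)
  have s1: "0 \<le> (\<Sum>i\<in>A j. \<bar>\<xi> i \<omega>\<bar> * e i \<omega>)" by (intro sum_nonneg mult_nonneg_nonneg e_nonneg) auto
  have s2: "0 \<le> (\<Sum>i\<in>I - A j. \<bar>\<xi> i \<omega>\<bar> * (e i \<omega> - e_off j i \<omega>))"
    using e_off_bounds by (intro sum_nonneg mult_nonneg_nonneg) auto
  have d0: "0 \<le> ?d" using s1 s2 R_minus_R_off[OF j, of \<omega>] by simp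
  have "(\<Sum>i\<in>I. \<bar>\<xi> i \<omega>\<bar> * ?w i) = (\<Sum>i\<in>A j. \<bar>\<xi> i \<omega>\<bar> * ?w i) + (\<Sum>i\<in>I - A j. \<bar>\<xi> i \<omega>\<bar> * ?w i)"
    using sum.subset_diff[OF A_sub[OF j] finite_I, of "\<lambda>i. \<bar>\<xi> i \<omega>\<bar> * ?w i"] by simp
  then have eq: "test_fun z \<omega> x - test_fun_off z j \<omega> x = (?k - ?k') * (\<Sum>i\<in>I. \<bar>\<xi> i \<omega>\<bar> * ?w i)
      + ?k' * ((\<Sum>i\<in>A j. \<bar>\<xi> i \<omega>\<bar> * ?w i) + (\<Sum>i\<in>I - A j. \<bar>\<xi> i \<omega>\<bar> * (?w i - ?w' i)))"
    unfolding test_fun_def test_fun_off_def by (simp add: right_diff_distrib sum_subtractf left_diff_distrib distrib_left)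
  have b1: "\<bar>(?k - ?k') * (\<Sum>i\<in>I. \<bar>\<xi> i \<omega>\<bar> * ?w i)\<bar> \<le> 2 * ?d * \<bar>x\<bar>"
  proof -
    have "\<bar>\<Sum>i\<in>I. \<bar>\<xi> i \<omega>\<bar> * ?w i\<bar> \<le> (\<Sum>i\<in>I. \<bar>\<xi> i \<omega>\<bar> * (2 * e i \<omega> * \<bar>x\<bar>))"
      by (rule order_trans[OF sum_abs sum_mono]) (auto simp: abs_mult intro!: mult_left_mono wb)
    also have "\<dots> = R \<omega> * (2 * \<bar>x\<bar>)" by (simp add: R_eq sum_distrib_left sum_distrib_right mult_ac)
    finally have "\<bar>?k - ?k'\<bar> * \<bar>\<Sum>i\<in>I. \<bar>\<xi> i \<omega>\<bar> * ?w i\<bar> \<le> \<bar>?k - ?k'\<bar> * (R \<omega> * (2 * \<bar>x\<bar>))"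
      by (intro mult_left_mono) auto
    also have "\<dots> = (\<bar>?k - ?k'\<bar> * R \<omega>) * (2 * \<bar>x\<bar>)" by simp
    also have "\<dots> \<le> \<bar>?d\<bar> * (2 * \<bar>x\<bar>)"
      using B_ge_1 by (intro mult_right_mono cutoff_diff_le R_nonneg) auto
    finally show ?thesis using d0 by (simp add: abs_mult mult_ac)
  qed
  have b2: "\<bar>(\<Sum>i\<in>A j. \<bar>\<xi> i \<omega>\<bar> * ?w i) + (\<Sum>i\<in>I - A j. \<bar>\<xi> i \<omega>\<bar> * (?w i - ?w' i))\<bar> \<le> 6 * ?d * \<bar>x\<bar>"
  proof -
    have "\<bar>\<Sum>i\<in>A j. \<bar>\<xi> i \<omega>\<bar> * ?w i\<bar> \<le> (\<Sum>i\<in>A j. \<bar>\<xi> i \<omega>\<bar> * (6 * e i \<omega> * \<bar>x\<bar>))"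
    proof (rule order_trans[OF sum_abs sum_mono])
      fix i
      have "2 * e i \<omega> * \<bar>x\<bar> \<le> 6 * e i \<omega> * \<bar>x\<bar>" using e_nonneg by (intro mult_right_mono) auto
      then show "\<bar>\<bar>\<xi> i \<omega>\<bar> * ?w i\<bar> \<le> \<bar>\<xi> i \<omega>\<bar> * (6 * e i \<omega> * \<bar>x\<bar>)"
        unfolding abs_mult abs_abs using wb[of i] by (intro mult_left_mono) auto
    qed
    moreover have "\<bar>\<Sum>i\<in>I - A j. \<bar>\<xi> i \<omega>\<bar> * (?w i - ?w' i)\<bar>
        \<le> (\<Sum>i\<in>I - A j. \<bar>\<xi> i \<omega>\<bar> * (6 * (e i \<omega> - e_off j i \<omega>) * \<bar>x\<bar>))"
    proof (rule order_trans[OF sum_abs sum_mono])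
      fix i assume i: "i \<in> I - A j"
      have "\<bar>?w i - ?w' i\<bar> \<le> 6 * \<bar>e i \<omega> - e_off j i \<omega>\<bar> * \<bar>x\<bar>"
        using i by (intro weighted_primitive_diff r0_bounds e_nonneg e_off_bounds) auto
      then show "\<bar>\<bar>\<xi> i \<omega>\<bar> * (?w i - ?w' i)\<bar> \<le> \<bar>\<xi> i \<omega>\<bar> * (6 * (e i \<omega> - e_off j i \<omega>) * \<bar>x\<bar>)"
        unfolding abs_mult abs_abs using i e_off_bounds[of i j \<omega>] by (intro mult_left_mono) auto
    qed
    moreover have "(\<Sum>i\<in>A j. \<bar>\<xi> i \<omega>\<bar> * (6 * e i \<omega> * \<bar>x\<bar>))
        + (\<Sum>i\<in>I - A j. \<bar>\<xi> i \<omega>\<bar> * (6 * (e i \<omega> - e_off j i \<omega>) * \<bar>x\<bar>)) = 6 * ?d * \<bar>x\<bar>"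
      unfolding R_minus_R_off[OF j] by (simp add: sum_distrib_left sum_distrib_right distrib_left distrib_right mult_ac)
    ultimately show ?thesis by linarith
  qed
  have "\<bar>?k' * ((\<Sum>i\<in>A j. \<bar>\<xi> i \<omega>\<bar> * ?w i) + (\<Sum>i\<in>I - A j. \<bar>\<xi> i \<omega>\<bar> * (?w i - ?w' i)))\<bar> \<le> 1 * (6 * ?d * \<bar>x\<bar>)"
    unfolding abs_mult[of ?k'] using cutoff_bounds[of "R_off j \<omega>"] b2 by (intro mult_mono) auto
  then have "\<bar>test_fun z \<omega> x - test_fun_off z j \<omega> x\<bar> \<le> 2 * ?d * \<bar>x\<bar> + 1 * (6 * ?d * \<bar>x\<bar>)"
    unfolding eq using b1 by (intro order_trans[OF abs_triangle_ineq] add_mono)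
  also have "\<dots> = \<bar>x\<bar> * (8 * ?d)" by (simp add: algebra_simps)
  finally show ?thesis .
qed

text \<open>The derivative of the test function at \<open>T\<close> is \<open>cut * bump_sum\<close>. Its oscillation over the shifts
  is a multiple of itself, with the factor \<open>144 * Rv\<close> that is typically below \<open>1/2\<close>.\<close>

lemma test_fun_increments:
  "(\<Sum>j\<in>I. \<xi> j \<omega> * \<rho> \<omega> * (test_fun z \<omega> (T \<omega>) - test_fun z \<omega> (T \<omega> - shift j \<omega>)))
    \<ge> (\<rho> \<omega>)\<^sup>2 * S \<omega> * (cut \<omega> * bump_sum z \<omega>) - 144 * Rv \<omega> * (cut \<omega> * bump_sum z \<omega>)"
proof -
  define b where "b i = bump (e i \<omega> + \<alpha>) (T \<omega> - z)" for i
  define g where "g i = bump_weight r0 \<alpha> (e i \<omega>)" for i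
  define q where "q i = (e i \<omega>)\<^sup>2 / (e i \<omega> + \<alpha>)" for i
  define x where "x i = \<bar>\<xi> i \<omega>\<bar>" for i
  let ?w = "\<lambda>i. weighted_primitive r0 \<alpha> z (e i \<omega>)"
  let ?k = "cut \<omega>" and ?P = "bump_sum z \<omega>"
  have nn: "0 \<le> b i" "0 \<le> g i" "0 \<le> q i" "q i \<le> g i" "0 \<le> x i" for i
    using bump_bounds bump_weight_bounds[OF r0_bounds e_nonneg] e_nonneg r0_bounds(3)
    by (auto simp: b_def g_def q_def x_def intro!: divide_nonneg_pos add_nonneg_pos)
  have k0: "0 \<le> ?k" by (rule cut_bounds)
  have P: "?P = (\<Sum>i\<in>I. x i * (g i * b i))" by (simp add: bump_sum_def x_def g_def b_def)
  have Rv: "Rv \<omega> = (\<Sum>i\<in>I. x i * g i)" by (simp add: Rv_def x_def g_def)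
  have P0: "0 \<le> ?P" unfolding P using nn by (intro sum_nonneg mult_nonneg_nonneg)
  have step: "\<bar>\<xi> j \<omega> * \<rho> \<omega> * (test_fun z \<omega> (T \<omega>) - test_fun z \<omega> (T \<omega> - shift j \<omega>)) - \<xi> j \<omega> * \<rho> \<omega> * shift j \<omega> * (?k * ?P)\<bar>
      \<le> ?k * (72 * (x j * q j * (\<Sum>i\<in>I. x i * (g i * (b i + b j)))))" for j
  proof -
    have "test_fun z \<omega> (T \<omega>) - test_fun z \<omega> (T \<omega> - shift j \<omega>) - shift j \<omega> * (?k * ?P)
       = ?k * (\<Sum>i\<in>I. x i * (?w i (T \<omega>) - ?w i (T \<omega> - shift j \<omega>) - shift j \<omega> * (g i * b i)))"
      unfolding test_fun_def P x_def cut_def[symmetric]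
      by (simp add: right_diff_distrib sum_subtractf sum_distrib_left mult_ac)
    moreover have "\<bar>\<Sum>i\<in>I. x i * (?w i (T \<omega>) - ?w i (T \<omega> - shift j \<omega>) - shift j \<omega> * (g i * b i))\<bar>
      \<le> (\<Sum>i\<in>I. x i * (36 * q j * (g i * (b i + b j))))"
    proof (rule order_trans[OF sum_abs sum_mono])
      fix i
      have "\<bar>?w i (T \<omega>) - ?w i (T \<omega> - shift j \<omega>) - shift j \<omega> * (g i * b i)\<bar> \<le> 36 * q j * (g i * (b i + b j))"
        unfolding g_def b_def q_def
        by (intro weighted_primitive_expansion r0_bounds e_nonneg abs_shift_le)
      then show "\<bar>x i * (?w i (T \<omega>) - ?w i (T \<omega> - shift j \<omega>) - shift j \<omega> * (g i * b i))\<bar> \<le> x i * (36 * q j * (g i * (b i + b j)))"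
        using nn(5)[of i] by (simp add: abs_mult mult_left_mono)
    qed
    ultimately have 1: "\<bar>test_fun z \<omega> (T \<omega>) - test_fun z \<omega> (T \<omega> - shift j \<omega>) - shift j \<omega> * (?k * ?P)\<bar>
      \<le> ?k * (\<Sum>i\<in>I. x i * (36 * q j * (g i * (b i + b j))))"
      using k0 by (simp add: abs_mult mult_left_mono)
    have eq: "\<xi> j \<omega> * \<rho> \<omega> * (test_fun z \<omega> (T \<omega>) - test_fun z \<omega> (T \<omega> - shift j \<omega>)) - \<xi> j \<omega> * \<rho> \<omega> * shift j \<omega> * (?k * ?P)
      = (\<xi> j \<omega> * \<rho> \<omega>) * (test_fun z \<omega> (T \<omega>) - test_fun z \<omega> (T \<omega> - shift j \<omega>) - shift j \<omega> * (?k * ?P))"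
      by (simp add: algebra_simps)
    have "\<bar>(\<xi> j \<omega> * \<rho> \<omega>) * (test_fun z \<omega> (T \<omega>) - test_fun z \<omega> (T \<omega> - shift j \<omega>) - shift j \<omega> * (?k * ?P))\<bar>
      \<le> (x j * 2) * (?k * (\<Sum>i\<in>I. x i * (36 * q j * (g i * (b i + b j)))))"
      unfolding abs_mult[of "\<xi> j \<omega> * \<rho> \<omega>"] using 1 rho_bounds[of \<omega>] nn(5)[of j]
      by (intro mult_mono) (auto simp: abs_mult x_def intro: mult_left_mono)
    also have "\<dots> = ?k * (72 * (x j * q j * (\<Sum>i\<in>I. x i * (g i * (b i + b j)))))"
    proof -
      have "(\<Sum>i\<in>I. x i * (36 * q j * y i)) = 36 * q j * (\<Sum>i\<in>I. x i * y i)" for y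
        by (simp add: sum_distrib_left mult_ac)
      from this[of "\<lambda>i. g i * (b i + b j)"] show ?thesis by simp
    qed
    finally show ?thesis unfolding eq .
  qed
  have "(\<Sum>j\<in>I. x j * q j * (\<Sum>i\<in>I. x i * (g i * (b i + b j)))) \<le> 2 * (Rv \<omega> * ?P)"
  proof -
    have "(\<Sum>j\<in>I. x j * q j * (\<Sum>i\<in>I. x i * (g i * (b i + b j))))
        = (\<Sum>j\<in>I. x j * q j) * ?P + (\<Sum>j\<in>I. x j * (q j * b j)) * Rv \<omega>"
      unfolding P Rv sum_distrib_right sum.distrib[symmetric]
      by (intro sum.cong refl) (simp add: distrib_left sum.distrib sum_distrib_left mult_ac)
    also have "\<dots> \<le> Rv \<omega> * ?P + ?P * Rv \<omega>"
    proof (intro add_mono mult_right_mono P0)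
      show "(\<Sum>j\<in>I. x j * q j) \<le> Rv \<omega>" unfolding Rv using nn by (intro sum_mono mult_left_mono) auto
      show "(\<Sum>j\<in>I. x j * (q j * b j)) \<le> ?P" unfolding P
        using nn by (intro sum_mono mult_left_mono mult_right_mono) auto
      show "0 \<le> Rv \<omega>" unfolding Rv using nn by (intro sum_nonneg mult_nonneg_nonneg)
    qed
    finally show ?thesis by simp
  qed
  then have "?k * (72 * (\<Sum>j\<in>I. x j * q j * (\<Sum>i\<in>I. x i * (g i * (b i + b j))))) \<le> ?k * (72 * (2 * (Rv \<omega> * ?P)))"
    using k0 by (intro mult_left_mono) auto
  moreover have "\<bar>\<Sum>j\<in>I. \<xi> j \<omega> * \<rho> \<omega> * (test_fun z \<omega> (T \<omega>) - test_fun z \<omega> (T \<omega> - shift j \<omega>)) - \<xi> j \<omega> * \<rho> \<omega> * shift j \<omega> * (?k * ?P)\<bar>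
     \<le> (\<Sum>j\<in>I. ?k * (72 * (x j * q j * (\<Sum>i\<in>I. x i * (g i * (b i + b j))))))"
    by (rule order_trans[OF sum_abs sum_mono]) (rule step)
  moreover have "(\<Sum>j\<in>I. ?k * (72 * (x j * q j * (\<Sum>i\<in>I. x i * (g i * (b i + b j))))))
      = ?k * (72 * (\<Sum>j\<in>I. x j * q j * (\<Sum>i\<in>I. x i * (g i * (b i + b j)))))"
    by (simp only: sum_distrib_left)
  moreover have "(\<Sum>j\<in>I. \<xi> j \<omega> * \<rho> \<omega> * (test_fun z \<omega> (T \<omega>) - test_fun z \<omega> (T \<omega> - shift j \<omega>)) - \<xi> j \<omega> * \<rho> \<omega> * shift j \<omega> * (?k * ?P))
     = (\<Sum>j\<in>I. \<xi> j \<omega> * \<rho> \<omega> * (test_fun z \<omega> (T \<omega>) - test_fun z \<omega> (T \<omega> - shift j \<omega>))) - (\<rho> \<omega>)\<^sup>2 * S \<omega> * (?k * ?P)"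
    unfolding sum_subtractf sum_distrib_right[symmetric] sum_xi_rho_shift ..
  ultimately show ?thesis by (simp add: mult_ac)
qed

subsection \<open>Concentration and the distance to the normal law\<close>

definition c_bump :: real where
  "c_bump = 2 * (16 * (nW * B * (1 + 2000 * B)) + B * nW * (20 * (4 * B) * c + 4 * 16) + 4 * B * (8 * c + c_fluct)) + 16 * B\<^sup>2"

lemma bump_sum_measurable [measurable]: "bump_sum z \<in> borel_measurable M"
  unfolding bump_sum_def[abs_def] by measurable

lemma cut_measurable [measurable]: "cut \<in> borel_measurable M"
  unfolding cut_def[abs_def] by measurable

lemma bump_sum_bounds: "0 \<le> bump_sum z \<omega>" "bump_sum z \<omega> \<le> 2 * R \<omega>"
proof -
  note w = bump_weight_bounds[OF r0_bounds e_nonneg]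
  show "0 \<le> bump_sum z \<omega>" unfolding bump_sum_def
    using w bump_bounds by (intro sum_nonneg mult_nonneg_nonneg) auto
  have "bump_sum z \<omega> \<le> (\<Sum>i\<in>I. \<bar>\<xi> i \<omega>\<bar> * ((2 * e i \<omega>) * 1))"
    unfolding bump_sum_def using w bump_bounds e_nonneg by (intro sum_mono mult_left_mono mult_mono) auto
  then show "bump_sum z \<omega> \<le> 2 * R \<omega>" by (simp add: R_eq sum_distrib_left mult_ac)
qed

lemma expectation_T_test_fun_le:
  "\<bar>expectation (\<lambda>\<omega>. T \<omega> * test_fun z \<omega> (T \<omega>))\<bar> \<le> 16 * (nW * B * (1 + 2000 * B)) * \<delta>"
proof -
  let ?Y = "\<lambda>\<omega>. \<Sum>i\<in>I. 16 * \<bar>W \<omega> * \<xi> i \<omega> * (e i \<omega> * e i \<omega>)\<bar> + (16 * \<alpha>) * \<bar>W \<omega> * \<xi> i \<omega> * e i \<omega>\<bar>"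
  have 1: "Lp_le 1 ?Y (real (card I) * (\<bar>16\<bar> * (nW * a * (\<delta> * \<delta>)) + \<bar>16 * \<alpha>\<bar> * (nW * a * \<delta>)))"
    by (intro Lp_le_sum_const Lp_le_add Lp_le_cmult Lp_le_abs Lp_le_mult_L2 Lp_le_mult_L4 Lp_le_2_of_4 W_L4 L4 Lp_le_e) auto
  have "Lp_le 1 (\<lambda>\<omega>. T \<omega> * test_fun z \<omega> (T \<omega>))
      (real (card I) * (\<bar>16\<bar> * (nW * a * (\<delta> * \<delta>)) + \<bar>16 * \<alpha>\<bar> * (nW * a * \<delta>)))"
  proof (rule Lp_le_dominated[OF 1])
    show "(\<lambda>\<omega>. T \<omega> * test_fun z \<omega> (T \<omega>)) \<in> borel_measurable M"
      using test_fun_measurable[OF T_measurable] by measurable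
    fix \<omega>
    have "\<bar>\<Sum>i\<in>I. \<bar>\<xi> i \<omega>\<bar> * weighted_primitive r0 \<alpha> z (e i \<omega>) (T \<omega>)\<bar>
      \<le> (\<Sum>i\<in>I. \<bar>\<xi> i \<omega>\<bar> * (8 * (e i \<omega> * e i \<omega> + \<alpha> * e i \<omega>)))"
    proof (rule order_trans[OF sum_abs sum_mono])
      show "\<bar>\<bar>\<xi> i \<omega>\<bar> * weighted_primitive r0 \<alpha> z (e i \<omega>) (T \<omega>)\<bar> \<le> \<bar>\<xi> i \<omega>\<bar> * (8 * (e i \<omega> * e i \<omega> + \<alpha> * e i \<omega>))" for i
        unfolding abs_mult abs_abs by (intro mult_left_mono abs_weighted_primitive_le r0_bounds e_nonneg abs_ge_zero)
    qed
    then have "\<bar>test_fun z \<omega> (T \<omega>)\<bar> \<le> 1 * (\<Sum>i\<in>I. \<bar>\<xi> i \<omega>\<bar> * (8 * (e i \<omega> * e i \<omega> + \<alpha> * e i \<omega>)))"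
      unfolding test_fun_def abs_mult[of "2 * B / max (2 * B) (R \<omega>)"]
      using cutoff_bounds[of "R \<omega>"] by (intro mult_mono) auto
    then have "\<bar>T \<omega> * test_fun z \<omega> (T \<omega>)\<bar> \<le> (2 * \<bar>W \<omega>\<bar>) * (\<Sum>i\<in>I. \<bar>\<xi> i \<omega>\<bar> * (8 * (e i \<omega> * e i \<omega> + \<alpha> * e i \<omega>)))"
      unfolding abs_mult[of "T \<omega>"] using abs_T_le[of \<omega>] by (intro mult_mono) auto
    also have "\<dots> = ?Y \<omega>"
      unfolding sum_distrib_left using e_nonneg by (intro sum.cong refl) (simp add: abs_mult algebra_simps)
    finally show "\<bar>T \<omega> * test_fun z \<omega> (T \<omega>)\<bar> \<le> \<bar>?Y \<omega>\<bar>" by linarith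
  qed
  from Lp_le_1D(3)[OF this]
  have "\<bar>expectation (\<lambda>\<omega>. T \<omega> * test_fun z \<omega> (T \<omega>))\<bar>
      \<le> 16 * nW * (card I * (a * \<delta>\<^sup>2)) + 16 * nW * \<alpha> * (card I * (a * \<delta>))"
    using r0_bounds by (simp add: power2_eq_square algebra_simps)
  also have "\<dots> \<le> 16 * nW * (B * \<delta>) + 16 * nW * \<alpha> * B"
    using nW_ge_1 r0_bounds by (intro add_mono mult_left_mono card_sum_bounds) auto
  also have "\<dots> = 16 * (nW * B * (1 + 2000 * B)) * \<delta>" by (simp add: \<alpha>_def algebra_simps)
  finally show ?thesis .
qed

text \<open>With at least half of \<open>cut * bump_sum\<close> left after absorbing the oscillation, its mean is bounded by the mean
  of \<open>T * test_fun T\<close>. That is of order \<open>\<delta>\<close>, because the primitive of a bump is at most four times its width.\<close>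

lemma bump_sum_L1: "Lp_le 1 (bump_sum z) (c_bump * \<delta>)"
proof -
  let ?inc = "\<lambda>\<omega>. \<Sum>j\<in>I. \<xi> j \<omega> * \<rho> \<omega> * (test_fun z \<omega> (T \<omega>) - test_fun z \<omega> (T \<omega> - shift j \<omega>))"
  let ?Q = "\<lambda>\<omega>. cut \<omega> * bump_sum z \<omega>"
  have B0: "0 \<le> B" using B_ge_1 by simp
  have m2: "(\<lambda>\<omega>. test_fun z \<omega> (T \<omega> - shift j \<omega>)) \<in> borel_measurable M" if "j \<in> I" for j
  proof -
    have "shift j \<in> borel_measurable M"
      unfolding shift_def[abs_def] using Lp_leD(1)[OF Lp_le_eta[OF that]] by measurable
    then show ?thesis by (intro test_fun_measurable) measurable
  qed
  have Eoff: "Lp_le 2 (\<lambda>\<omega>. 8 * (R \<omega> - R_off j \<omega>)) (16 * \<delta>\<^sup>2)" if "j \<in> I" for j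
    using Lp_le_cmult[OF psum_minus_off[OF that, of "\<lambda>x y. \<bar>x * y\<bar>"], of 8] by simp
  note stein = stein_leave_one_out[where H="test_fun z" and H_off="test_fun_off z" and K="4 * B" and q=16
      and E="\<lambda>j \<omega>. 8 * (R \<omega> - R_off j \<omega>)", OF _ test_fun_Lipschitz _ test_fun_measurable[OF T_measurable] m2
      test_fun_off_measurable test_fun_close Eoff]
  have side: "\<bar>test_fun z \<omega> 0\<bar> \<le> 4 * B" for \<omega>
    using B0 by (simp add: test_fun_def weighted_primitive_0)
  have inc_int: "integrable M ?inc"
    using stein(2) B0 side by (intro Bochner_Integration.integrable_sum) auto
  have inc_le: "expectation ?inc \<le> (16 * (nW * B * (1 + 2000 * B)) + B * nW * (20 * (4 * B) * c + 4 * 16)) * \<delta>"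
    using stein(3) expectation_T_test_fun_le[of z] B0 side unfolding distrib_right by (simp add: abs_le_iff)
  have Q_bd: "0 \<le> ?Q \<omega>" "?Q \<omega> \<le> 4 * B" "?Q \<omega> \<le> bump_sum z \<omega>" for \<omega>
  proof -
    note k = cut_bounds[of \<omega>] and P = bump_sum_bounds[of z \<omega>]
    show "0 \<le> ?Q \<omega>" using k P by simp
    have "?Q \<omega> \<le> cut \<omega> * (2 * R \<omega>)" using k P by (intro mult_left_mono) auto
    also have "\<dots> \<le> 4 * B" using k(3) by simp
    finally show "?Q \<omega> \<le> 4 * B" .
    show "?Q \<omega> \<le> bump_sum z \<omega>" using mult_right_mono[OF k(2) P(1)] by simp
  qed
  have Q_int: "integrable M ?Q"
    by (rule integrable_const_bound[where B="4 * B"]) (use Q_bd in auto)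
  let ?X = "\<lambda>\<omega>. \<bar>(\<rho> \<omega>)\<^sup>2 * S \<omega> - 1\<bar> + fluct \<omega>"
  have X: "Lp_le 1 ?X (8 * c * \<delta> + c_fluct * \<delta>)"
    by (intro Lp_le_add Lp_le_abs rho_sq_S_L1 fluct_L1)
  have fl0: "0 \<le> fluct \<omega>" for \<omega> using r0_bounds by (simp add: fluct_def)
  have low: "?Q \<omega> / 2 - 4 * B * ?X \<omega> \<le> ?inc \<omega>" for \<omega>
  proof -
    have "(1/2 - ?X \<omega>) * ?Q \<omega> \<le> ((\<rho> \<omega>)\<^sup>2 * S \<omega> - 144 * Rv \<omega>) * ?Q \<omega>"
      using Rv_le_half_plus_fluct[of \<omega>] Q_bd(1) by (intro mult_right_mono) auto
    also have "\<dots> \<le> ?inc \<omega>" using test_fun_increments[of \<omega> z] by (simp only: left_diff_distrib)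
    finally have 1: "?Q \<omega> / 2 - ?X \<omega> * ?Q \<omega> \<le> ?inc \<omega>" by (simp add: left_diff_distrib)
    have "?X \<omega> * ?Q \<omega> \<le> ?X \<omega> * (4 * B)" using Q_bd(2)[of \<omega>] fl0[of \<omega>] by (intro mult_left_mono) auto
    then have "?X \<omega> * ?Q \<omega> \<le> 4 * B * ?X \<omega>" by (simp only: mult.commute[of "?X \<omega>" "4 * B"])
    with 1 show ?thesis by linarith
  qed
  have E1: "expectation (\<lambda>\<omega>. ?Q \<omega> / 2 - 4 * B * ?X \<omega>) \<le> expectation ?inc"
    using low Q_int inc_int Lp_le_1D(1)[OF X] by (intro integral_mono) auto
  have E2: "expectation (\<lambda>\<omega>. ?Q \<omega> / 2 - 4 * B * ?X \<omega>) = expectation ?Q / 2 - 4 * B * expectation ?X"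
    using Q_int Lp_le_1D(1)[OF X] by simp
  have E3: "4 * B * expectation ?X \<le> 4 * B * (8 * c * \<delta> + c_fluct * \<delta>)"
    using Lp_le_1D(3)[OF X] B0 by (intro mult_left_mono) auto
  have EQ: "expectation ?Q \<le> 2 * ((16 * (nW * B * (1 + 2000 * B)) + B * nW * (20 * (4 * B) * c + 4 * 16)) * \<delta>
      + 4 * B * (8 * c * \<delta> + c_fluct * \<delta>))"
  proof -
    have "q \<le> 2 * (s + t)" if "u \<le> i" "u = q / 2 - y" "y \<le> t" "i \<le> s" for q s t u i y :: real
      using that by simp
    from this[OF E1 E2 E3 inc_le] show ?thesis .
  qed
  let ?f = "\<lambda>\<omega>. (R \<omega> - expectation R)\<^sup>2"
  have f2: "integrable M ?f" "expectation ?f \<le> (2 * B * \<delta>)\<^sup>2" using Lp_le_2D[OF R_fluctuation] by auto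
  (* The cut-off is active only where R exceeds twice the bound B of its mean. *)
  have le: "bump_sum z \<omega> \<le> ?Q \<omega> + 4 * ?f \<omega>" for \<omega>
  proof (cases "R \<omega> \<le> 2 * B")
    case True
    then have "cut \<omega> = 1" using B_ge_1 by (simp add: cut_def max_def)
    then show ?thesis by simp
  next
    case False
    have ER: "expectation R \<le> B" using Lp_le_1D(3)[OF R_L1] by simp
    let ?t = "R \<omega> - expectation R"
    have t: "R \<omega> \<le> 2 * ?t" "1 \<le> ?t" using False ER B_ge_1 by auto
    have "bump_sum z \<omega> \<le> 2 * R \<omega>" by (rule bump_sum_bounds)
    also have "\<dots> \<le> 4 * (?t * 1)" using t by simp
    also have "\<dots> \<le> 4 * (?t * ?t)" using t by (intro mult_left_mono) auto
    finally show ?thesis using Q_bd(1)[of \<omega>] by (simp add: power2_eq_square)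
  qed
  have P_int: "integrable M (bump_sum z)"
  proof (rule Bochner_Integration.integrable_bound)
    show "integrable M (\<lambda>\<omega>. ?Q \<omega> + 4 * ?f \<omega>)" using Q_int f2 by auto
    show "AE \<omega> in M. norm (bump_sum z \<omega>) \<le> norm (?Q \<omega> + 4 * ?f \<omega>)"
      using le bump_sum_bounds(1) by (intro AE_I2) (auto intro: order_trans[OF le abs_ge_self])
  qed measurable
  have "expectation (bump_sum z) \<le> expectation (\<lambda>\<omega>. ?Q \<omega> + 4 * ?f \<omega>)"
    using P_int Q_int f2 le by (intro integral_mono) auto
  also have "\<dots> = expectation ?Q + 4 * expectation ?f" using Q_int f2 by simp
  also have "\<dots> \<le> 2 * ((16 * (nW * B * (1 + 2000 * B)) + B * nW * (20 * (4 * B) * c + 4 * 16)) * \<delta>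
      + 4 * B * (8 * c * \<delta> + c_fluct * \<delta>)) + 4 * (4 * B\<^sup>2 * \<delta>)"
  proof -
    have "(2 * B * \<delta>)\<^sup>2 = 4 * B\<^sup>2 * \<delta>\<^sup>2" by (simp add: power_mult_distrib)
    also have "\<dots> \<le> 4 * B\<^sup>2 * \<delta>" using delta_power_le by (intro mult_left_mono) auto
    finally show ?thesis using EQ f2(2) by linarith
  qed
  also have "\<dots> = c_bump * \<delta>" by (simp add: c_bump_def algebra_simps)
  finally have 1: "expectation (bump_sum z) \<le> c_bump * \<delta>" .
  have 2: "0 \<le> expectation (bump_sum z)" using bump_sum_bounds(1) by (intro Bochner_Integration.integral_nonneg) auto
  from order_trans[OF 2 1] show ?thesis using P_int bump_sum_bounds(1) 1 by (simp add: Lp_le_def)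
qed

definition c_BE :: real where
  "c_BE = 16 * c + 8 * ((4 * nW + 3) * B) + 16 * (5000 * B * c_bump) + B * nW * (60 * c)"

text \<open>The bump of index \<open>j\<close> is at least \<open>1/5\<close> wherever the indicator is one.\<close>

lemma near_sum_L1:
  "Lp_le 1 (\<lambda>\<omega>. \<Sum>j\<in>I. \<bar>\<xi> j \<omega>\<bar> * (e j \<omega> * of_bool (\<bar>T \<omega> - z\<bar> \<le> 2 * e j \<omega>))) (5000 * B * c_bump * \<delta>)"
proof -
  have 1: "Lp_le 1 (\<lambda>\<omega>. (5 / r0) * bump_sum z \<omega>) (\<bar>5 / r0\<bar> * (c_bump * \<delta>))"
    by (intro Lp_le_cmult bump_sum_L1)
  have "Lp_le 1 (\<lambda>\<omega>. \<Sum>j\<in>I. \<bar>\<xi> j \<omega>\<bar> * (e j \<omega> * of_bool (\<bar>T \<omega> - z\<bar> \<le> 2 * e j \<omega>))) (\<bar>5 / r0\<bar> * (c_bump * \<delta>))"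
  proof (rule Lp_le_dominated[OF 1])
    show "(\<lambda>\<omega>. \<Sum>j\<in>I. \<bar>\<xi> j \<omega>\<bar> * (e j \<omega> * of_bool (\<bar>T \<omega> - z\<bar> \<le> 2 * e j \<omega>))) \<in> borel_measurable M"
      unfolding of_bool_def by measurable
    fix \<omega>
    have "(\<Sum>j\<in>I. \<bar>\<xi> j \<omega>\<bar> * (e j \<omega> * of_bool (\<bar>T \<omega> - z\<bar> \<le> 2 * e j \<omega>)))
      \<le> (\<Sum>j\<in>I. (5 / r0) * (\<bar>\<xi> j \<omega>\<bar> * (bump_weight r0 \<alpha> (e j \<omega>) * bump (e j \<omega> + \<alpha>) (T \<omega> - z))))"
    proof (rule sum_mono)
      fix j
      note w = bump_weight_bounds[OF r0_bounds e_nonneg, of j \<omega>]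
      have "e j \<omega> * of_bool (\<bar>T \<omega> - z\<bar> \<le> 2 * e j \<omega>) \<le> (5 / r0) * (bump_weight r0 \<alpha> (e j \<omega>) * bump (e j \<omega> + \<alpha>) (T \<omega> - z))"
      proof (cases "\<bar>T \<omega> - z\<bar> \<le> 2 * e j \<omega>")
        case True
        have "1/5 \<le> bump (e j \<omega> + \<alpha>) (T \<omega> - z)"
          using True e_nonneg[of j \<omega>] r0_bounds(3) by (intro bump_ge_fifth) auto
        then have "(r0 * e j \<omega>) * (1/5) \<le> bump_weight r0 \<alpha> (e j \<omega>) * bump (e j \<omega> + \<alpha>) (T \<omega> - z)"
          using w by (intro mult_mono) auto
        then have "(5 / r0) * ((r0 * e j \<omega>) * (1/5)) \<le> (5 / r0) * (bump_weight r0 \<alpha> (e j \<omega>) * bump (e j \<omega> + \<alpha>) (T \<omega> - z))"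
          using const_bounds by (intro mult_left_mono) auto
        then show ?thesis using True const_bounds by simp
      next
        case False
        have "0 \<le> (5 / r0) * (bump_weight r0 \<alpha> (e j \<omega>) * bump (e j \<omega> + \<alpha>) (T \<omega> - z))"
          using w bump_bounds const_bounds by (intro mult_nonneg_nonneg) auto
        then show ?thesis using False by simp
      qed
      from mult_left_mono[OF this, of "\<bar>\<xi> j \<omega>\<bar>"]
      show "\<bar>\<xi> j \<omega>\<bar> * (e j \<omega> * of_bool (\<bar>T \<omega> - z\<bar> \<le> 2 * e j \<omega>)) \<le> (5 / r0) * (\<bar>\<xi> j \<omega>\<bar> * (bump_weight r0 \<alpha> (e j \<omega>) * bump (e j \<omega> + \<alpha>) (T \<omega> - z)))"
        by (simp add: mult_ac)
    qed
    also have "\<dots> = (5 / r0) * bump_sum z \<omega>" by (simp only: bump_sum_def sum_distrib_left)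
    finally have "(\<Sum>j\<in>I. \<bar>\<xi> j \<omega>\<bar> * (e j \<omega> * of_bool (\<bar>T \<omega> - z\<bar> \<le> 2 * e j \<omega>))) \<le> (5 / r0) * bump_sum z \<omega>" .
    moreover have "0 \<le> (\<Sum>j\<in>I. \<bar>\<xi> j \<omega>\<bar> * (e j \<omega> * of_bool (\<bar>T \<omega> - z\<bar> \<le> 2 * e j \<omega>)))"
      using e_nonneg by (intro sum_nonneg mult_nonneg_nonneg) auto
    ultimately show "\<bar>\<Sum>j\<in>I. \<bar>\<xi> j \<omega>\<bar> * (e j \<omega> * of_bool (\<bar>T \<omega> - z\<bar> \<le> 2 * e j \<omega>))\<bar> \<le> \<bar>(5 / r0) * bump_sum z \<omega>\<bar>"
      by linarith
  qed
  moreover have "\<bar>5 / r0\<bar> * (c_bump * \<delta>) = 5000 * B * c_bump * \<delta>" using B_ge_1 by (simp add: r0_def)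
  ultimately show ?thesis by simp
qed

text \<open>For the Stein solution \<open>f\<close> the difference is \<open>E (f' T) - E (T * f T)\<close>. The linear parts of the increments
  add up to \<open>\<rho>\<^sup>2 * S * f' T\<close>, where \<open>\<rho>\<^sup>2 * S\<close> is close to one.\<close>

theorem Berry_Esseen:
  "\<bar>prob {\<omega> \<in> space M. T \<omega> \<le> z} - std_normal_cdf z\<bar> \<le> c_BE * \<delta>"
proof -
  let ?f = "stein_sol z" and ?f' = "stein_deriv z"
  let ?inc = "\<lambda>\<omega>. \<Sum>j\<in>I. \<xi> j \<omega> * \<rho> \<omega> * (?f (T \<omega>) - ?f (T \<omega> - shift j \<omega>))"
  have shm: "shift j \<in> borel_measurable M" if "j \<in> I" for j
    unfolding shift_def[abs_def] using Lp_leD(1)[OF Lp_le_eta[OF that]] by measurable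
  note stein = stein_leave_one_out[where H="\<lambda>_. ?f" and H_off="\<lambda>_ _. ?f" and K=3 and q=0 and E="\<lambda>_ _. 0"]
  have m1: "(\<lambda>\<omega>. ?f (T \<omega>)) \<in> borel_measurable M" by measurable
  have m2: "(\<lambda>\<omega>. ?f (T \<omega> - shift j \<omega>)) \<in> borel_measurable M" if "j \<in> I" for j
    using shm[OF that] by measurable
  have m3: "(\<lambda>\<omega>. ?f (T_off j \<omega>)) \<in> borel_measurable (F (I - A j))" if "j \<in> I" for j
    using T_off_measurable_F(1)[OF that] by measurable
  have Lip: "\<bar>?f x - ?f y\<bar> \<le> 3 * \<bar>x - y\<bar>" for x y
    using stein_sol_Lipschitz[of z x y] by linarith
  have E0: "Lp_le 2 (\<lambda>_::'a. 0) (0 * \<delta>\<^sup>2)" using Lp_le_const[of 2 0] by simp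
  have i1: "integrable M (\<lambda>\<omega>. T \<omega> * ?f (T \<omega>))"
    by (rule stein(1)) (use m1 m2 m3 Lip E0 stein_sol_bound in auto)
  have i2: "integrable M (\<lambda>\<omega>. \<xi> j \<omega> * \<rho> \<omega> * (?f (T \<omega>) - ?f (T \<omega> - shift j \<omega>)))" if "j \<in> I" for j
    by (rule stein(2)[OF _ _ _ _ _ _ _ _ _ that]) (use m1 m2 m3 Lip E0 stein_sol_bound in auto)
  have s3: "\<bar>expectation (\<lambda>\<omega>. T \<omega> * ?f (T \<omega>)) - expectation ?inc\<bar> \<le> B * nW * (20 * 3 * c + 4 * 0) * \<delta>"
    by (rule stein(3)) (use m1 m2 m3 Lip E0 stein_sol_bound in auto)
  let ?near = "\<lambda>\<omega>. \<Sum>j\<in>I. \<bar>\<xi> j \<omega>\<bar> * (e j \<omega> * of_bool (\<bar>T \<omega> - z\<bar> \<le> 2 * e j \<omega>))"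
  let ?Y = "\<lambda>\<omega>. 2 * \<bar>(\<rho> \<omega>)\<^sup>2 * S \<omega> - 1\<bar> + (\<Sum>j\<in>I. 32 * \<bar>W \<omega> * \<xi> j \<omega> * (e j \<omega> * e j \<omega>)\<bar> + 24 * \<bar>\<xi> j \<omega> * e j \<omega> * e j \<omega>\<bar>)
      + 16 * ?near \<omega>"
  have Y: "Lp_le 1 ?Y (\<bar>2\<bar> * (8 * c * \<delta>) + real (card I) * (\<bar>32\<bar> * (nW * a * (\<delta> * \<delta>)) + \<bar>24\<bar> * (a * \<delta> * \<delta>))
      + \<bar>16\<bar> * (5000 * B * c_bump * \<delta>))"
    by (intro Lp_le_add Lp_le_cmult Lp_le_abs rho_sq_S_L1 near_sum_L1 Lp_le_sum_const Lp_le_mult_L2 Lp_le_mult_L4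
        W_L4 L4 Lp_le_e Lp_le_2_of_4) auto
  have ptw: "\<bar>?f' (T \<omega>) - ?inc \<omega>\<bar> \<le> ?Y \<omega>" for \<omega>
  proof -
    have eq: "?inc \<omega> - (\<rho> \<omega>)\<^sup>2 * S \<omega> * ?f' (T \<omega>)
      = (\<Sum>j\<in>I. \<xi> j \<omega> * \<rho> \<omega> * (?f (T \<omega>) - ?f (T \<omega> - shift j \<omega>) - shift j \<omega> * ?f' (T \<omega>)))"
      unfolding sum_xi_rho_shift[symmetric] sum_distrib_right sum_subtractf[symmetric]
      by (intro sum.cong refl) (simp add: algebra_simps)
    have "\<bar>\<Sum>j\<in>I. \<xi> j \<omega> * \<rho> \<omega> * (?f (T \<omega>) - ?f (T \<omega> - shift j \<omega>) - shift j \<omega> * ?f' (T \<omega>))\<bar>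
      \<le> (\<Sum>j\<in>I. 32 * \<bar>W \<omega> * \<xi> j \<omega> * (e j \<omega> * e j \<omega>)\<bar> + 24 * \<bar>\<xi> j \<omega> * e j \<omega> * e j \<omega>\<bar>
        + 16 * (\<bar>\<xi> j \<omega>\<bar> * (e j \<omega> * of_bool (\<bar>T \<omega> - z\<bar> \<le> 2 * e j \<omega>))))"
    proof (rule order_trans[OF sum_abs sum_mono])
      fix j
      let ?s = "shift j \<omega>" and ?e = "e j \<omega>"
      have sq: "?s\<^sup>2 \<le> 4 * (?e * ?e)"
        using abs_shift_le[of j \<omega>] power_mono[of "\<bar>?s\<bar>" "2 * ?e" 2] by (simp add: power2_eq_square)
      have "\<bar>?f (T \<omega>) - ?f (T \<omega> - ?s) - ?s * ?f' (T \<omega>)\<bar>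
         \<le> (2 * \<bar>T \<omega>\<bar> + 3) * ?s\<^sup>2 + 4 * (\<bar>?s\<bar> * of_bool (\<bar>T \<omega> - z\<bar> \<le> \<bar>?s\<bar>))"
        by (rule stein_sol_expansion)
      also have "\<dots> \<le> (2 * (2 * \<bar>W \<omega>\<bar>) + 3) * (4 * (?e * ?e)) + 4 * ((2 * ?e) * of_bool (\<bar>T \<omega> - z\<bar> \<le> 2 * ?e))"
      proof (intro add_mono mult_mono mult_left_mono)
        show "(of_bool (\<bar>T \<omega> - z\<bar> \<le> \<bar>?s\<bar>)::real) \<le> of_bool (\<bar>T \<omega> - z\<bar> \<le> 2 * ?e)"
          using abs_shift_le[of j \<omega>] by auto
      qed (use abs_T_le[of \<omega>] sq abs_shift_le[of j \<omega>] e_nonneg[of j \<omega>] in auto)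
      finally have b: "\<bar>?f (T \<omega>) - ?f (T \<omega> - ?s) - ?s * ?f' (T \<omega>)\<bar>
        \<le> (2 * (2 * \<bar>W \<omega>\<bar>) + 3) * (4 * (?e * ?e)) + 4 * ((2 * ?e) * of_bool (\<bar>T \<omega> - z\<bar> \<le> 2 * ?e))" .
      have "\<bar>\<xi> j \<omega> * \<rho> \<omega> * (?f (T \<omega>) - ?f (T \<omega> - ?s) - ?s * ?f' (T \<omega>))\<bar>
        \<le> (\<bar>\<xi> j \<omega>\<bar> * 2) * ((2 * (2 * \<bar>W \<omega>\<bar>) + 3) * (4 * (?e * ?e)) + 4 * ((2 * ?e) * of_bool (\<bar>T \<omega> - z\<bar> \<le> 2 * ?e)))"
        unfolding abs_mult using b rho_bounds[of \<omega>] by (intro mult_mono) (auto simp: abs_mult)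
      also have "\<dots> = 32 * \<bar>W \<omega> * \<xi> j \<omega> * (?e * ?e)\<bar> + 24 * \<bar>\<xi> j \<omega> * ?e * ?e\<bar>
        + 16 * (\<bar>\<xi> j \<omega>\<bar> * (?e * of_bool (\<bar>T \<omega> - z\<bar> \<le> 2 * ?e)))"
        using e_nonneg[of j \<omega>] by (simp add: abs_mult algebra_simps)
      finally show "\<bar>\<xi> j \<omega> * \<rho> \<omega> * (?f (T \<omega>) - ?f (T \<omega> - ?s) - ?s * ?f' (T \<omega>))\<bar>
        \<le> 32 * \<bar>W \<omega> * \<xi> j \<omega> * (?e * ?e)\<bar> + 24 * \<bar>\<xi> j \<omega> * ?e * ?e\<bar>
        + 16 * (\<bar>\<xi> j \<omega>\<bar> * (?e * of_bool (\<bar>T \<omega> - z\<bar> \<le> 2 * ?e)))" .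
    qed
    also have "\<dots> = (\<Sum>j\<in>I. 32 * \<bar>W \<omega> * \<xi> j \<omega> * (e j \<omega> * e j \<omega>)\<bar> + 24 * \<bar>\<xi> j \<omega> * e j \<omega> * e j \<omega>\<bar>) + 16 * ?near \<omega>"
      by (simp only: sum.distrib sum_distrib_left)
    finally have 1: "\<bar>?inc \<omega> - (\<rho> \<omega>)\<^sup>2 * S \<omega> * ?f' (T \<omega>)\<bar>
       \<le> (\<Sum>j\<in>I. 32 * \<bar>W \<omega> * \<xi> j \<omega> * (e j \<omega> * e j \<omega>)\<bar> + 24 * \<bar>\<xi> j \<omega> * e j \<omega> * e j \<omega>\<bar>) + 16 * ?near \<omega>" unfolding eq .
    have "\<bar>(\<rho> \<omega>)\<^sup>2 * S \<omega> * ?f' (T \<omega>) - ?f' (T \<omega>)\<bar> = \<bar>?f' (T \<omega>)\<bar> * \<bar>(\<rho> \<omega>)\<^sup>2 * S \<omega> - 1\<bar>"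
      unfolding abs_mult[symmetric] by (simp add: algebra_simps)
    also have "\<dots> \<le> 2 * \<bar>(\<rho> \<omega>)\<^sup>2 * S \<omega> - 1\<bar>"
      using stein_deriv_bound[of z "T \<omega>"] by (intro mult_right_mono) auto
    finally show ?thesis using 1 by linarith
  qed
  have i3: "integrable M (\<lambda>\<omega>. ?f' (T \<omega>))"
    by (rule integrable_const_bound[where B=2]) (use stein_deriv_bound in auto)
  have i4: "integrable M ?inc" using i2 by (intro Bochner_Integration.integrable_sum) auto
  have "\<bar>expectation (\<lambda>\<omega>. ?f' (T \<omega>)) - expectation ?inc\<bar> = \<bar>expectation (\<lambda>\<omega>. ?f' (T \<omega>) - ?inc \<omega>)\<bar>"
    using i3 i4 by simp
  also have "\<dots> \<le> expectation (\<lambda>\<omega>. \<bar>?f' (T \<omega>) - ?inc \<omega>\<bar>)" by (rule integral_abs_bound)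
  also have "\<dots> \<le> expectation ?Y"
    using i3 i4 Lp_le_1D(1)[OF Y] ptw by (intro integral_mono) auto
  also have "\<dots> \<le> \<bar>2\<bar> * (8 * c * \<delta>) + real (card I) * (\<bar>32\<bar> * (nW * a * (\<delta> * \<delta>)) + \<bar>24\<bar> * (a * \<delta> * \<delta>))
      + \<bar>16\<bar> * (5000 * B * c_bump * \<delta>)"
    using Lp_le_1D(3)[OF Y] by linarith
  also have "\<dots> = 16 * c * \<delta> + 8 * (4 * nW + 3) * (card I * (a * \<delta>\<^sup>2)) + 16 * (5000 * B * c_bump * \<delta>)"
    by (simp add: power2_eq_square algebra_simps)
  also have "\<dots> \<le> 16 * c * \<delta> + 8 * (4 * nW + 3) * (B * \<delta>) + 16 * (5000 * B * c_bump * \<delta>)"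
    using nW_ge_1 by (intro add_mono order_refl mult_left_mono card_sum_bounds) auto
  finally have s4: "\<bar>expectation (\<lambda>\<omega>. ?f' (T \<omega>)) - expectation ?inc\<bar>
     \<le> 16 * c * \<delta> + 8 * (4 * nW + 3) * (B * \<delta>) + 16 * (5000 * B * c_bump * \<delta>)" .
  have "prob {\<omega> \<in> space M. T \<omega> \<le> z} - std_normal_cdf z = expectation (\<lambda>\<omega>. ?f' (T \<omega>)) - expectation (\<lambda>\<omega>. T \<omega> * ?f (T \<omega>))"
  proof -
    have set: "{\<omega> \<in> space M. T \<omega> \<le> z} \<in> sets M" by measurable
    have "expectation (\<lambda>\<omega>. ?f' (T \<omega>)) - expectation (\<lambda>\<omega>. T \<omega> * ?f (T \<omega>)) = expectation (\<lambda>\<omega>. ?f' (T \<omega>) - T \<omega> * ?f (T \<omega>))"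
      using i1 i3 by simp
    also have "\<dots> = expectation (\<lambda>\<omega>. indicator {\<omega> \<in> space M. T \<omega> \<le> z} \<omega> - std_normal_cdf z)"
      by (intro Bochner_Integration.integral_cong refl) (auto simp: stein_deriv_def indicator_def)
    also have "\<dots> = prob {\<omega> \<in> space M. T \<omega> \<le> z} - std_normal_cdf z"
    proof -
      have "integrable M (indicat_real {\<omega> \<in> space M. T \<omega> \<le> z})"
        using set by (intro integrable_real_indicator) (auto simp: emeasure_eq_measure)
      then show ?thesis using set by (subst Bochner_Integration.integral_diff) (auto simp: prob_space)
    qed
    finally show ?thesis by simp
  qed
  then have "\<bar>prob {\<omega> \<in> space M. T \<omega> \<le> z} - std_normal_cdf z\<bar>
     \<le> (16 * c * \<delta> + 8 * (4 * nW + 3) * (B * \<delta>) + 16 * (5000 * B * c_bump * \<delta>)) + B * nW * (20 * 3 * c + 4 * 0) * \<delta>"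
    using s3 s4 by linarith
  also have "\<dots> = c_BE * \<delta>" by (simp add: c_BE_def algebra_simps)
  finally show ?thesis .
qed

end


section \<open>Berry--Esseen bounds for normalized and self-normalized sums\<close>

context local_dependence
begin

text \<open>The square of the self-normalizing factor in units of the variance, before the positive part is taken.\<close>

definition self_norm :: "'a \<Rightarrow> real" where
  "self_norm \<omega> = S \<omega> - W \<omega> * (\<Sum>i\<in>I. \<eta> i \<omega>) / card I"

lemma S_measurable [measurable]: "S \<in> borel_measurable M"
  by (rule psum_measurable) auto

lemma studentized_constant: "studentized_dependence M I A F \<xi> D a B (\<lambda>_. 1) (\<lambda>_ _. 1) (2 * B)"
proof
  have Z: "Lp_le 2 (\<lambda>_::'a. 0) k" if "0 \<le> k" for k
    using Lp_le_bound_mono[OF Lp_le_const[of 2 0]] that by simp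
  show "Lp_le 2 (\<lambda>\<omega>. 1 - 1) (2 * B * \<delta>)" "Lp_le 2 (\<lambda>\<omega>. 1 - 1) (2 * B * \<delta>\<^sup>2)"
    using Z B_ge_1 delta_pos by auto
  show "Lp_le 1 (\<lambda>\<omega>. S \<omega> - 1) (2 * B * \<delta>)" by (rule Lp_le_1_of_2[OF S_minus_1_L2])
qed (use B_ge_1 in auto)

text \<open>Summing \<open>\<eta>\<^sub>i\<close> over \<open>i\<close> counts each \<open>\<xi>\<^sub>k\<close> once per neighbour of \<open>k\<close>. The centering term is
  therefore a product of two sums of the size of \<open>W\<close>, with the small factor \<open>D / card I\<close>.\<close>

lemma centering_term_L2: "Lp_le 2 (\<lambda>\<omega>. W \<omega> * (\<Sum>i\<in>I. \<eta> i \<omega>) / card I) (nW\<^sup>2 * \<delta>\<^sup>2)"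
proof -
  have I0: "0 < real (card I)" using one_le_card a_pos D_pos by (cases "card I = 0") auto
  have "(\<Sum>i\<in>I. \<eta> i \<omega>) = D * (\<Sum>k\<in>I. (real (card (A k)) / D) * \<xi> k \<omega>)" for \<omega>
  proof -
    have "(\<Sum>i\<in>I. \<eta> i \<omega>) = (\<Sum>k\<in>I. real (card (A k)) * \<xi> k \<omega>)"
      unfolding \<eta>_def by (rule sum_nbhd_swap)
    then show ?thesis using D_pos by (simp add: sum_distrib_left)
  qed
  moreover have "Lp_le 4 (\<lambda>\<omega>. D * (\<Sum>k\<in>I. (real (card (A k)) / D) * \<xi> k \<omega>)) (\<bar>D\<bar> * (1 + 7 * B))"
    by (intro Lp_le_cmult weighted_sum_L4) (use card_A D_pos in auto)
  ultimately have "Lp_le 4 (\<lambda>\<omega>. \<Sum>i\<in>I. \<eta> i \<omega>) (D * nW)"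
    using D_pos by (auto simp: nW_def intro: Lp_le_bound_mono)
  from Lp_le_cmult[OF Lp_le_mult_L4[OF W_L4 this], of "1 / card I"]
  have 1: "Lp_le 2 (\<lambda>\<omega>. W \<omega> * (\<Sum>i\<in>I. \<eta> i \<omega>) / card I) (nW\<^sup>2 * (D / card I))"
    by (simp add: power2_eq_square mult_ac)
  have "D * 1 \<le> D * (card I * (a * \<delta>))" using one_le_card D_pos by (intro mult_left_mono) auto
  then have "D / card I \<le> \<delta>\<^sup>2" using I0 by (simp add: field_simps power2_eq_square)
  then have "nW\<^sup>2 * (D / card I) \<le> nW\<^sup>2 * \<delta>\<^sup>2" by (intro mult_left_mono) auto
  with 1 show ?thesis by (rule Lp_le_bound_mono)
qed

definition c_self :: real where "c_self = 2 * B + nW\<^sup>2"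

lemma self_norm_minus_1: "Lp_le 2 (\<lambda>\<omega>. self_norm \<omega> - 1) (c_self * \<delta>)"
proof -
  have "Lp_le 2 (\<lambda>\<omega>. (S \<omega> - 1) - W \<omega> * (\<Sum>i\<in>I. \<eta> i \<omega>) / card I) (2 * B * \<delta> + nW\<^sup>2 * \<delta>\<^sup>2)"
    by (intro Lp_le_diff S_minus_1_L2 centering_term_L2)
  moreover have "nW\<^sup>2 * \<delta>\<^sup>2 \<le> nW\<^sup>2 * \<delta>" using delta_power_le by (intro mult_left_mono) auto
  ultimately show ?thesis
    by (auto simp: self_norm_def c_self_def algebra_simps intro: Lp_le_bound_mono)
qed

lemma studentized_self_norm:
  "studentized_dependence M I A F \<xi> D a B self_norm (\<lambda>j. psum (pairs_off j) (*)) c_self"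
proof
  show "self_norm \<in> borel_measurable M"
    unfolding self_norm_def[abs_def] using Lp_leD(1)[OF centering_term_L2] by measurable
  show "psum (pairs_off j) (*) \<in> borel_measurable (F (I - A j))" if "j \<in> I" for j
    by (rule psum_off_measurable_F[OF that]) auto
  show "Lp_le 2 (\<lambda>\<omega>. self_norm \<omega> - 1) (c_self * \<delta>)" by (rule self_norm_minus_1)
  show "Lp_le 2 (\<lambda>\<omega>. self_norm \<omega> - psum (pairs_off j) (*) \<omega>) (c_self * \<delta>\<^sup>2)" if "j \<in> I" for j
  proof -
    have "Lp_le 2 (\<lambda>\<omega>. (S \<omega> - psum (pairs_off j) (*) \<omega>) - W \<omega> * (\<Sum>i\<in>I. \<eta> i \<omega>) / card I) (2 * \<delta>\<^sup>2 + nW\<^sup>2 * \<delta>\<^sup>2)"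
      by (intro Lp_le_diff psum_minus_off centering_term_L2 that) auto
    moreover have "2 * \<delta>\<^sup>2 + nW\<^sup>2 * \<delta>\<^sup>2 \<le> c_self * \<delta>\<^sup>2"
      unfolding distrib_right[symmetric] c_self_def using B_ge_1 by (intro mult_right_mono) auto
    ultimately show ?thesis
      by (auto simp: self_norm_def algebra_simps intro: Lp_le_bound_mono)
  qed
  show "Lp_le 1 (\<lambda>\<omega>. S \<omega> - self_norm \<omega>) (c_self * \<delta>)"
  proof (rule Lp_le_bound_mono)
    show "Lp_le 1 (\<lambda>\<omega>. S \<omega> - self_norm \<omega>) (nW\<^sup>2 * \<delta>\<^sup>2)"
      using Lp_le_1_of_2[OF centering_term_L2] by (simp add: self_norm_def)
    have "nW\<^sup>2 * \<delta>\<^sup>2 \<le> c_self * \<delta>"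
      using delta_power_le B_ge_1 by (intro mult_mono) (auto simp: c_self_def)
    then show "nW\<^sup>2 * \<delta>\<^sup>2 \<le> c_self * \<delta>" .
  qed
  show "1 \<le> c_self" using B_ge_1 zero_le_power2[of nW] unfolding c_self_def by linarith
qed

theorem Berry_Esseen_normalized:
  "\<bar>prob {\<omega> \<in> space M. W \<omega> \<le> z} - std_normal_cdf z\<bar> \<le> studentized_dependence.c_BE B (2 * B) * \<delta>"
proof -
  interpret N: studentized_dependence M I A F \<xi> D a B "\<lambda>_. 1" "\<lambda>_ _. 1" "2 * B"
    by (rule studentized_constant)
  have "N.T \<omega> = W \<omega>" for \<omega> by (simp add: N.T_def N.\<rho>_def inv_sqrt_def)
  then show ?thesis using N.Berry_Esseen[of z] by simp
qed

text \<open>By Chebyshev's inequality \<open>self_norm\<close> leaves the range where clipping is inactive with probability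
  \<open>O(\<delta>\<^sup>2)\<close>.\<close>

theorem Berry_Esseen_self_normalized:
  assumes Y: "Y \<in> borel_measurable M"
    and eq: "\<And>\<omega>. \<omega> \<in> space M \<Longrightarrow> 0 < self_norm \<omega> \<Longrightarrow> Y \<omega> = W \<omega> / sqrt (self_norm \<omega>)"
  shows "\<bar>prob {\<omega> \<in> space M. Y \<omega> \<le> z} - std_normal_cdf z\<bar>
    \<le> (studentized_dependence.c_BE B c_self + 2 * c_self\<^sup>2) * \<delta>"
proof -
  interpret N: studentized_dependence M I A F \<xi> D a B self_norm "\<lambda>j. psum (pairs_off j) (*)" c_self
    by (rule studentized_self_norm)
  note [measurable] = Y N.T_measurable N.G_meas
  let ?bad = "{\<omega> \<in> space M. 3/4 < \<bar>self_norm \<omega> - 1\<bar>}"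
  let ?E = "{\<omega> \<in> space M. Y \<omega> \<le> z}" and ?E' = "{\<omega> \<in> space M. N.T \<omega> \<le> z}"
  have sets: "?bad \<in> sets M" "?E \<in> sets M" "?E' \<in> sets M" by measurable
  have same: "Y \<omega> = N.T \<omega>" if "\<omega> \<in> space M" "\<omega> \<notin> ?bad" for \<omega>
  proof -
    have "\<bar>self_norm \<omega> - 1\<bar> \<le> 3/4" using that by auto
    then have "1/4 \<le> self_norm \<omega>" by linarith
    then show ?thesis using eq[OF that(1)] by (simp add: N.T_def N.\<rho>_def inv_sqrt_def max_absorb1)
  qed
  have "?E \<subseteq> ?E' \<union> ?bad" "?E' \<subseteq> ?E \<union> ?bad" using same by fastforce+
  then have "prob ?E \<le> prob (?E' \<union> ?bad)" "prob ?E' \<le> prob (?E \<union> ?bad)"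
    using sets by (auto intro!: finite_measure_mono)
  then have 1: "\<bar>prob ?E - prob ?E'\<bar> \<le> prob ?bad"
    using measure_Un_le[OF sets(3) sets(1)] measure_Un_le[OF sets(2) sets(1)] by linarith
  note L = Lp_le_2D[OF self_norm_minus_1]
  have "prob ?bad = expectation (indicator ?bad)" using sets by simp
  also have "\<dots> \<le> expectation (\<lambda>\<omega>. 2 * (self_norm \<omega> - 1)\<^sup>2)"
  proof (rule integral_mono)
    show "integrable M (indicat_real ?bad)" using sets by (intro integrable_real_indicator) (auto simp: emeasure_eq_measure)
    show "integrable M (\<lambda>\<omega>. 2 * (self_norm \<omega> - 1)\<^sup>2)" using L by simp
    fix \<omega>
    have "1 \<le> 2 * (self_norm \<omega> - 1)\<^sup>2" if "3/4 < \<bar>self_norm \<omega> - 1\<bar>"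
      using power_mono[of "3/4" "\<bar>self_norm \<omega> - 1\<bar>" 2] that by (simp add: power2_eq_square)
    then show "indicat_real ?bad \<omega> \<le> 2 * (self_norm \<omega> - 1)\<^sup>2" by (auto simp: indicator_def)
  qed
  also have "\<dots> \<le> 2 * (c_self * \<delta>)\<^sup>2" using L by simp
  also have "\<dots> = 2 * c_self\<^sup>2 * \<delta>\<^sup>2" by (simp add: power_mult_distrib)
  also have "\<dots> \<le> 2 * c_self\<^sup>2 * \<delta>" using delta_power_le by (intro mult_left_mono) auto
  finally have "prob ?bad \<le> 2 * c_self\<^sup>2 * \<delta>" .
  then show ?thesis using 1 N.Berry_Esseen[of z] unfolding distrib_right by linarith
qed

end


section \<open>Stationary m-dependent sequences\<close>

locale stationary_m_dependent = prob_space M for M :: "'a measure" +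
  fixes X :: "nat \<Rightarrow> 'a \<Rightarrow> real" and m :: nat
  assumes X_meas: "\<And>i. i \<ge> 1 \<Longrightarrow> X i \<in> borel_measurable M"
    and stat: "stationary M X"
    and m_dep: "m_dependent M m X"
begin

definition cylinder :: "nat set \<Rightarrow> (nat \<Rightarrow> real set) \<Rightarrow> 'a set" where
  "cylinder P U = {\<omega> \<in> space M. \<forall>p\<in>P. X p \<omega> \<in> U p}"

lemma cylinder_sets:
  assumes "finite P" "0 \<notin> P" "\<And>p. p \<in> P \<Longrightarrow> U p \<in> sets borel"
  shows "cylinder P U \<in> sets M"
  unfolding cylinder_def
proof (rule sets.sets_Collect_finite_All[OF _ assms(1)])
  fix p assume p: "p \<in> P"
  then have "X p \<in> borel_measurable M" using assms(2) by (intro X_meas) (metis less_one not_less)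
  from measurable_sets[OF this assms(3)[OF p]]
  show "{\<omega> \<in> space M. X p \<omega> \<in> U p} \<in> sets M" by (simp add: vimage_def Int_def conj_commute)
qed

lemma cylinder_Un: "cylinder (P \<union> Q) U = cylinder P U \<inter> cylinder Q U"
  by (auto simp: cylinder_def)

lemma prob_split:
  assumes P: "finite P" "\<And>p. p \<in> P \<Longrightarrow> s p \<in> {1..k}" and Q: "finite Q" "\<And>q. q \<in> Q \<Longrightarrow> k + m < s q"
    and U: "\<And>p. p \<in> P \<union> Q \<Longrightarrow> U p \<in> sets borel"
  shows "prob {\<omega> \<in> space M. \<forall>p\<in>P \<union> Q. X (s p) \<omega> \<in> U p}
    = prob {\<omega> \<in> space M. \<forall>p\<in>P. X (s p) \<omega> \<in> U p} * prob {\<omega> \<in> space M. \<forall>p\<in>Q. X (s p) \<omega> \<in> U p}"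
proof -
  let ?I = "{1..k}" and ?J = "{k + m<..}"
  have ind: "indep_var (Pi\<^sub>M ?I (\<lambda>_. borel)) (\<lambda>\<omega>. \<lambda>i\<in>?I. X i \<omega>) (Pi\<^sub>M ?J (\<lambda>_. borel)) (\<lambda>\<omega>. \<lambda>i\<in>?J. X i \<omega>)"
    using m_dep by (simp add: m_dependent_def)
  define R where "R K L = {x \<in> space (Pi\<^sub>M K (\<lambda>_. borel :: real measure)). \<forall>p\<in>L. x (s p) \<in> U p}" for K L
  have sR: "R K L \<in> sets (Pi\<^sub>M K (\<lambda>_. borel))" if L: "finite L" "L \<subseteq> P \<union> Q" "\<And>p. p \<in> L \<Longrightarrow> s p \<in> K" for K L
    unfolding R_def
  proof (rule sets.sets_Collect_finite_All[OF _ L(1)])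
    fix p assume p: "p \<in> L"
    have "(\<lambda>x. x (s p)) \<in> measurable (Pi\<^sub>M K (\<lambda>_. borel)) (borel :: real measure)"
      by (rule measurable_component_singleton[OF L(3)[OF p]])
    from measurable_sets[OF this U, of p] p L(2)
    show "{x \<in> space (Pi\<^sub>M K (\<lambda>_. borel)). x (s p) \<in> U p} \<in> sets (Pi\<^sub>M K (\<lambda>_. borel))"
      by (auto simp: vimage_def Int_def conj_commute)
  qed
  have pre: "(\<lambda>\<omega>. \<lambda>i\<in>K. X i \<omega>) -` R K L \<inter> space M = {\<omega> \<in> space M. \<forall>p\<in>L. X (s p) \<omega> \<in> U p}"
    if "\<And>p. p \<in> L \<Longrightarrow> s p \<in> K" for K L
    using that by (auto simp: R_def space_PiM)
  have PI: "\<And>p. p \<in> P \<Longrightarrow> s p \<in> ?I" and QJ: "\<And>p. p \<in> Q \<Longrightarrow> s p \<in> ?J" using P Q by auto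
  have "prob ((\<lambda>\<omega>. (\<lambda>i\<in>?I. X i \<omega>, \<lambda>i\<in>?J. X i \<omega>)) -` (R ?I P \<times> R ?J Q) \<inter> space M)
     = prob ((\<lambda>\<omega>. \<lambda>i\<in>?I. X i \<omega>) -` R ?I P \<inter> space M) * prob ((\<lambda>\<omega>. \<lambda>i\<in>?J. X i \<omega>) -` R ?J Q \<inter> space M)"
    using P(1) Q(1) PI QJ by (intro indep_varD[OF ind] sR) auto
  moreover have "(\<lambda>\<omega>. (\<lambda>i\<in>?I. X i \<omega>, \<lambda>i\<in>?J. X i \<omega>)) -` (R ?I P \<times> R ?J Q) \<inter> space M
     = ((\<lambda>\<omega>. \<lambda>i\<in>?I. X i \<omega>) -` R ?I P \<inter> space M) \<inter> ((\<lambda>\<omega>. \<lambda>i\<in>?J. X i \<omega>) -` R ?J Q \<inter> space M)" by blast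
  moreover have "{\<omega> \<in> space M. \<forall>p\<in>P. X (s p) \<omega> \<in> U p} \<inter> {\<omega> \<in> space M. \<forall>p\<in>Q. X (s p) \<omega> \<in> U p}
     = {\<omega> \<in> space M. \<forall>p\<in>P \<union> Q. X (s p) \<omega> \<in> U p}" by blast
  ultimately show ?thesis using pre[OF PI] pre[OF QJ] by simp
qed

lemma prob_cylinder_split:
  assumes "finite P" "P \<subseteq> {1..k}" "finite Q" "Q \<subseteq> {k + m<..}" "\<And>p. U p \<in> sets borel"
  shows "prob (cylinder (P \<union> Q) U) = prob (cylinder P U) * prob (cylinder Q U)"
  unfolding cylinder_def by (rule prob_split[where s="\<lambda>p. p"]) (use assms in auto)

definition separated :: "nat set \<Rightarrow> nat set \<Rightarrow> bool" where
  "separated P Q \<longleftrightarrow> (\<forall>p\<in>P. \<forall>q\<in>Q. p + m < q \<or> q + m < p)"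

text \<open>Cut at the last element \<open>k\<close> of the set that does not contain the overall maximum: the part of the
  other set beyond \<open>k\<close> is independent of everything up to \<open>k\<close>.\<close>

lemma prob_cylinder_separated:
  assumes "finite P" "finite Q" "0 \<notin> P" "0 \<notin> Q" "separated P Q" "\<And>p. U p \<in> sets borel"
  shows "prob (cylinder (P \<union> Q) U) = prob (cylinder P U) * prob (cylinder Q U)"
  using assms(1-5)
proof (induction "card P + card Q" arbitrary: P Q rule: less_induct)
  case less
  note fin = less.prems(1,2)
  have one: "cylinder {} U = space M" by (simp add: cylinder_def)
  have step: "prob (cylinder (P \<union> Q) U) = prob (cylinder P U) * prob (cylinder Q U)"
    if hyp: "\<And>P'. P' \<subset> P \<Longrightarrow> prob (cylinder (P' \<union> Q) U) = prob (cylinder P' U) * prob (cylinder Q U)"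
      and PQ: "finite P" "finite Q" "0 \<notin> P" "0 \<notin> Q" "separated P Q" "Q \<noteq> {}" "P \<noteq> {}" "Max Q < Max P" for P Q
  proof -
    define k where "k = Max Q"
    define P1 P2 where "P1 = {p \<in> P. p \<le> k}" and "P2 = {p \<in> P. k < p}"
    have kQ: "k \<in> Q" using PQ unfolding k_def by simp
    have P12: "P = P1 \<union> P2" by (auto simp: P1_def P2_def)
    have P2: "P2 \<subseteq> {k + m<..}" using PQ(5) kQ unfolding separated_def P2_def by fastforce
    have pos: "P1 \<union> Q \<subseteq> {1..k}"
    proof
      fix x assume x: "x \<in> P1 \<union> Q"
      then have "x \<noteq> 0" using PQ(3,4) by (cases "x = 0") (auto simp: P1_def)
      moreover have "x \<le> k" using x PQ(2) by (auto simp: P1_def k_def)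
      ultimately show "x \<in> {1..k}" by simp
    qed
    have f: "finite P1" "finite P2" using PQ by (auto simp: P1_def P2_def)
    have "Max P \<in> P - P1" using Max_in[OF PQ(1,7)] PQ(8) by (simp add: P1_def k_def)
    then have "P1 \<subset> P" using P12 by blast
    note h = hyp[OF this]
    have "P \<union> Q = (P1 \<union> Q) \<union> P2" using P12 by auto
    then have "prob (cylinder (P \<union> Q) U) = prob (cylinder (P1 \<union> Q) U) * prob (cylinder P2 U)"
      using prob_cylinder_split[of "P1 \<union> Q" k P2 U] f PQ pos P2 assms(6) by simp
    also have "\<dots> = prob (cylinder P1 U) * prob (cylinder P2 U) * prob (cylinder Q U)" by (simp add: h)
    also have "prob (cylinder P1 U) * prob (cylinder P2 U) = prob (cylinder P U)"
      unfolding P12 using prob_cylinder_split[of P1 k P2 U] f pos P2 assms(6) by simp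
    finally show ?thesis .
  qed
  show ?case
  proof (cases "P = {} \<or> Q = {}")
    case True
    then show ?thesis by (auto simp: one prob_space)
  next
    case False
    then have ne: "P \<noteq> {}" "Q \<noteq> {}" by auto
    have "Max P \<noteq> Max Q"
      using less.prems(5) Max_in[OF fin(1) ne(1)] Max_in[OF fin(2) ne(2)] unfolding separated_def by force
    then consider "Max Q < Max P" | "Max P < Max Q" by linarith
    then show ?thesis
    proof cases
      case 1
      show ?thesis
      proof (rule step[OF _ less.prems(1-5) ne(2,1) 1])
        fix P' assume P': "P' \<subset> P"
        then have "card P' < card P" using fin by (intro psubset_card_mono)
        then show "prob (cylinder (P' \<union> Q) U) = prob (cylinder P' U) * prob (cylinder Q U)"
          using P' less.prems by (intro less.hyps) (auto simp: separated_def intro: finite_subset)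
      qed
    next
      case 2
      have sep: "separated Q P" using less.prems(5) unfolding separated_def by blast
      have "prob (cylinder (Q \<union> P) U) = prob (cylinder Q U) * prob (cylinder P U)"
      proof (rule step[OF _ less.prems(2,1,4,3) sep ne(1,2) 2])
        fix Q' assume Q': "Q' \<subset> Q"
        then have "card Q' < card Q" using fin by (intro psubset_card_mono)
        then have "prob (cylinder (P \<union> Q') U) = prob (cylinder P U) * prob (cylinder Q' U)"
          using Q' less.prems by (intro less.hyps) (auto simp: separated_def intro: finite_subset)
        then show "prob (cylinder (Q' \<union> P) U) = prob (cylinder Q' U) * prob (cylinder P U)"
          by (simp add: Un_commute)
      qed
      then show ?thesis by (simp add: Un_commute)
    qed
  qed
qed

definition cylinders :: "nat set \<Rightarrow> 'a set set" where
  "cylinders P = {cylinder P U | U. \<forall>p. U p \<in> sets borel}"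

text \<open>The sigma algebra generated by the \<open>X p\<close> with \<open>p \<in> P\<close>; its generator is stable under intersection.\<close>

definition F_pos :: "nat set \<Rightarrow> 'a measure" where
  "F_pos P = sigma (space M) (cylinders P)"

lemma cylinders_sub: "cylinders P \<subseteq> Pow (space M)"
  by (auto simp: cylinders_def cylinder_def)

lemma sets_F_pos: "sets (F_pos P) = sigma_sets (space M) (cylinders P)"
  unfolding F_pos_def by (rule sets_measure_of[OF cylinders_sub])

lemma space_F_pos: "space (F_pos P) = space M"
  unfolding F_pos_def by (rule space_measure_of[OF cylinders_sub])

lemma cylinders_sets: "finite P \<Longrightarrow> 0 \<notin> P \<Longrightarrow> cylinders P \<subseteq> sets M"
  by (auto simp: cylinders_def intro: cylinder_sets)

lemma subalgebra_F_pos: "finite P \<Longrightarrow> 0 \<notin> P \<Longrightarrow> subalgebra M (F_pos P)"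
  unfolding subalgebra_def sets_F_pos space_F_pos using sets.sigma_sets_subset[OF cylinders_sets] by auto

lemma cylinders_mono: "P \<subseteq> Q \<Longrightarrow> cylinders P \<subseteq> cylinders Q"
proof
  fix C assume PQ: "P \<subseteq> Q" and "C \<in> cylinders P"
  then obtain U where U: "C = cylinder P U" "\<forall>p. U p \<in> sets borel" by (auto simp: cylinders_def)
  have "C = cylinder Q (\<lambda>p. if p \<in> P then U p else UNIV)" using PQ by (auto simp: U cylinder_def)
  then show "C \<in> cylinders Q" using U(2) by (auto simp: cylinders_def)
qed

lemma F_pos_mono: "P \<subseteq> Q \<Longrightarrow> sets (F_pos P) \<subseteq> sets (F_pos Q)"
  unfolding sets_F_pos by (intro sigma_sets_mono' cylinders_mono)

lemma X_measurable_F_pos: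
  assumes "p \<in> P"
  shows "X p \<in> borel_measurable (F_pos P)"
proof (rule measurableI)
  fix B :: "real set" assume B: "B \<in> sets borel"
  have "X p -` B \<inter> space (F_pos P) = cylinder P (\<lambda>q. if q = p then B else UNIV)"
    using assms by (auto simp: cylinder_def space_F_pos)
  also have "\<dots> \<in> cylinders P" using B by (auto simp: cylinders_def)
  finally show "X p -` B \<inter> space (F_pos P) \<in> sets (F_pos P)" unfolding sets_F_pos by (rule sigma_sets.Basic)
qed simp

lemma Int_stable_cylinders: "Int_stable (cylinders P)"
proof (rule Int_stableI)
  fix A B assume "A \<in> cylinders P" "B \<in> cylinders P"
  then obtain U V where "A = cylinder P U" "B = cylinder P V" "\<forall>p. U p \<in> sets borel" "\<forall>p. V p \<in> sets borel"
    by (auto simp: cylinders_def)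
  then have "A \<inter> B = cylinder P (\<lambda>p. U p \<inter> V p)" "\<forall>p. U p \<inter> V p \<in> sets borel" by (auto simp: cylinder_def)
  then show "A \<inter> B \<in> cylinders P" by (auto simp: cylinders_def)
qed

lemma indep_F_pos:
  assumes fin: "finite P" "finite Q" "0 \<notin> P" "0 \<notin> Q" and sep: "separated P Q"
  shows "indep_set (sets (F_pos P)) (sets (F_pos Q))"
  unfolding sets_F_pos
proof (rule indep_set_sigma_sets[OF _ Int_stable_cylinders Int_stable_cylinders])
  show "indep_set (cylinders P) (cylinders Q)"
  proof (rule indep_setI)
    fix A B assume "A \<in> cylinders P" "B \<in> cylinders Q"
    then obtain U V where A: "A = cylinder P U" "\<forall>p. U p \<in> sets borel"
      and B: "B = cylinder Q V" "\<forall>p. V p \<in> sets borel" by (auto simp: cylinders_def)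
    define T where "T p = (if p \<in> P then U p else V p)" for p
    have "P \<inter> Q = {}" using sep by (fastforce simp: separated_def)
    then have "A = cylinder P T" "B = cylinder Q T" by (auto simp: A B T_def cylinder_def)
    moreover have "T p \<in> sets borel" for p using A B by (auto simp: T_def)
    ultimately show "prob (A \<inter> B) = prob A * prob B"
      using prob_cylinder_separated[OF fin sep, of T] by (simp add: cylinder_Un)
  qed (rule cylinders_sets; use fin in simp)+
qed

lemma prob_shift:
  assumes J: "finite J" "\<And>j. j \<in> J \<Longrightarrow> 1 \<le> s j" and U: "\<And>j. j \<in> J \<Longrightarrow> U j \<in> sets borel"
  shows "prob {\<omega> \<in> space M. \<forall>j\<in>J. X (s j + h) \<omega> \<in> U j} = prob {\<omega> \<in> space M. \<forall>j\<in>J. X (s j) \<omega> \<in> U j}"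
proof -
  define k where "k = (\<Sum>j\<in>J. s j)"
  have sk: "s j \<in> {1..k}" if "j \<in> J" for j
    using J that member_le_sum[of j J s] by (auto simp: k_def)
  let ?P = "Pi\<^sub>M {1..k} (\<lambda>_. borel) :: (nat \<Rightarrow> real) measure"
  let ?A = "{x \<in> space ?P. \<forall>j\<in>J. x (s j) \<in> U j}"
  have sA: "?A \<in> sets ?P"
  proof (rule sets.sets_Collect_finite_All[OF _ J(1)])
    fix j assume j: "j \<in> J"
    have "(\<lambda>x. x (s j)) \<in> measurable ?P (borel :: real measure)"
      using sk[OF j] by (intro measurable_component_singleton) auto
    from measurable_sets[OF this U[OF j]] show "{x \<in> space ?P. x (s j) \<in> U j} \<in> sets ?P"
      by (simp add: vimage_def Int_def conj_commute)
  qed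
  have mX: "(\<lambda>\<omega>. \<lambda>j\<in>{1..k}. X (j + h) \<omega>) \<in> measurable M ?P" for h
    by (intro measurable_restrict X_meas) auto
  have ev: "(\<lambda>\<omega>. \<lambda>j\<in>{1..k}. X (j + h) \<omega>) -` ?A \<inter> space M = {\<omega> \<in> space M. \<forall>j\<in>J. X (s j + h) \<omega> \<in> U j}" for h
    using sk by (auto simp: space_PiM)
  have "measure (distr M ?P (\<lambda>\<omega>. \<lambda>j\<in>{1..k}. X (j + h) \<omega>)) ?A = measure (distr M ?P (\<lambda>\<omega>. \<lambda>j\<in>{1..k}. X (j + 0) \<omega>)) ?A"
    using stat by (simp add: stationary_def)
  then show ?thesis unfolding measure_distr[OF mX sA] ev by simp
qed

end


subsection \<open>Laws of index vectors\<close>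

lemma index_setD:
  assumes "i \<in> index_set l d n"
  shows "\<And>j. j \<in> {1..l} \<Longrightarrow> i j \<in> {1..n}" "strict_mono_on {1..l} i"
    "\<And>j. j \<in> {1..l - 1} \<Longrightarrow> enat (i (j + 1) - i j) \<le> d j" "\<And>j. j \<notin> {1..l} \<Longrightarrow> i j = undefined"
  using assms by (auto simp: index_set_def PiE_def extensional_def Pi_def)

lemma index_set_less: "i \<in> index_set l d n \<Longrightarrow> p \<in> {1..l} \<Longrightarrow> q \<in> {1..l} \<Longrightarrow> p < q \<Longrightarrow> i p < i q"
  using index_setD(2) by (auto simp: strict_mono_on_def)

lemma index_set_less_Suc: "i \<in> index_set l d n \<Longrightarrow> j \<in> {1..l - 1} \<Longrightarrow> i j < i (j + 1)"
  by (rule index_set_less) auto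

lemma finite_index_set: "finite (index_set l d n)"
  by (rule finite_subset[of _ "{1..l} \<rightarrow>\<^sub>E {1..n}"]) (auto simp: index_set_def intro: finite_PiE)

context stationary_m_dependent
begin

definition law :: "nat \<Rightarrow> (nat \<Rightarrow> nat) \<Rightarrow> (nat \<Rightarrow> real) measure" where
  "law l i = distr M (Pi\<^sub>M {1..l} (\<lambda>_. borel)) (\<lambda>\<omega>. \<lambda>j\<in>{1..l}. X (i j) \<omega>)"

lemma index_vector_measurable:
  assumes "\<And>j. j \<in> {1..l} \<Longrightarrow> 1 \<le> i j"
  shows "(\<lambda>\<omega>. \<lambda>j\<in>{1..l}. X (i j) \<omega>) \<in> measurable M (Pi\<^sub>M {1..l} (\<lambda>_. borel))"
  using assms by (intro measurable_restrict X_meas) auto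

lemma law_eqI:
  assumes i: "\<And>j. j \<in> {1..l} \<Longrightarrow> 1 \<le> i j" and i': "\<And>j. j \<in> {1..l} \<Longrightarrow> 1 \<le> i' j"
    and eq: "\<And>U. (\<And>j. j \<in> {1..l} \<Longrightarrow> U j \<in> sets borel) \<Longrightarrow>
      prob {\<omega> \<in> space M. \<forall>j\<in>{1..l}. X (i j) \<omega> \<in> U j} = prob {\<omega> \<in> space M. \<forall>j\<in>{1..l}. X (i' j) \<omega> \<in> U j}"
  shows "law l i = law l i'"
proof -
  let ?P = "Pi\<^sub>M {1..l} (\<lambda>_. borel) :: (nat \<Rightarrow> real) measure"
  have em: "emeasure (law l k) (Pi\<^sub>E {1..l} U) = prob {\<omega> \<in> space M. \<forall>j\<in>{1..l}. X (k j) \<omega> \<in> U j}"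
    if k: "\<And>j. j \<in> {1..l} \<Longrightarrow> 1 \<le> k j" and U: "\<And>j. j \<in> {1..l} \<Longrightarrow> U j \<in> sets borel" for k U
  proof -
    have "Pi\<^sub>E {1..l} U \<in> sets ?P" using U by (intro sets_PiM_I_finite) auto
    then have "emeasure (law l k) (Pi\<^sub>E {1..l} U) = emeasure M ((\<lambda>\<omega>. \<lambda>j\<in>{1..l}. X (k j) \<omega>) -` Pi\<^sub>E {1..l} U \<inter> space M)"
      unfolding law_def by (intro emeasure_distr index_vector_measurable k)
    also have "(\<lambda>\<omega>. \<lambda>j\<in>{1..l}. X (k j) \<omega>) -` Pi\<^sub>E {1..l} U \<inter> space M = {\<omega> \<in> space M. \<forall>j\<in>{1..l}. X (k j) \<omega> \<in> U j}"
      by (auto simp: PiE_def Pi_def)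
    finally show ?thesis by (simp add: emeasure_eq_measure)
  qed
  show ?thesis
  proof (rule measure_eqI_PiM_finite[where I="{1..l}" and M="\<lambda>_. borel" and A="\<lambda>_. space ?P"])
    show "emeasure (law l i) (Pi\<^sub>E {1..l} U) = emeasure (law l i') (Pi\<^sub>E {1..l} U)"
      if "\<And>j. j \<in> {1..l} \<Longrightarrow> U j \<in> sets borel" for U
      using em[OF i that] em[OF i' that] eq[OF that] by simp
    have "space ?P = Pi\<^sub>E {1..l} (\<lambda>_. UNIV)" by (simp add: space_PiM)
    also have "\<dots> \<in> prod_algebra {1..l} (\<lambda>_. borel :: real measure)"
      by (rule prod_algebraI_finite) auto
    finally show "range (\<lambda>_::nat. space ?P) \<subseteq> prod_algebra {1..l} (\<lambda>_. borel)" by auto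
    interpret L: prob_space "law l i"
      unfolding law_def by (rule prob_space_distr[OF index_vector_measurable[OF i]])
    show "emeasure (law l i) (space ?P) \<noteq> \<infinity>" by simp
  qed (auto simp: law_def)
qed

text \<open>A gap longer than \<open>m + 1\<close> can be shortened by one without changing the law: both before and
  after, the two parts of the vector are independent, and each part keeps its law by stationarity.\<close>

lemma law_shorten_gap:
  assumes i: "i \<in> index_set l d n" and j: "j \<in> {1..<l}" and gap: "i j + m + 1 < i (j + 1)"
  defines "i' \<equiv> (\<lambda>q. if q \<in> {1..l} \<and> j < q then i q - 1 else i q)"
  shows "law l i = law l i'" "i' \<in> index_set l d n"
proof -
  note D = index_setD[OF i]
  have mono: "i p < i q" if "p \<in> {1..l}" "q \<in> {1..l}" "p < q" for p q
    by (rule index_set_less) (use i that in auto)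
  have ge: "i (j + 1) \<le> i q" if "q \<in> {1..l}" "j < q" for q
  proof (cases "q = j + 1")
    case False
    then show ?thesis using mono[of "j + 1" q] that by auto
  qed simp
  have big: "i j + m + 1 < i q" if "q \<in> {1..l}" "j < q" for q using gap ge[OF that] by linarith
  have small: "i q \<le> i j" if "q \<in> {1..l}" "q \<le> j" for q
    using mono[of q j] that j by (cases "q = j") auto
  have i'1: "i' q = i q" if "q \<in> {1..j}" for q using that by (auto simp: i'_def)
  have i'2: "i q = i' q + 1" "i j + m < i' q" if "q \<in> {j<..l}" for q using that big[of q] by (auto simp: i'_def)
  have split: "{1..l} = {1..j} \<union> {j<..l}" using j by auto
  show "law l i = law l i'"
  proof (rule law_eqI)
    show "1 \<le> i q" "1 \<le> i' q" if "q \<in> {1..l}" for q using D(1)[OF that] big[of q] that by (auto simp: i'_def)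
    fix U :: "nat \<Rightarrow> real set" assume U: "\<And>q. q \<in> {1..l} \<Longrightarrow> U q \<in> sets borel"
    have "prob {\<omega> \<in> space M. \<forall>q\<in>{1..j} \<union> {j<..l}. X (i q) \<omega> \<in> U q}
      = prob {\<omega> \<in> space M. \<forall>q\<in>{1..j}. X (i q) \<omega> \<in> U q} * prob {\<omega> \<in> space M. \<forall>q\<in>{j<..l}. X (i q) \<omega> \<in> U q}"
    proof (rule prob_split[where k="i j"])
      show "i q \<in> {1..i j}" if "q \<in> {1..j}" for q using that j D(1)[of q] small[of q] by auto
      show "i j + m < i q" if "q \<in> {j<..l}" for q using i'2[OF that] by simp
    qed (use U j in auto)
    moreover have "prob {\<omega> \<in> space M. \<forall>q\<in>{1..j} \<union> {j<..l}. X (i' q) \<omega> \<in> U q}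
      = prob {\<omega> \<in> space M. \<forall>q\<in>{1..j}. X (i' q) \<omega> \<in> U q} * prob {\<omega> \<in> space M. \<forall>q\<in>{j<..l}. X (i' q) \<omega> \<in> U q}"
    proof (rule prob_split[where k="i j"])
      show "i' q \<in> {1..i j}" if "q \<in> {1..j}" for q using that j D(1)[of q] small[of q] i'1[OF that] by auto
      show "i j + m < i' q" if "q \<in> {j<..l}" for q using i'2[OF that] by simp
    qed (use U j in auto)
    moreover have "prob {\<omega> \<in> space M. \<forall>q\<in>{j<..l}. X (i q) \<omega> \<in> U q} = prob {\<omega> \<in> space M. \<forall>q\<in>{j<..l}. X (i' q) \<omega> \<in> U q}"
    proof -
      have "prob {\<omega> \<in> space M. \<forall>q\<in>{j<..l}. X (i' q + 1) \<omega> \<in> U q} = prob {\<omega> \<in> space M. \<forall>q\<in>{j<..l}. X (i' q) \<omega> \<in> U q}"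
      proof (rule prob_shift)
        show "1 \<le> i' q" if "q \<in> {j<..l}" for q using i'2(2)[OF that] D(1)[of j] j by auto
      qed (use U in auto)
      then show ?thesis using i'2(1) by simp
    qed
    moreover have "prob {\<omega> \<in> space M. \<forall>q\<in>{1..j}. X (i q) \<omega> \<in> U q} = prob {\<omega> \<in> space M. \<forall>q\<in>{1..j}. X (i' q) \<omega> \<in> U q}"
      using i'1 by simp
    ultimately show "prob {\<omega> \<in> space M. \<forall>q\<in>{1..l}. X (i q) \<omega> \<in> U q} = prob {\<omega> \<in> space M. \<forall>q\<in>{1..l}. X (i' q) \<omega> \<in> U q}"
      by (simp only: split)
  qed
  show "i' \<in> index_set l d n"
    unfolding index_set_def
  proof (intro CollectI conjI ballI)
    show "i' \<in> {1..l} \<rightarrow>\<^sub>E {1..n}"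
    proof (intro PiE_I)
      show "i' q \<in> {1..n}" if "q \<in> {1..l}" for q using that D(1)[OF that] big[of q] by (auto simp: i'_def)
      show "i' q = undefined" if "q \<notin> {1..l}" for q using that D(4)[OF that] by (auto simp: i'_def)
    qed
    show "strict_mono_on {1..l} i'"
    proof (rule strict_mono_onI)
      fix p q assume pq: "p \<in> {1..l}" "q \<in> {1..l}" "p < q"
      show "i' p < i' q"
        using mono[OF pq] pq small[of p] big[of q] big[of p] by (auto simp: i'_def)
    qed
    fix q assume q: "q \<in> {1..l - 1}"
    have "i' (q + 1) - i' q \<le> i (q + 1) - i q"
      using q mono[of q "q + 1"] big[of q] by (auto simp: i'_def)
    then have "enat (i' (q + 1) - i' q) \<le> enat (i (q + 1) - i q)" by simp
    also have "\<dots> \<le> d q" by (rule D(3)[OF q])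
    finally show "enat (i' (q + 1) - i' q) \<le> d q" .
  qed
qed

lemma law_shift_all:
  assumes i: "i \<in> index_set l d n" and l: "1 \<le> l" and gap: "1 < i 1"
  defines "i' \<equiv> (\<lambda>q. if q \<in> {1..l} then i q - 1 else i q)"
  shows "law l i = law l i'" "i' \<in> index_set l d n"
proof -
  note D = index_setD[OF i]
  have mono: "i p < i q" if "p \<in> {1..l}" "q \<in> {1..l}" "p < q" for p q
    by (rule index_set_less) (use i that in auto)
  have ge: "1 < i q" if "q \<in> {1..l}" for q
    using mono[of 1 q] that gap by (cases "q = 1") auto
  have i': "i q = i' q + 1" "1 \<le> i' q" if "q \<in> {1..l}" for q using that ge[of q] by (auto simp: i'_def)
  show "law l i = law l i'"
  proof (rule law_eqI)
    show "1 \<le> i q" "1 \<le> i' q" if "q \<in> {1..l}" for q using i'[OF that] by auto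
    fix U :: "nat \<Rightarrow> real set" assume U: "\<And>q. q \<in> {1..l} \<Longrightarrow> U q \<in> sets borel"
    have "prob {\<omega> \<in> space M. \<forall>q\<in>{1..l}. X (i' q + 1) \<omega> \<in> U q} = prob {\<omega> \<in> space M. \<forall>q\<in>{1..l}. X (i' q) \<omega> \<in> U q}"
      using i' U by (intro prob_shift) auto
    then show "prob {\<omega> \<in> space M. \<forall>q\<in>{1..l}. X (i q) \<omega> \<in> U q} = prob {\<omega> \<in> space M. \<forall>q\<in>{1..l}. X (i' q) \<omega> \<in> U q}"
      using i'(1) by simp
  qed
  show "i' \<in> index_set l d n"
    unfolding index_set_def
  proof (intro CollectI conjI ballI)
    show "i' \<in> {1..l} \<rightarrow>\<^sub>E {1..n}"
    proof (intro PiE_I)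
      show "i' q \<in> {1..n}" if "q \<in> {1..l}" for q using that D(1)[OF that] ge[of q] by (auto simp: i'_def)
      show "i' q = undefined" if "q \<notin> {1..l}" for q using that D(4)[OF that] by (auto simp: i'_def)
    qed
    show "strict_mono_on {1..l} i'"
    proof (rule strict_mono_onI)
      fix p q assume pq: "p \<in> {1..l}" "q \<in> {1..l}" "p < q"
      show "i' p < i' q" using mono[OF pq] pq ge[of p] ge[of q] by (auto simp: i'_def)
    qed
    fix q assume q: "q \<in> {1..l - 1}"
    have "i' (q + 1) - i' q = i (q + 1) - i q" using q ge[of q] by (auto simp: i'_def)
    then show "enat (i' (q + 1) - i' q) \<le> d q" using D(3)[OF q] by simp
  qed
qed

text \<open>If the first index and all gaps are at most \<open>m + 1\<close>, then so is the last index divided by \<open>l\<close>. Otherwise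
  the vector can be shifted or one of its gaps shortened.\<close>

lemma law_reduce:
  assumes l: "1 \<le> l" and "i \<in> index_set l d n"
  shows "\<exists>i0\<in>index_set l d (l * (m + 1)). law l i = law l i0"
  using assms(2)
proof (induction "i l" arbitrary: i rule: less_induct)
  case less
  note D = index_setD[OF less.prems]
  have mono: "i p < i q" if "p \<in> {1..l}" "q \<in> {1..l}" "p < q" for p q
    by (rule index_set_less) (use less.prems that in auto)
  consider "i l \<le> l * (m + 1)" | "1 < i 1" | j where "j \<in> {1..<l}" "i j + m + 1 < i (j + 1)"
  proof -
    have "i l \<le> l * (m + 1)" if "\<not> 1 < i 1" and no: "\<And>j. j \<in> {1..<l} \<Longrightarrow> \<not> i j + m + 1 < i (j + 1)"
    proof -
      have "q \<le> l \<Longrightarrow> i q \<le> q * (m + 1)" if "1 \<le> q" for q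
        using that
      proof (induction q rule: dec_induct)
        case base
        then show ?case using \<open>\<not> 1 < i 1\<close> by simp
      next
        case (step q)
        then show ?case using no[of q] by simp
      qed
      then show ?thesis using l by simp
    qed
    then show ?thesis using that by blast
  qed
  then show ?case
  proof cases
    case 1
    have "i j \<le> l * (m + 1)" if "j \<in> {1..l}" for j
      using 1 mono[of j l] that l by (cases "j = l") auto
    then have "i \<in> index_set l d (l * (m + 1))"
      using less.prems by (auto simp: index_set_def PiE_def Pi_def)
    then show ?thesis by blast
  next
    case 2
    note s = law_shift_all[OF less.prems l 2]
    have "1 \<le> i l" using D(1)[of l] l by simp
    then show ?thesis using less.hyps[OF _ s(2)] s(1) l by auto
  next
    case (3 j)
    note s = law_shorten_gap[OF less.prems 3]
    have "1 \<le> i l" using D(1)[of l] l by simp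
    then show ?thesis using less.hyps[OF _ s(2)] s(1) l 3 by auto
  qed
qed

end

subsection \<open>Counting index vectors\<close>

lemma index_set_eqI:
  assumes k: "k \<in> index_set l d n" and k': "k' \<in> index_set l d n"
    and gaps: "\<And>j. j \<in> {1..l - 1} \<Longrightarrow> k (j + 1) - k j = k' (j + 1) - k' j"
    and q: "q \<in> {1..l}" "k q = k' q"
  shows "k = k'"
proof
  fix j
  have mono: "k j < k (j + 1)" "k' j < k' (j + 1)" if "j \<in> {1..l - 1}" for j
    using index_set_less_Suc[OF k that] index_set_less_Suc[OF k' that] .
  show "k j = k' j"
  proof (cases "j \<in> {1..l}")
    case True
    show ?thesis
    proof (cases "q \<le> j")
      case qj: True
      then have "j \<le> l \<longrightarrow> k j = k' j"
      proof (induction j rule: dec_induct)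
        case (step j)
        show ?case
        proof
          assume "Suc j \<le> l"
          then have j: "j \<in> {1..l - 1}" "k j = k' j" using step q(1) by auto
          show "k (Suc j) = k' (Suc j)" using gaps[OF j(1)] mono[OF j(1)] j(2) by simp
        qed
      qed (use q in simp)
      then show ?thesis using True by simp
    next
      case False
      then have "j \<le> q" by simp
      then have "1 \<le> j \<longrightarrow> k j = k' j"
      proof (induction j rule: inc_induct)
        case (step j)
        show ?case
        proof
          assume "1 \<le> j"
          then have j: "j \<in> {1..l - 1}" "k (j + 1) = k' (j + 1)" using step q(1) by auto
          show "k j = k' j" using gaps[OF j(1)] mono[OF j(1)] j(2) by simp
        qed
      qed (use q in simp)
      then show ?thesis using True by simp
    qed
  next
    case False
    then show ?thesis using index_setD(4)[OF k] index_setD(4)[OF k'] by simp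
  qed
qed

definition bounded_gaps :: "nat \<Rightarrow> (nat \<Rightarrow> enat) \<Rightarrow> nat" where
  "bounded_gaps l d = (\<Prod>j\<in>{j \<in> {1..l - 1}. d j < \<infinity>}. the_enat (d j))"

text \<open>A vector is determined by one coordinate and its gaps. A bounded gap has boundedly many values,
  and there are \<open>block_number l d - 1\<close> unbounded ones.\<close>

lemma card_index_set_fixed:
  assumes l: "1 \<le> l" and q: "q \<in> {1..l}" and n: "1 \<le> n"
  shows "card {k \<in> index_set l d n. k q = v} \<le> bounded_gaps l d * n ^ (block_number l d - 1)"
proof -
  let ?G = "\<lambda>j. if d j < \<infinity> then {1..the_enat (d j)} else {1..n}"
  let ?g = "\<lambda>k. \<lambda>j\<in>{1..l - 1}. k (j + 1) - k j"
  have inj: "inj_on ?g {k \<in> index_set l d n. k q = v}"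
  proof (rule inj_onI)
    fix k k' assume kk: "k \<in> {k \<in> index_set l d n. k q = v}" "k' \<in> {k \<in> index_set l d n. k q = v}" and eq: "?g k = ?g k'"
    have "k (j + 1) - k j = k' (j + 1) - k' j" if "j \<in> {1..l - 1}" for j
      using fun_cong[OF eq, of j] that by simp
    then show "k = k'" using kk q by (intro index_set_eqI) auto
  qed
  have img: "?g ` {k \<in> index_set l d n. k q = v} \<subseteq> Pi\<^sub>E {1..l - 1} ?G"
  proof
    fix g assume "g \<in> ?g ` {k \<in> index_set l d n. k q = v}"
    then obtain k where k: "k \<in> index_set l d n" "g = ?g k" by auto
    note D = index_setD[OF k(1)]
    have "k (j + 1) - k j \<in> ?G j" if j: "j \<in> {1..l - 1}" for j
    proof -
      have lt: "k j < k (j + 1)" by (rule index_set_less_Suc[OF k(1) j])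
      have "j + 1 \<in> {1..l}" using j by auto
      note D(1)[OF this] D(3)[OF j]
      then show ?thesis using lt by (cases "d j") auto
    qed
    then show "g \<in> Pi\<^sub>E {1..l - 1} ?G" unfolding k(2) by (intro restrict_PiE_iff[THEN iffD2]) blast
  qed
  have fin: "finite (Pi\<^sub>E {1..l - 1} ?G)" by (intro finite_PiE) auto
  have "card {k \<in> index_set l d n. k q = v} \<le> card (Pi\<^sub>E {1..l - 1} ?G)"
    by (rule card_inj_on_le[OF inj img fin])
  also have "\<dots> = (\<Prod>j\<in>{1..l - 1}. if d j < \<infinity> then the_enat (d j) else n)"
    by (subst card_PiE) (auto intro!: prod.cong)
  also have "\<dots> = bounded_gaps l d * (\<Prod>j\<in>{j \<in> {1..l - 1}. \<not> d j < \<infinity>}. n)"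
    by (simp add: prod.If_cases bounded_gaps_def Int_def)
  also have "(\<Prod>j\<in>{j \<in> {1..l - 1}. \<not> d j < \<infinity>}. n) = n ^ (block_number l d - 1)"
  proof -
    have "{j \<in> {1..l - 1}. \<not> d j < \<infinity>} = {1..l - 1} - {j \<in> {1..l - 1}. d j < \<infinity>}" by auto
    then have "card {j \<in> {1..l - 1}. \<not> d j < \<infinity>} = card ({1..l - 1} - {j \<in> {1..l - 1}. d j < \<infinity>})" by simp
    also have "\<dots> = (l - 1) - card {j \<in> {1..l - 1}. d j < \<infinity>}"
    proof (subst card_Diff_subset)
      show "{j \<in> {1..l - 1}. d j < \<infinity>} \<subseteq> {1..l - 1}" by blast
    qed auto
    also have "\<dots> = block_number l d - 1" by (simp add: block_number_def)
    finally show ?thesis by simp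
  qed
  finally show ?thesis .
qed

lemma block_number_pos: "1 \<le> l \<Longrightarrow> 1 \<le> block_number l d"
proof -
  assume l: "1 \<le> l"
  have "card {k \<in> {1..l - 1}. d k < \<infinity>} \<le> card {1..l - 1}" by (rule card_mono) auto
  then show ?thesis using l by (simp add: block_number_def)
qed

lemma card_index_set:
  assumes l: "1 \<le> l" and n: "1 \<le> n"
  shows "card (index_set l d n) \<le> bounded_gaps l d * n ^ block_number l d"
proof -
  have "index_set l d n \<subseteq> (\<Union>v\<in>{1..n}. {k \<in> index_set l d n. k 1 = v})"
    using index_setD(1)[of _ l d n 1] l by auto
  then have "card (index_set l d n) \<le> card (\<Union>v\<in>{1..n}. {k \<in> index_set l d n. k 1 = v})"
    by (intro card_mono) (auto intro: finite_subset[OF _ finite_index_set])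
  also have "\<dots> \<le> (\<Sum>v\<in>{1..n}. card {k \<in> index_set l d n. k 1 = v})" by (rule card_UN_le) simp
  also have "\<dots> \<le> (\<Sum>v\<in>{1..n}. bounded_gaps l d * n ^ (block_number l d - 1))"
    using assms by (intro sum_mono card_index_set_fixed) auto
  also have "\<dots> = bounded_gaps l d * n ^ block_number l d"
    using block_number_pos[OF l, of d] by (simp add: power_eq_if)
  finally show ?thesis .
qed

lemma index_dist_le_iff:
  assumes "1 \<le> l"
  shows "index_dist l i k \<le> int m \<longleftrightarrow> (\<exists>p\<in>supp l i. \<exists>q\<in>supp l k. \<bar>int p - int q\<bar> \<le> int m)"
proof -
  have "finite (supp l i \<times> supp l k)" "supp l i \<times> supp l k \<noteq> {}" using assms by (auto simp: supp_def)
  then show ?thesis unfolding index_dist_def by (subst Min_le_iff) auto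
qed

lemma nbhd_iff:
  assumes "1 \<le> l"
  shows "k \<in> nbhd m l d n i \<longleftrightarrow> k \<in> index_set l d n \<and> (\<exists>p\<in>supp l i. \<exists>q\<in>supp l k. \<bar>int p - int q\<bar> \<le> int m)"
  unfolding nbhd_def A1_def A2_def using index_dist_le_iff[OF assms, of i k m] by force

lemma card_nbhd:
  assumes l: "1 \<le> l" and n: "1 \<le> n"
  shows "card (nbhd m l d n i) \<le> l * (l * ((2 * m + 1) * (bounded_gaps l d * n ^ (block_number l d - 1))))"
proof -
  let ?K = "\<lambda>q v. {k \<in> index_set l d n. k q = v}"
  have fK: "finite (?K q v)" for q v by (rule finite_subset[OF _ finite_index_set]) auto
  have "nbhd m l d n i \<subseteq> (\<Union>p\<in>supp l i. \<Union>q\<in>{1..l}. \<Union>v\<in>{p - m..p + m}. ?K q v)"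
  proof
    fix k assume "k \<in> nbhd m l d n i"
    then obtain p q' where k': "k \<in> index_set l d n" "p \<in> supp l i" "q' \<in> supp l k" "\<bar>int p - int q'\<bar> \<le> int m"
      unfolding nbhd_iff[OF l] by blast
    then obtain q where "q \<in> {1..l}" "q' = k q" unfolding supp_def by blast
    with k' have k: "k \<in> index_set l d n" "p \<in> supp l i" "q \<in> {1..l}" "\<bar>int p - int (k q)\<bar> \<le> int m" by auto
    then have "k q \<in> {p - m..p + m}" by auto
    with k show "k \<in> (\<Union>p\<in>supp l i. \<Union>q\<in>{1..l}. \<Union>v\<in>{p - m..p + m}. ?K q v)" by blast
  qed
  then have "card (nbhd m l d n i) \<le> card (\<Union>p\<in>supp l i. \<Union>q\<in>{1..l}. \<Union>v\<in>{p - m..p + m}. ?K q v)"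
    using fK by (intro card_mono) (auto simp: supp_def)
  also have "\<dots> \<le> (\<Sum>p\<in>supp l i. \<Sum>q\<in>{1..l}. \<Sum>v\<in>{p - m..p + m}. card (?K q v))"
    by (intro order_trans[OF card_UN_le] sum_mono order_refl) (auto simp: supp_def)
  also have "\<dots> \<le> (\<Sum>p\<in>supp l i. \<Sum>q\<in>{1..l}. \<Sum>v\<in>{p - m..p + m}. bounded_gaps l d * n ^ (block_number l d - 1))"
    using assms by (intro sum_mono card_index_set_fixed) auto
  also have "\<dots> \<le> (\<Sum>p\<in>supp l i. \<Sum>q\<in>{1..l}. (2 * m + 1) * (bounded_gaps l d * n ^ (block_number l d - 1)))"
  proof (intro sum_mono)
    fix p
    have "card {p - m..p + m} \<le> 2 * m + 1" by auto
    then have "card {p - m..p + m} * (bounded_gaps l d * n ^ (block_number l d - 1)) \<le> (2 * m + 1) * (bounded_gaps l d * n ^ (block_number l d - 1))"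
      by (rule mult_right_mono) simp
    then show "(\<Sum>v\<in>{p - m..p + m}. bounded_gaps l d * n ^ (block_number l d - 1)) \<le> (2 * m + 1) * (bounded_gaps l d * n ^ (block_number l d - 1))"
      by simp
  qed
  also have "\<dots> = card (supp l i) * (l * ((2 * m + 1) * (bounded_gaps l d * n ^ (block_number l d - 1))))" by simp
  also have "\<dots> \<le> l * (l * ((2 * m + 1) * (bounded_gaps l d * n ^ (block_number l d - 1))))"
    using card_image_le[of "{1..l}" i] by (intro mult_right_mono) (auto simp: supp_def)
  finally show ?thesis .
qed


section \<open>Application to constrained U-statistics\<close>

lemma (in prob_space) Lp_norm_2_sq:
  "(Lp_norm M 2 Y)\<^sup>2 = expectation (\<lambda>\<omega>. (Y \<omega>)\<^sup>2)"
proof -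
  have "0 \<le> expectation (\<lambda>\<omega>. (Y \<omega>)\<^sup>2)" by simp
  then show ?thesis by (simp add: Lp_norm_def powr_half_sqrt)
qed

lemma (in prob_space) Lp_norm_4_power4:
  "Lp_norm M 4 Y ^ 4 = expectation (\<lambda>\<omega>. \<bar>Y \<omega>\<bar> ^ 4)"
proof -
  have "0 \<le> expectation (\<lambda>\<omega>. \<bar>Y \<omega>\<bar> ^ 4)" by simp
  moreover have "(x powr (1/4)) ^ 4 = x" if "0 \<le> x" for x :: real
    using that by (cases "x = 0") (auto simp: powr_power)
  ultimately show ?thesis by (simp add: Lp_norm_def)
qed

lemma Lp_norm_nonneg: "0 \<le> Lp_norm M p Y"
  by (simp add: Lp_norm_def)

locale constrained_U_statistic = stationary_m_dependent M X m
  for M :: "'a measure" and X :: "nat \<Rightarrow> 'a \<Rightarrow> real" and m :: nat +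
  fixes l :: nat and d :: "nat \<Rightarrow> enat" and f :: "(nat \<Rightarrow> real) \<Rightarrow> real" and \<sigma> :: real
  assumes l: "1 \<le> l"
    and d: "\<And>j. j \<in> {1..l - 1} \<Longrightarrow> d j \<ge> 1"
    and f_meas: "f \<in> borel_measurable (Pi\<^sub>M {1..l} (\<lambda>_. borel))"
    and int4: "\<And>n i. i \<in> index_set l d n \<Longrightarrow> integrable M (\<lambda>\<omega>. \<bar>fI l f X i \<omega>\<bar> ^ 4)"
    and sigma_pos: "\<sigma> > 0"
    and var_lim: "(\<lambda>n. variance (U_stat l d f X n) / real n ^ (2 * block_number l d - 1)) \<longlonglongrightarrow> \<sigma>\<^sup>2"
begin

abbreviation b :: nat where "b \<equiv> block_number l d"
abbreviation J :: "nat \<Rightarrow> (nat \<Rightarrow> nat) set" where "J n \<equiv> index_set l d n"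
abbreviation ff :: "(nat \<Rightarrow> nat) \<Rightarrow> 'a \<Rightarrow> real" where "ff i \<equiv> fI l f X i"
abbreviation Z :: "(nat \<Rightarrow> nat) \<Rightarrow> 'a \<Rightarrow> real" where "Z i \<equiv> ZI M l f X i"
definition var_U :: "nat \<Rightarrow> real" where "var_U n = variance (U_stat l d f X n)"

text \<open>\<open>K4\<close> bounds all \<open>L\<^sup>4\<close> norms; \<open>KI * n ^ b\<close> and \<open>KD * n ^ (b - 1)\<close> bound the number of index vectors and
  the size of a neighbourhood. \<open>KB\<close> below is the resulting value of \<open>B\<close>.\<close>

definition K4 :: real where
  "K4 = 1 + (\<Sum>i\<in>J (l * (m + 1)). expectation (\<lambda>\<omega>. \<bar>ff i \<omega>\<bar> ^ 4))"
definition KD :: real where "KD = real (l * (l * ((2 * m + 1) * bounded_gaps l d)))"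
definition KI :: real where "KI = real (bounded_gaps l d)"

lemma index_pos: "i \<in> J n \<Longrightarrow> j \<in> {1..l} \<Longrightarrow> 1 \<le> i j"
  using index_setD(1) by fastforce

lemma supp_fin: "finite (supp l i)" and supp_pos: "i \<in> J n \<Longrightarrow> 0 \<notin> supp l i"
  using index_pos[of i n] by (fastforce simp: supp_def)+

lemma ff_measurable_F: "i \<in> J n \<Longrightarrow> supp l i \<subseteq> P \<Longrightarrow> ff i \<in> borel_measurable (F_pos P)"
proof -
  assume P: "supp l i \<subseteq> P"
  have "(\<lambda>\<omega>. \<lambda>j\<in>{1..l}. X (i j) \<omega>) \<in> measurable (F_pos P) (Pi\<^sub>M {1..l} (\<lambda>_. borel))"
    using P by (intro measurable_restrict X_measurable_F_pos) (auto simp: supp_def)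
  from measurable_compose[OF this f_meas] show ?thesis by (simp add: fI_def[abs_def])
qed

lemma ff_measurable: "i \<in> J n \<Longrightarrow> ff i \<in> borel_measurable M"
  using measurable_from_subalg[OF subalgebra_F_pos[OF supp_fin supp_pos] ff_measurable_F[OF _ order_refl]] by blast

lemma moment4_law:
  assumes "i \<in> J n"
  shows "expectation (\<lambda>\<omega>. \<bar>ff i \<omega>\<bar> ^ 4) = integral\<^sup>L (law l i) (\<lambda>x. \<bar>f x\<bar> ^ 4)"
  unfolding law_def fI_def
  by (rule integral_distr[symmetric, OF index_vector_measurable[OF index_pos[OF assms]]]) (use f_meas in measurable)

lemma K4_ge_1: "1 \<le> K4"
  unfolding K4_def by (simp add: sum_nonneg)

text \<open>By stationarity and m-dependence the variables \<open>f_i\<close> have only finitely many laws.\<close>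

lemma ff_L4:
  assumes i: "i \<in> J n"
  shows "Lp_le 4 (ff i) K4"
proof -
  obtain i0 where i0: "i0 \<in> J (l * (m + 1))" "law l i = law l i0"
    using law_reduce[OF l i] by blast
  have "expectation (\<lambda>\<omega>. \<bar>ff i \<omega>\<bar> ^ 4) = expectation (\<lambda>\<omega>. \<bar>ff i0 \<omega>\<bar> ^ 4)"
    unfolding moment4_law[OF i] moment4_law[OF i0(1)] i0(2) ..
  also have "\<dots> \<le> (\<Sum>i\<in>J (l * (m + 1)). expectation (\<lambda>\<omega>. \<bar>ff i \<omega>\<bar> ^ 4))"
    by (rule member_le_sum[OF i0(1)]) (auto simp: finite_index_set)
  also have "\<dots> \<le> K4" by (simp add: K4_def)
  also have "\<dots> \<le> K4 ^ 4" using K4_ge_1 by (intro self_le_power) auto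
  finally show ?thesis using int4[OF i] ff_measurable[OF i] K4_ge_1 by (simp add: Lp_le_def)
qed

lemma Z_eq: "Z i \<omega> = ff i \<omega> - expectation (ff i)"
  by (simp add: ZI_def)

lemma Z_L4: "i \<in> J n \<Longrightarrow> Lp_le 4 (Z i) (2 * K4)"
proof -
  assume i: "i \<in> J n"
  have "\<bar>expectation (ff i)\<bar> \<le> K4" by (rule Lp_le_1D(3)[OF Lp_le_1_of_2[OF Lp_le_2_of_4[OF ff_L4[OF i]]]])
  from Lp_le_diff[OF ff_L4[OF i] Lp_le_bound_mono[OF Lp_le_const this]]
  show ?thesis by (simp add: Z_eq[abs_def])
qed

lemma ff_integrable: "i \<in> J n \<Longrightarrow> integrable M (ff i)"
  by (rule Lp_le_1D(1)[OF Lp_le_1_of_2[OF Lp_le_2_of_4[OF ff_L4]]])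

lemma U_centered: "U_stat l d f X n \<omega> - expectation (U_stat l d f X n) = (\<Sum>i\<in>J n. Z i \<omega>)"
  using ff_integrable[of _ n] by (simp add: U_stat_def[abs_def] Z_eq sum_subtractf)

lemma var_U_eq: "var_U n = expectation (\<lambda>\<omega>. (\<Sum>i\<in>J n. Z i \<omega>)\<^sup>2)"
  by (simp add: var_U_def U_centered)

lemma Z_second_moment: "i \<in> J n \<Longrightarrow> expectation (\<lambda>\<omega>. (Z i \<omega>)\<^sup>2) \<le> (Lp_norm M 2 (ff i))\<^sup>2"
proof -
  assume i: "i \<in> J n"
  note L = Lp_le_2D(1)[OF Lp_le_2_of_4[OF ff_L4[OF i]]]
  have "expectation (\<lambda>\<omega>. (Z i \<omega>)\<^sup>2) = expectation (\<lambda>\<omega>. (ff i \<omega>)\<^sup>2) - (expectation (ff i))\<^sup>2"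
    unfolding Z_eq by (rule variance_eq[OF ff_integrable[OF i] L])
  then show ?thesis by (simp add: Lp_norm_2_sq)
qed

lemma KI_ge_1: "1 \<le> KI"
proof -
  have "1 \<le> bounded_gaps l d"
    unfolding bounded_gaps_def
  proof (rule prod_ge_1)
    fix j assume "j \<in> {j \<in> {1..l - 1}. d j < \<infinity>}"
    then show "1 \<le> the_enat (d j)" using d[of j] by (cases "d j") (auto simp: one_enat_def)
  qed
  then show ?thesis by (simp add: KI_def)
qed

lemma KD_ge_1: "1 \<le> KD"
proof -
  have "1 \<le> bounded_gaps l d" using KI_ge_1 by (simp add: KI_def)
  then have "1 * (1 * (1 * 1)) \<le> l * (l * ((2 * m + 1) * bounded_gaps l d))" using l by (intro mult_le_mono) auto
  then have "real 1 \<le> real (l * (l * ((2 * m + 1) * bounded_gaps l d)))" by (intro of_nat_mono) simp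
  then show ?thesis by (simp add: KD_def)
qed

lemma card_J: "1 \<le> n \<Longrightarrow> real (card (J n)) \<le> KI * real n ^ b"
proof -
  assume n: "1 \<le> n"
  have "real (card (J n)) \<le> real (bounded_gaps l d * n ^ b)" by (rule of_nat_mono[OF card_index_set[OF l n]])
  then show ?thesis by (simp add: KI_def)
qed

lemma card_nbhd_le: "1 \<le> n \<Longrightarrow> real (card (nbhd m l d n i)) \<le> KD * real n ^ (b - 1)"
proof -
  assume n: "1 \<le> n"
  have "real (card (nbhd m l d n i)) \<le> real (l * (l * ((2 * m + 1) * (bounded_gaps l d * n ^ (b - 1)))))"
    by (rule of_nat_mono[OF card_nbhd[OF l n]])
  also have "\<dots> = KD * real n ^ (b - 1)" by (simp only: KD_def of_nat_mult of_nat_power mult_ac)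
  finally show ?thesis .
qed

definition KB :: real where "KB = max 1 (8 * KI * KD * K4\<^sup>2 / \<sigma>\<^sup>2)"

definition large :: "nat \<Rightarrow> bool" where
  "large n \<longleftrightarrow> 1 \<le> n \<and> \<sigma>\<^sup>2 / 2 * real n ^ (2 * b - 1) \<le> var_U n \<and> KD * real n ^ (b - 1) * (2 * K4 / sqrt (var_U n)) \<le> 1"

lemma power_2b: "real n ^ (2 * b - 1) = real n ^ (b - 1) * real n ^ b" "real n ^ b = real n ^ (b - 1) * real n"
proof -
  have "1 \<le> b" by (rule block_number_pos[OF l])
  then have "2 * b - 1 = (b - 1) + b" "b = (b - 1) + 1" by auto
  then show "real n ^ (2 * b - 1) = real n ^ (b - 1) * real n ^ b" "real n ^ b = real n ^ (b - 1) * real n"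
    by (metis power_add) (metis \<open>b = (b - 1) + 1\<close> power_add power_one_right)
qed

lemma large_var_pos: "large n \<Longrightarrow> 0 < var_U n"
proof -
  assume L: "large n"
  have "0 < \<sigma>\<^sup>2 / 2 * real n ^ (2 * b - 1)" using L sigma_pos by (simp add: large_def)
  then show ?thesis using L unfolding large_def by linarith
qed

lemma local_dependence_U:
  assumes L: "large n"
  shows "local_dependence M (J n) (nbhd m l d n) (\<lambda>S. F_pos (\<Union>i\<in>S. supp l i)) (\<lambda>i \<omega>. Z i \<omega> / sqrt (var_U n))
    (KD * real n ^ (b - 1)) (2 * K4 / sqrt (var_U n)) KB"
proof
  have n: "1 \<le> n" and vL: "\<sigma>\<^sup>2 / 2 * real n ^ (2 * b - 1) \<le> var_U n" using L by (auto simp: large_def)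
  have v: "0 < var_U n" by (rule large_var_pos[OF L])
  have n0: "0 < real n" using n by simp
  show "finite (J n)" by (rule finite_index_set)
  show "nbhd m l d n i \<subseteq> J n" for i unfolding nbhd_def A1_def A2_def by auto
  show "i \<in> nbhd m l d n k" if ik: "i \<in> J n" "k \<in> nbhd m l d n i" for i k
  proof -
    obtain p q where "k \<in> J n" "p \<in> supp l i" "q \<in> supp l k" "\<bar>int p - int q\<bar> \<le> int m"
      using ik(2) unfolding nbhd_iff[OF l] by blast
    moreover have "\<bar>int q - int p\<bar> = \<bar>int p - int q\<bar>" by (rule abs_minus_commute)
    ultimately have "\<exists>q\<in>supp l k. \<exists>p\<in>supp l i. \<bar>int q - int p\<bar> \<le> int m" by (intro bexI) auto
    then show ?thesis using ik(1) unfolding nbhd_iff[OF l] by blast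
  qed
  show "real (card (nbhd m l d n i)) \<le> KD * real n ^ (b - 1)" for i by (rule card_nbhd_le[OF n])
  have fin: "finite (\<Union>i\<in>S. supp l i)" "0 \<notin> (\<Union>i\<in>S. supp l i)" if "S \<subseteq> J n" for S
    using that supp_fin supp_pos finite_subset[OF that finite_index_set] by auto
  show "subalgebra M (F_pos (\<Union>i\<in>S. supp l i))" if "S \<subseteq> J n" for S
    by (rule subalgebra_F_pos[OF fin[OF that]])
  show "sets (F_pos (\<Union>i\<in>S. supp l i)) \<subseteq> sets (F_pos (\<Union>i\<in>S'. supp l i))" if "S \<subseteq> S'" for S S'
    using that by (intro F_pos_mono) auto
  show "(\<lambda>\<omega>. Z i \<omega> / sqrt (var_U n)) \<in> borel_measurable (F_pos (\<Union>i\<in>{i}. supp l i))" if "i \<in> J n" for i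
    unfolding Z_eq using ff_measurable_F[OF that, of "\<Union>i\<in>{i}. supp l i"] by measurable
  show "indep_set (sets (F_pos (\<Union>i\<in>S. supp l i))) (sets (F_pos (\<Union>i\<in>S'. supp l i)))"
    if S: "S \<subseteq> J n" "S' \<subseteq> J n" and A: "\<And>s. s \<in> S \<Longrightarrow> nbhd m l d n s \<inter> S' = {}" for S S'
  proof (rule indep_F_pos[OF fin(1)[OF S(1)] fin(1)[OF S(2)] fin(2)[OF S(1)] fin(2)[OF S(2)]])
    show "separated (\<Union>i\<in>S. supp l i) (\<Union>i\<in>S'. supp l i)"
      unfolding separated_def
    proof (intro ballI)
      fix p q assume "p \<in> (\<Union>i\<in>S. supp l i)" "q \<in> (\<Union>i\<in>S'. supp l i)"
      then obtain i k where ik: "i \<in> S" "k \<in> S'" "p \<in> supp l i" "q \<in> supp l k" by blast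
      then have "k \<notin> nbhd m l d n i" "k \<in> J n" using A[OF ik(1)] S by auto
      then have "\<not> \<bar>int p - int q\<bar> \<le> int m" unfolding nbhd_iff[OF l] using ik by blast
      then show "p + m < q \<or> q + m < p" by linarith
    qed
  qed
  show "expectation (\<lambda>\<omega>. Z i \<omega> / sqrt (var_U n)) = 0" if "i \<in> J n" for i
    using ff_integrable[OF that] by (simp add: Z_eq prob_space)
  show "Lp_le 4 (\<lambda>\<omega>. Z i \<omega> / sqrt (var_U n)) (2 * K4 / sqrt (var_U n))" if "i \<in> J n" for i
    using Lp_le_cmult[OF Z_L4[OF that], of "1 / sqrt (var_U n)"] v by simp
  show "real (card (J n)) * (KD * real n ^ (b - 1)) * (2 * K4 / sqrt (var_U n))\<^sup>2 \<le> KB"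
  proof -
    have "(2 * K4 / sqrt (var_U n))\<^sup>2 = 4 * K4\<^sup>2 / var_U n" using v by (simp add: power_divide power_mult_distrib)
    also have "\<dots> \<le> 4 * K4\<^sup>2 / (\<sigma>\<^sup>2 / 2 * real n ^ (2 * b - 1))"
      using vL v sigma_pos n0 by (intro divide_left_mono mult_pos_pos) auto
    finally have 1: "(2 * K4 / sqrt (var_U n))\<^sup>2 \<le> 4 * K4\<^sup>2 / (\<sigma>\<^sup>2 / 2 * real n ^ (2 * b - 1))" .
    have "real (card (J n)) * (KD * real n ^ (b - 1)) * (2 * K4 / sqrt (var_U n))\<^sup>2
      \<le> (KI * real n ^ b) * (KD * real n ^ (b - 1)) * (4 * K4\<^sup>2 / (\<sigma>\<^sup>2 / 2 * real n ^ (2 * b - 1)))"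
      using 1 card_J[OF n] KD_ge_1 KI_ge_1 n0 by (intro mult_mono mult_nonneg_nonneg) auto
    also have "\<dots> = 8 * KI * KD * K4\<^sup>2 / \<sigma>\<^sup>2"
      unfolding power_2b(1) using n0 sigma_pos by (simp add: field_simps)
    also have "\<dots> \<le> KB" by (simp add: KB_def)
    finally show ?thesis .
  qed
  show "1 \<le> KB" by (simp add: KB_def)
  show "0 < 2 * K4 / sqrt (var_U n)" using K4_ge_1 v by simp
  show "0 < KD * real n ^ (b - 1)" using KD_ge_1 n0 by simp
  show "KD * real n ^ (b - 1) * (2 * K4 / sqrt (var_U n)) \<le> 1" using L by (simp add: large_def)
  show "expectation (\<lambda>\<omega>. (\<Sum>i\<in>J n. Z i \<omega> / sqrt (var_U n))\<^sup>2) = 1"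
    using v by (simp add: sum_divide_distrib[symmetric] power_divide var_U_eq[symmetric])
qed

lemma delta_le:
  assumes n: "1 \<le> n" and vL: "\<sigma>\<^sup>2 / 2 * real n ^ (2 * b - 1) \<le> var_U n"
  shows "KD * real n ^ (b - 1) * (2 * K4 / sqrt (var_U n)) \<le> 3 * KD * K4 / \<sigma> * real n powr (-1/2)"
proof (rule power2_le_imp_le)
  have n0: "0 < real n" using n by simp
  have p: "0 < \<sigma>\<^sup>2 / 2 * real n ^ (2 * b - 1)" using n0 sigma_pos by simp
  have v: "0 < var_U n" using p vL by linarith
  have "(KD * real n ^ (b - 1) * (2 * K4 / sqrt (var_U n)))\<^sup>2 = (KD * real n ^ (b - 1) * (2 * K4))\<^sup>2 / var_U n"
    using v by (simp add: power_divide power_mult_distrib)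
  also have "\<dots> \<le> (KD * real n ^ (b - 1) * (2 * K4))\<^sup>2 / (\<sigma>\<^sup>2 / 2 * real n ^ (2 * b - 1))"
    by (intro divide_left_mono vL mult_pos_pos v p zero_le_power2)
  also have "\<dots> = 8 * (KD\<^sup>2 * K4\<^sup>2 / \<sigma>\<^sup>2 / real n)"
    unfolding power_2b using n0 sigma_pos by (simp add: field_simps power2_eq_square)
  also have "\<dots> \<le> 9 * (KD\<^sup>2 * K4\<^sup>2 / \<sigma>\<^sup>2 / real n)" using n0 by (intro mult_right_mono) auto
  also have "\<dots> = (3 * KD * K4 / \<sigma> * real n powr (-1/2))\<^sup>2"
  proof -
    have "(real n powr (-1/2))\<^sup>2 = 1 / real n"
      using n0 powr_half_sqrt[of "real n"] by (simp add: powr_minus_divide power_divide)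
    then show ?thesis by (simp add: power_mult_distrib power_divide mult_ac)
  qed
  finally show "(KD * real n ^ (b - 1) * (2 * K4 / sqrt (var_U n)))\<^sup>2 \<le> (3 * KD * K4 / \<sigma> * real n powr (-1/2))\<^sup>2" .
  show "0 \<le> 3 * KD * K4 / \<sigma> * real n powr (-1/2)" using KD_ge_1 K4_ge_1 sigma_pos by simp
qed

lemma eventually_large: "eventually large sequentially"
proof -
  have "\<sigma>\<^sup>2 / 2 < \<sigma>\<^sup>2" using sigma_pos by simp
  from order_tendstoD(1)[OF var_lim[folded var_U_def] this]
  have 1: "\<forall>\<^sub>F n in sequentially. \<sigma>\<^sup>2 / 2 < var_U n / real n ^ (2 * b - 1)" .
  have "((\<lambda>n. 3 * KD * K4 / \<sigma> * real n powr (-1/2)) \<longlongrightarrow> 3 * KD * K4 / \<sigma> * 0) sequentially"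
    by (intro tendsto_mult tendsto_const tendsto_neg_powr filterlim_real_sequentially) simp
  then have 2: "\<forall>\<^sub>F n in sequentially. 3 * KD * K4 / \<sigma> * real n powr (-1/2) < 1"
    by (rule order_tendstoD(2)) simp
  show ?thesis
    using 1 2 eventually_ge_at_top[of 1]
  proof eventually_elim
    case (elim n)
    then have n0: "0 < real n ^ (2 * b - 1)" by simp
    have v: "\<sigma>\<^sup>2 / 2 * real n ^ (2 * b - 1) \<le> var_U n" using elim(1) n0 by (simp add: less_divide_eq)
    from delta_le[OF elim(3) v] elim v show ?case by (simp add: large_def)
  qed
qed

subsection \<open>The two statistics\<close>

lemma W1_eq: "W1 M l d f X n \<omega> = (\<Sum>i\<in>J n. Z i \<omega> / sqrt (var_U n))"
  unfolding W1_def unfolding var_U_def[symmetric] unfolding U_centered by (simp add: sum_divide_distrib)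

lemma Z_measurable [measurable]: "i \<in> J n \<Longrightarrow> Z i \<in> borel_measurable M"
  using Z_L4 Lp_leD(1) by blast

lemma nbhd_sub: "nbhd m l d n i \<subseteq> J n"
  unfolding nbhd_def A1_def A2_def by auto

lemma YI_measurable: "YI M m l d f X n i \<in> borel_measurable M"
  unfolding YI_def[abs_def] using nbhd_sub by (intro borel_measurable_sum Z_measurable) auto

lemma W2_measurable:
  assumes [measurable]: "w \<in> borel_measurable M"
  shows "W2 M m l d f X n w \<in> borel_measurable M"
proof -
  note [measurable] = YI_measurable
  have "V_stat M m l d f X n \<in> borel_measurable M"
    unfolding V_stat_def[abs_def] Zbar_def[abs_def] Ybar_def[abs_def] by measurable
  then show ?thesis unfolding W2_def[abs_def] by measurable
qed

definition C_BE :: real where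
  "C_BE = \<bar>studentized_dependence.c_BE KB (2 * KB)\<bar>
    + \<bar>studentized_dependence.c_BE KB (local_dependence.c_self KB) + 2 * (local_dependence.c_self KB)\<^sup>2\<bar>"

lemma Berry_Esseen_large:
  assumes L: "large n"
  shows "\<bar>prob {\<omega> \<in> space M. W1 M l d f X n \<omega> \<le> z} - std_normal_cdf z\<bar> \<le> C_BE * (3 * KD * K4 / \<sigma>) * real n powr (-1/2)"
    and "w \<in> borel_measurable M \<Longrightarrow>
      \<bar>prob {\<omega> \<in> space M. W2 M m l d f X n w \<omega> \<le> z} - std_normal_cdf z\<bar> \<le> C_BE * (3 * KD * K4 / \<sigma>) * real n powr (-1/2)"
proof -
  let ?s = "sqrt (var_U n)"
  interpret N: local_dependence M "J n" "nbhd m l d n" "\<lambda>S. F_pos (\<Union>i\<in>S. supp l i)" "\<lambda>i \<omega>. Z i \<omega> / ?s"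
    "KD * real n ^ (b - 1)" "2 * K4 / ?s" KB
    by (rule local_dependence_U[OF L])
  let ?\<delta> = "KD * real n ^ (b - 1) * (2 * K4 / ?s)"
  have s: "0 < ?s" using large_var_pos[OF L] by simp
  have d: "?\<delta> \<le> 3 * KD * K4 / \<sigma> * real n powr (-1/2)"
    using L by (intro delta_le) (auto simp: large_def)
  have d0: "0 < ?\<delta>" by (rule N.delta_pos)
  have le: "c * ?\<delta> \<le> C_BE * (3 * KD * K4 / \<sigma>) * real n powr (-1/2)" if c: "c \<le> C_BE" for c
  proof -
    have "c * ?\<delta> \<le> C_BE * ?\<delta>" using c d0 by (intro mult_right_mono) auto
    also have "\<dots> \<le> C_BE * (3 * KD * K4 / \<sigma> * real n powr (-1/2))"
      using d by (intro mult_left_mono) (auto simp: C_BE_def)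
    finally show ?thesis by (simp add: mult.assoc)
  qed
  have W: "N.W \<omega> = W1 M l d f X n \<omega>" for \<omega> by (simp add: N.W_def W1_eq)
  have "\<bar>prob {\<omega> \<in> space M. W1 M l d f X n \<omega> \<le> z} - std_normal_cdf z\<bar> \<le> studentized_dependence.c_BE KB (2 * KB) * ?\<delta>"
    using N.Berry_Esseen_normalized[of z] unfolding W .
  also have "\<dots> \<le> C_BE * (3 * KD * K4 / \<sigma>) * real n powr (-1/2)" by (rule le) (simp add: C_BE_def)
  finally show "\<bar>prob {\<omega> \<in> space M. W1 M l d f X n \<omega> \<le> z} - std_normal_cdf z\<bar> \<le> C_BE * (3 * KD * K4 / \<sigma>) * real n powr (-1/2)" .
  assume w: "w \<in> borel_measurable M"
  have J0: "0 < real (card (J n))" using N.one_le_card by (cases "card (J n) = 0") auto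
  have eta: "YI M m l d f X n i \<omega> = ?s * N.\<eta> i \<omega>" for i \<omega>
    using s by (simp add: YI_def N.\<eta>_def sum_divide_distrib[symmetric])
  have sumZ: "(\<Sum>i\<in>J n. Z i \<omega>) = ?s * N.W \<omega>" for \<omega>
    using s by (simp add: N.W_def sum_divide_distrib[symmetric])
  have V: "V_stat M m l d f X n \<omega> = ?s * sqrt (max (N.self_norm \<omega>) 0)" for \<omega>
  proof -
    have "(\<Sum>i\<in>J n. Z i \<omega> * YI M m l d f X n i \<omega> - Zbar M l d f X n \<omega> * Ybar M m l d f X n \<omega>)
      = (\<Sum>i\<in>J n. Z i \<omega> * (?s * N.\<eta> i \<omega>)) - (?s * N.W \<omega>) * (?s * (\<Sum>i\<in>J n. N.\<eta> i \<omega>)) / real (card (J n))"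
      unfolding Zbar_def Ybar_def eta sumZ sum_subtractf using J0 by (simp add: sum_distrib_left)
    also have "(\<Sum>i\<in>J n. Z i \<omega> * (?s * N.\<eta> i \<omega>)) = ?s\<^sup>2 * N.S \<omega>"
      
    proof -
      have "x * (t * y) = t\<^sup>2 * (x / t * y)" if "0 < t" for x y t :: real
        using that by (simp add: power2_eq_square)
      then show ?thesis unfolding N.S_eq sum_distrib_left using s by (intro sum.cong refl) blast
    qed
    also have "?s\<^sup>2 * N.S \<omega> - (?s * N.W \<omega>) * (?s * (\<Sum>i\<in>J n. N.\<eta> i \<omega>)) / real (card (J n)) = ?s\<^sup>2 * N.self_norm \<omega>"
      by (simp add: N.self_norm_def power2_eq_square right_diff_distrib)
    finally have eq: "(\<Sum>i\<in>J n. Z i \<omega> * YI M m l d f X n i \<omega> - Zbar M l d f X n \<omega> * Ybar M m l d f X n \<omega>) = ?s\<^sup>2 * N.self_norm \<omega>" .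
    have "max (?s\<^sup>2 * N.self_norm \<omega>) 0 = ?s\<^sup>2 * max (N.self_norm \<omega>) 0"
      using s by (auto simp: max_def mult_le_0_iff zero_le_mult_iff)
    then show ?thesis unfolding V_stat_def eq using s by (simp add: real_sqrt_mult)
  qed
  have "\<bar>prob {\<omega> \<in> space M. W2 M m l d f X n w \<omega> \<le> z} - std_normal_cdf z\<bar>
    \<le> (studentized_dependence.c_BE KB N.c_self + 2 * N.c_self\<^sup>2) * ?\<delta>"
  proof (rule N.Berry_Esseen_self_normalized[OF W2_measurable[OF w]])
    fix \<omega> assume "0 < N.self_norm \<omega>"
    then have "V_stat M m l d f X n \<omega> = ?s * sqrt (N.self_norm \<omega>)" "V_stat M m l d f X n \<omega> \<noteq> 0"
      using s by (auto simp: V max_def)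
    then show "W2 M m l d f X n w \<omega> = N.W \<omega> / sqrt (N.self_norm \<omega>)"
      using s by (simp add: W2_def sumZ)
  qed
  also have "\<dots> \<le> C_BE * (3 * KD * K4 / \<sigma>) * real n powr (-1/2)" by (rule le) (simp add: C_BE_def)
  finally show "\<bar>prob {\<omega> \<in> space M. W2 M m l d f X n w \<omega> \<le> z} - std_normal_cdf z\<bar> \<le> C_BE * (3 * KD * K4 / \<sigma>) * real n powr (-1/2)" .
qed

subsection \<open>Lower bounds for the rates\<close>

definition sum_sq :: "nat \<Rightarrow> real" where "sum_sq n = (\<Sum>i\<in>J n. (Lp_norm M 2 (ff i))\<^sup>2)"
definition factor :: "nat \<Rightarrow> real" where "factor n = real n powr (- real b) / \<sigma>\<^sup>2 * sum_sq n"

lemma sum_sq_nonneg: "0 \<le> sum_sq n"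
  by (simp add: sum_sq_def sum_nonneg)

lemma var_U_le: "var_U n \<le> card (J n) * sum_sq n"
proof -
  note L = Lp_le_2D(1)[OF Lp_le_2_of_4[OF Z_L4]]
  have "var_U n \<le> expectation (\<lambda>\<omega>. card (J n) * (\<Sum>i\<in>J n. (Z i \<omega>)\<^sup>2))"
    unfolding var_U_eq
  proof (rule integral_mono)
    show "integrable M (\<lambda>\<omega>. (\<Sum>i\<in>J n. Z i \<omega>)\<^sup>2)"
      by (rule Lp_le_2D(1)[OF Lp_le_sum[OF _ Lp_le_2_of_4[OF Z_L4]]]) auto
    show "integrable M (\<lambda>\<omega>. card (J n) * (\<Sum>i\<in>J n. (Z i \<omega>)\<^sup>2))" using L[of _ n] by auto
    show "(\<Sum>i\<in>J n. Z i \<omega>)\<^sup>2 \<le> card (J n) * (\<Sum>i\<in>J n. (Z i \<omega>)\<^sup>2)" for \<omega>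
      using Cauchy_Schwarz_ineq_sum[of "\<lambda>_. 1" "\<lambda>i. Z i \<omega>" "J n"] by simp
  qed
  also have "\<dots> = card (J n) * (\<Sum>i\<in>J n. expectation (\<lambda>\<omega>. (Z i \<omega>)\<^sup>2))" using L[of _ n] by simp
  also have "\<dots> \<le> card (J n) * sum_sq n"
    unfolding sum_sq_def by (intro mult_left_mono sum_mono Z_second_moment) auto
  finally show ?thesis .
qed

lemma sum_sq_le: "sum_sq n \<le> sqrt (card (J n)) * sqrt (\<Sum>i\<in>J n. Lp_norm M 4 (ff i) ^ 4)"
proof -
  have "(sum_sq n)\<^sup>2 \<le> card (J n) * (\<Sum>i\<in>J n. ((Lp_norm M 2 (ff i))\<^sup>2)\<^sup>2)"
    using Cauchy_Schwarz_ineq_sum[of "\<lambda>_. 1" "\<lambda>i. (Lp_norm M 2 (ff i))\<^sup>2" "J n"] by (simp add: sum_sq_def)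
  also have "\<dots> \<le> card (J n) * (\<Sum>i\<in>J n. Lp_norm M 4 (ff i) ^ 4)"
  proof (intro mult_left_mono sum_mono)
    fix i assume i: "i \<in> J n"
    have N: "Lp_le 4 (ff i) (Lp_norm M 4 (ff i))"
      using int4[OF i] ff_measurable[OF i] Lp_norm_nonneg by (simp add: Lp_le_def Lp_norm_4_power4)
    have "(Lp_norm M 2 (ff i))\<^sup>2 \<le> (Lp_norm M 4 (ff i))\<^sup>2"
      using Lp_le_2D(2)[OF Lp_le_2_of_4[OF N]] by (simp add: Lp_norm_2_sq)
    then have "((Lp_norm M 2 (ff i))\<^sup>2)\<^sup>2 \<le> ((Lp_norm M 4 (ff i))\<^sup>2)\<^sup>2" by (rule power_mono) simp
    then show "((Lp_norm M 2 (ff i))\<^sup>2)\<^sup>2 \<le> Lp_norm M 4 (ff i) ^ 4" by simp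
  qed auto
  finally have "sqrt ((sum_sq n)\<^sup>2) \<le> sqrt (card (J n) * (\<Sum>i\<in>J n. Lp_norm M 4 (ff i) ^ 4))"
    by (rule real_sqrt_le_mono)
  then show ?thesis using sum_sq_nonneg by (simp add: real_sqrt_mult)
qed

lemma rate_ge:
  "real n powr (- real b / 2 - 1/2) / \<sigma>\<^sup>2 * sqrt (\<Sum>i\<in>J n. Lp_norm M 4 (ff i) ^ 4) \<le> rate M l d f X \<sigma> n"
proof -
  have "0 \<le> real n powr (- real b - 1/2) / \<sigma> ^ 3 * (\<Sum>i\<in>J n. Lp_norm M 4 (ff i) ^ 3)"
    using sigma_pos by (intro mult_nonneg_nonneg sum_nonneg zero_le_power Lp_norm_nonneg) auto
  then show ?thesis by (simp add: rate_def)
qed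

lemma rate_pos:
  assumes "1 \<le> n" "0 < var_U n"
  shows "0 < rate M l d f X \<sigma> n" "0 < factor n"
proof -
  have "0 < card (J n) * sum_sq n" using var_U_le[of n] assms by linarith
  then have s: "0 < sum_sq n" by (simp add: zero_less_mult_iff)
  then show "0 < factor n" using assms sigma_pos by (simp add: factor_def)
  have "0 < sqrt (card (J n)) * sqrt (\<Sum>i\<in>J n. Lp_norm M 4 (ff i) ^ 4)" using s sum_sq_le[of n] by linarith
  then have "0 < sqrt (\<Sum>i\<in>J n. Lp_norm M 4 (ff i) ^ 4)" by (simp add: zero_less_mult_iff)
  then have "0 < real n powr (- real b / 2 - 1/2) / \<sigma>\<^sup>2 * sqrt (\<Sum>i\<in>J n. Lp_norm M 4 (ff i) ^ 4)"
    using assms sigma_pos by (intro mult_pos_pos divide_pos_pos) auto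
  then show "0 < rate M l d f X \<sigma> n" using rate_ge[of n] by linarith
qed

text \<open>Since only neighbours are correlated, the variance is at most \<open>KD * n ^ (b - 1)\<close> times the sum of the second
  moments.\<close>

lemma sum_sq_ge:
  assumes L: "large n"
  shows "\<sigma>\<^sup>2 / (2 * KD) * real n ^ b \<le> sum_sq n"
proof -
  let ?s = "sqrt (var_U n)"
  interpret N: local_dependence M "J n" "nbhd m l d n" "\<lambda>S. F_pos (\<Union>i\<in>S. supp l i)" "\<lambda>i \<omega>. Z i \<omega> / ?s"
    "KD * real n ^ (b - 1)" "2 * K4 / ?s" KB
    by (rule local_dependence_U[OF L])
  have v: "0 < var_U n" by (rule large_var_pos[OF L])
  have n: "1 \<le> n" using L by (simp add: large_def)
  have p: "0 < real n ^ (b - 1)" "0 < KD" using n KD_ge_1 by auto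
  have "1 \<le> KD * real n ^ (b - 1) * (\<Sum>i\<in>J n. expectation (\<lambda>\<omega>. (Z i \<omega> / ?s)\<^sup>2))"
    by (rule N.one_le_second_moments)
  also have "(\<Sum>i\<in>J n. expectation (\<lambda>\<omega>. (Z i \<omega> / ?s)\<^sup>2)) = (\<Sum>i\<in>J n. expectation (\<lambda>\<omega>. (Z i \<omega>)\<^sup>2)) / var_U n"
    using v by (simp add: power_divide sum_divide_distrib)
  finally have "var_U n \<le> KD * real n ^ (b - 1) * (\<Sum>i\<in>J n. expectation (\<lambda>\<omega>. (Z i \<omega>)\<^sup>2))"
    using v by (simp add: field_simps)
  also have "\<dots> \<le> KD * real n ^ (b - 1) * sum_sq n"
    unfolding sum_sq_def using p by (intro mult_left_mono sum_mono Z_second_moment) auto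
  finally have "\<sigma>\<^sup>2 / 2 * (real n ^ (b - 1) * real n ^ b) \<le> KD * real n ^ (b - 1) * sum_sq n"
    using L unfolding large_def power_2b(1) by linarith
  then have "real n ^ (b - 1) * (\<sigma>\<^sup>2 / 2 * real n ^ b) \<le> real n ^ (b - 1) * (KD * sum_sq n)" by (simp add: mult_ac)
  then have "\<sigma>\<^sup>2 / 2 * real n ^ b \<le> KD * sum_sq n" using p by (simp only: mult_le_cancel_left_pos)
  then show ?thesis using p by (simp add: field_simps)
qed

definition c_rate :: real where "c_rate = 1 / (2 * KD * sqrt KI)"

text \<open>The second summand of the rate suffices: by Cauchy--Schwarz over the at most \<open>KI * n ^ b\<close> index vectors, the
  fourth moments cannot be small when \<open>sum_sq n\<close> is large.\<close>

lemma rate_lower: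
  assumes L: "large n"
  shows "c_rate * real n powr (-1/2) \<le> rate M l d f X \<sigma> n" "1 / (2 * KD) \<le> factor n"
proof -
  have n: "1 \<le> n" using L by (simp add: large_def)
  have n0: "0 < real n" using n by simp
  have K: "0 < KD" "0 < KI" using KD_ge_1 KI_ge_1 by auto
  note S = sum_sq_ge[OF L]
  have pow: "real n powr (- real b) * real n ^ b = 1"
    using n0 by (simp add: powr_minus powr_realpow)
  have "1 / (2 * KD) = real n powr (- real b) / \<sigma>\<^sup>2 * (\<sigma>\<^sup>2 / (2 * KD) * real n ^ b)"
    using pow sigma_pos by (simp add: field_simps)
  also have "\<dots> \<le> factor n" unfolding factor_def using S by (intro mult_left_mono) auto
  finally show "1 / (2 * KD) \<le> factor n" .
  let ?Q = "sqrt (\<Sum>i\<in>J n. Lp_norm M 4 (ff i) ^ 4)"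
  have Q0: "0 \<le> ?Q" by (simp add: sum_nonneg)
  have h: "real n powr (real b / 2) * real n powr (real b / 2) = real n ^ b"
    using n0 by (simp add: powr_add[symmetric] powr_realpow)
  have "sqrt (card (J n)) \<le> sqrt KI * real n powr (real b / 2)"
  proof (rule real_le_lsqrt)
    show "real (card (J n)) \<le> (sqrt KI * real n powr (real b / 2))\<^sup>2"
      unfolding power_mult_distrib real_sqrt_pow2[OF less_imp_le[OF K(2)]] power2_eq_square[of "_ powr _"] h
      by (rule card_J[OF n])
  qed (use K in auto)
  then have "sqrt (card (J n)) * ?Q \<le> sqrt KI * real n powr (real b / 2) * ?Q" using Q0 by (rule mult_right_mono)
  with S sum_sq_le[of n] have "\<sigma>\<^sup>2 / (2 * KD) * real n ^ b \<le> sqrt KI * real n powr (real b / 2) * ?Q" by linarith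
  then have "real n powr (real b / 2) * (\<sigma>\<^sup>2 / (2 * KD) * real n powr (real b / 2)) \<le> real n powr (real b / 2) * (sqrt KI * ?Q)"
    unfolding h[symmetric] by (simp add: mult_ac)
  then have 1: "\<sigma>\<^sup>2 / (2 * KD) * real n powr (real b / 2) \<le> sqrt KI * ?Q"
    using n0 by (simp only: mult_le_cancel_left_pos powr_gt_zero)
  then have 2: "\<sigma>\<^sup>2 * c_rate * real n powr (real b / 2) \<le> ?Q"
    using K by (simp add: c_rate_def field_simps)
  have "c_rate * real n powr (-1/2) = real n powr (- real b / 2 - 1/2) / \<sigma>\<^sup>2 * (\<sigma>\<^sup>2 * c_rate * real n powr (real b / 2))"
  proof -
    have "real n powr (- real b / 2 - 1/2) * real n powr (real b / 2) = real n powr (-1/2)"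
      by (simp add: powr_add[symmetric])
    then show ?thesis using sigma_pos by (simp add: field_simps)
  qed
  also have "\<dots> \<le> real n powr (- real b / 2 - 1/2) / \<sigma>\<^sup>2 * ?Q" using 2 by (intro mult_left_mono) auto
  also have "\<dots> \<le> rate M l d f X \<sigma> n" by (rule rate_ge)
  finally show "c_rate * real n powr (-1/2) \<le> rate M l d f X \<sigma> n" .
qed

theorem Berry_Esseen_U:
  "\<exists>C>0. \<forall>n\<ge>1. var_U n > 0 \<longrightarrow>
    (SUP z. \<bar>prob {\<omega> \<in> space M. W1 M l d f X n \<omega> \<le> z} - std_normal_cdf z\<bar>) \<le> C * rate M l d f X \<sigma> n \<and>
    (\<forall>w \<in> borel_measurable M.
      (SUP z. \<bar>prob {\<omega> \<in> space M. W2 M m l d f X n w \<omega> \<le> z} - std_normal_cdf z\<bar>)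
        \<le> C * rate M l d f X \<sigma> n * factor n)"
proof -
  let ?r = "rate M l d f X \<sigma>"
  obtain n0 where n0: "\<And>n. n0 \<le> n \<Longrightarrow> large n"
    using eventually_large by (auto simp: eventually_sequentially)
  define H where "H = C_BE * (3 * KD * K4 / \<sigma>)"
  have H0: "0 \<le> H" unfolding H_def C_BE_def using KD_ge_1 K4_ge_1 sigma_pos by (intro mult_nonneg_nonneg) auto
  have cr: "0 < c_rate" using KD_ge_1 KI_ge_1 by (simp add: c_rate_def)
  have KD0: "0 < KD" using KD_ge_1 by simp
  define C1 where "C1 = H / c_rate * (1 + 2 * KD)"
  define g where "g n = \<bar>1 / ?r n\<bar> + \<bar>1 / (?r n * factor n)\<bar>" for n
  define C where "C = 1 + C1 + (\<Sum>n<n0. g n)"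
  have C10: "0 \<le> C1" unfolding C1_def using H0 cr KD0 by (intro mult_nonneg_nonneg divide_nonneg_pos) auto
  have g0: "0 \<le> g n" for n by (simp add: g_def)
  have Cpos: "0 < C" unfolding C_def using C10 sum_nonneg[of "{..<n0}" g] g0 by auto
  have triv: "\<bar>prob E - std_normal_cdf z\<bar> \<le> 1" for E z
    using std_normal_cdf_bounds[of z] measure_nonneg[of M E] prob_le_1[of E] by linarith
  have small: "1 \<le> C * ?r n" "1 \<le> C * ?r n * factor n" if n: "1 \<le> n" "var_U n > 0" "n < n0" for n
  proof -
    note r = rate_pos[OF n(1,2)]
    have "g n \<le> (\<Sum>n<n0. g n)" using n g0 by (intro member_le_sum) auto
    then have gC: "g n \<le> C" using C10 by (simp add: C_def)
    have gs: "1 / ?r n \<le> C" "1 / (?r n * factor n) \<le> C" using gC unfolding g_def by linarith+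
    have "1 = 1 / ?r n * ?r n" using r by simp
    also have "\<dots> \<le> C * ?r n" using gs r by (intro mult_right_mono) auto
    finally show "1 \<le> C * ?r n" .
    have "1 = 1 / (?r n * factor n) * (?r n * factor n)" using r by simp
    also have "\<dots> \<le> C * (?r n * factor n)" using gs r by (intro mult_right_mono) auto
    finally show "1 \<le> C * ?r n * factor n" by (simp add: mult.assoc)
  qed
  have big: "H * real n powr (-1/2) \<le> C * ?r n" "H * real n powr (-1/2) \<le> C * ?r n * factor n" if L: "large n" for n
  proof -
    note r = rate_lower[OF L]
    have r0: "0 \<le> ?r n" using r(1) cr by (intro order_trans[OF _ r(1)]) auto
    have "C1 \<le> C" unfolding C_def using sum_nonneg[of "{..<n0}" g] g0 by auto
    then have CC: "H / c_rate \<le> C" "H / c_rate * (2 * KD) \<le> C"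
      using H0 cr KD0 unfolding C1_def distrib_left by (smt (verit) divide_nonneg_pos mult_nonneg_nonneg mult_cancel_left2)+
    have 1: "H * real n powr (-1/2) = H / c_rate * (c_rate * real n powr (-1/2))" using cr by simp
    also have "\<dots> \<le> H / c_rate * ?r n" using r H0 cr by (intro mult_left_mono) auto
    finally have 2: "H * real n powr (-1/2) \<le> H / c_rate * ?r n" .
    also have "\<dots> \<le> C * ?r n" using CC r0 by (intro mult_right_mono) auto
    finally show "H * real n powr (-1/2) \<le> C * ?r n" .
    have "H / c_rate * ?r n = (H / c_rate * (2 * KD) * ?r n) * (1 / (2 * KD))" using KD0 by simp
    also have "\<dots> \<le> (C * ?r n) * factor n"
      using CC r r0 Cpos KD0 by (intro mult_mono mult_right_mono mult_nonneg_nonneg) auto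
    finally show "H * real n powr (-1/2) \<le> C * ?r n * factor n" using 2 by linarith
  qed
  have "(SUP z. \<bar>prob {\<omega> \<in> space M. W1 M l d f X n \<omega> \<le> z} - std_normal_cdf z\<bar>) \<le> C * ?r n \<and>
    (\<forall>w \<in> borel_measurable M.
      (SUP z. \<bar>prob {\<omega> \<in> space M. W2 M m l d f X n w \<omega> \<le> z} - std_normal_cdf z\<bar>) \<le> C * ?r n * factor n)"
    if n: "1 \<le> n" "var_U n > 0" for n
  proof (cases "n < n0")
    case True
    show ?thesis
      by (intro conjI ballI cSUP_least order_trans[OF triv] small[OF n True]) auto
  next
    case False
    then have L: "large n" using n0 by simp
    show ?thesis
      by (intro conjI ballI cSUP_least order_trans[OF Berry_Esseen_large(1)[OF L, folded H_def] big(1)[OF L]]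
          order_trans[OF Berry_Esseen_large(2)[OF L, folded H_def] big(2)[OF L]]) auto
  qed
  then show ?thesis using Cpos by blast
qed

end

theorem theorem3p9:
  fixes M :: "'a measure" and X :: "nat \<Rightarrow> 'a \<Rightarrow> real" and m l :: nat
    and d :: "nat \<Rightarrow> enat" and f :: "(nat \<Rightarrow> real) \<Rightarrow> real" and \<sigma> :: real
  assumes "prob_space M"
    and "l \<ge> 1"
    and "\<And>i. i \<ge> 1 \<Longrightarrow> X i \<in> borel_measurable M"
    and "stationary M X"
    and "m_dependent M m X"
    and "\<And>j. j \<in> {1..l - 1} \<Longrightarrow> d j \<ge> 1"
    and "f \<in> borel_measurable (Pi\<^sub>M {1..l} (\<lambda>_. borel))"
    and "\<And>n i. i \<in> index_set l d n \<Longrightarrow> integrable M (\<lambda>\<omega>. \<bar>fI l f X i \<omega>\<bar> ^ 4)"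
    and "\<sigma> > 0"
    and "(\<lambda>n. prob_space.variance M (U_stat l d f X n) / real n ^ (2 * block_number l d - 1))
           \<longlonglongrightarrow> \<sigma>\<^sup>2"
  shows "\<exists>C>0. \<forall>n\<ge>1. prob_space.variance M (U_stat l d f X n) > 0 \<longrightarrow>
    (SUP z. \<bar>measure M {\<omega> \<in> space M. W1 M l d f X n \<omega> \<le> z} - std_normal_cdf z\<bar>)
      \<le> C * rate M l d f X \<sigma> n \<and>
    (\<forall>w \<in> borel_measurable M.
      (SUP z. \<bar>measure M {\<omega> \<in> space M. W2 M m l d f X n w \<omega> \<le> z} - std_normal_cdf z\<bar>)
        \<le> C * rate M l d f X \<sigma> n
            * (real n powr (- real (block_number l d)) / \<sigma>\<^sup>2
                * (\<Sum>i\<in>index_set l d n. (Lp_norm M 2 (fI l f X i))\<^sup>2)))"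
proof -
  interpret prob_space M by fact
  interpret constrained_U_statistic M X m l d f \<sigma>
    by unfold_locales (use assms in auto)
  show ?thesis using Berry_Esseen_U unfolding factor_def sum_sq_def var_U_def .
qed

end
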